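(* Let $H^3$ be the $3$-dimensional Heisenberg group. The data $(C^*(H^3),L^2(H^3,\mathbb C^2),M_\ell)$, together with the action $(U_t)_{t\in\mathbb R^\times_+}$ of the group $\mathbb R^\times_+$ and conformal factors given by $\mu_t=t^{-1}$, constitute a conformally $\mathbb R^\times_+$-equivariant second order (order-$2$) spectral triple.
   Context: $H^3$ is the group of real upper unitriangular matrices $(a,b,c)=\begin{pmatrix}1&a&c\\&1&b\\&&1\end{pmatrix}$, so $(a,b,c)(a',b',c')=(a+a',b+b',c+c'+ab')$. $C^*(H^3)$ acts on $L^2(H^3,\mathbb C^2)$ by the left regular representation (acting trivially on $\mathbb C^2$). $\mathbb R^\times_+$ is the multiplicative group of positive reals; it acts on $H^3$ by the automorphisms $(a,b,c)\mapsto(ta,tb,t^2c)$ and by the induced automorphisms on $C^*(H^3)$, implemented on $L^2(H^3,\mathbb C^2)$ by the unitaries $(U_t\xi)(a,b,c)=t^{-2}\xi(t^{-1}a,t^{-1}b,t^{-2}c)$. Let $\gamma_1,\gamma_2,\gamma_3$ be mutually anticommuting self-adjoint unitary $2\times2$ matrices generating the Clifford algebra action of $\mathscr{C}\ell_3$ on $\mathbb C^2$, and let $\ell(a,b,c)=(a\gamma_1+b\gamma_2)(a^2+b^2)^{1/2}+c\gamma_3$; $M_\ell$ is the self-adjoint operator of multiplication by $\ell$. For $D$ self-adjoint on a Hilbert space $H$, $\langle D\rangle=(1+D^2)^{1/2}$. $\operatorname{Lip}^*_\alpha(D)$ is the $*$-algebra of bounded operators $a$ on $H$ with $a\operatorname{dom}D\subseteq\operatorname{dom}D$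 such that $[D,a]\langle D\rangle^{-\alpha}$ and $\langle D\rangle^{-\alpha}[D,a]$ extend to bounded operators. For $0\le\alpha<1$ an order-$\frac1{1-\alpha}$ spectral triple $(A,H,D)$ is a C*-algebra $A$ represented on $H$ with $D$ self-adjoint, $(1+D^2)^{-1}a$ compact for all $a\in A$, and $A$ contained in the norm closure of $\operatorname{Lip}^*_\alpha(D)$. Order $2$ (second order) means $\alpha=1/2$. For a locally compact group $G$ acting on $A$, with a strongly continuous unitary representation $U$ of $G$ on $H$ implementing the action, an order-$\frac1{1-\alpha}$ spectral triple is conformally $G$-equivariant with conformal factors $(\mu_g)_{g\in G}$ if $(\mu_g)_{g\in G}\subseteq B(H)$ is a $*$-strongly continuous family of invertible operators such that $A\subseteq\overline{\operatorname{span}}(A\mathscr Q)\cap\overline{\operatorname{span}}(\mathscr QA)$ (norm-closed linear spans), where $\mathscr Q$ is the set of $a\in\operatorname{Lip}^*_\alpha(D)$ such that for all $g\in G$ one has $\{a\mu_g,a\mu_g^{-1*}\}\operatorname{dom}D\subseteq\operatorname{dom}D\cap U_g\operatorname{dom}D$, and the maps $g\mapsto(U_gDU_g^*a-a\mu_gD\mu_g^* )\mu_g^{-1*}\langle D\rangle^{-\alpha}$, $g\mapsto U_g\langle D\rangle^{-\alpha}U_g^*(U_gDU_g^*a-a\mu_gD\mu_g^* )$, $g\mapsto[D,a\mu_g]\langle D\rangle^{-\alpha}$, $g\mapsto\langle D\rangle^{-\alpha}[D,a\mu_g]$, $g\mapsto[D,a\mu_g^{-1*}]\langle D\rangle^{-\alpha}$,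 $g\mapsto\langle D\rangle^{-\alpha}[D,a\mu_g^{-1*}]$ are $*$-strongly continuous from $G$ into bounded operators. *)

theory Defs
  imports "HOL-Analysis.Analysis" "HOL-Algebra.Group" "HOL-Computational_Algebra.Polynomial"
begin

section \<open>Complex Hilbert spaces and C*-algebras\<close>

class complex_normed_vector = real_normed_vector +
  fixes scaleC :: "complex \<Rightarrow> 'a \<Rightarrow> 'a"  (infixr "*\<^sub>C" 75)
  assumes scaleC_add_right: "c *\<^sub>C (x + y) = c *\<^sub>C x + c *\<^sub>C y"
    and scaleC_add_left: "(c + d) *\<^sub>C x = c *\<^sub>C x + d *\<^sub>C x"
    and scaleC_scaleC: "c *\<^sub>C d *\<^sub>C x = (c * d) *\<^sub>C x"
    and scaleR_scaleC: "r *\<^sub>R x = complex_of_real r *\<^sub>C x"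
    and norm_scaleC: "norm (c *\<^sub>C x) = cmod c * norm x"

text \<open>The inner product is conjugate linear in the first variable.\<close>

class chilbert_space = complex_normed_vector + banach +
  fixes cinner :: "'a \<Rightarrow> 'a \<Rightarrow> complex"
  assumes cinner_commute: "cinner x y = cnj (cinner y x)"
    and cinner_add_right: "cinner x (y + z) = cinner x y + cinner x z"
    and cinner_scaleC_right: "cinner x (c *\<^sub>C y) = c * cinner x y"
    and cinner_self: "cinner x x = complex_of_real ((norm x)\<^sup>2)"

class cstar_algebra = complex_normed_vector + banach + real_normed_algebra +
  fixes star :: "'a \<Rightarrow> 'a"
  assumes mult_scaleC_left: "(c *\<^sub>C x) * y = c *\<^sub>C (x * y)"
    and mult_scaleC_right: "x * (c *\<^sub>C y) = c *\<^sub>C (x * y)"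
    and star_star: "star (star x) = x"
    and star_add: "star (x + y) = star x + star y"
    and star_scaleC: "star (c *\<^sub>C x) = cnj c *\<^sub>C star x"
    and star_mult: "star (x * y) = star y * star x"
    and cstar_identity: "norm (star x * x) = (norm x)\<^sup>2"


section \<open>Bounded operators\<close>

text \<open>\<open>'h \<Rightarrow>\<^sub>L 'h\<close> consists of the bounded \<^emph>\<open>real\<close>-linear maps; \<open>B(H)\<close> is cut out by
  the following predicate.\<close>

definition bop :: "('h::chilbert_space \<Rightarrow>\<^sub>L 'h) \<Rightarrow> bool" where
  "bop T \<longleftrightarrow> (\<forall>c x. T (c *\<^sub>C x) = c *\<^sub>C T x)"

definition is_adjoint :: "('h::chilbert_space \<Rightarrow>\<^sub>L 'h) \<Rightarrow> ('h \<Rightarrow>\<^sub>L 'h) \<Rightarrow> bool" where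
  "is_adjoint T S \<longleftrightarrow> (\<forall>x y. cinner (T x) y = cinner x (S y))"

definition adj :: "('h::chilbert_space \<Rightarrow>\<^sub>L 'h) \<Rightarrow> ('h \<Rightarrow>\<^sub>L 'h)" where
  "adj T = (THE S. is_adjoint T S)"

definition invertible_op :: "('h::chilbert_space \<Rightarrow>\<^sub>L 'h) \<Rightarrow> bool" where
  "invertible_op T \<longleftrightarrow> (\<exists>S. S o\<^sub>L T = id_blinfun \<and> T o\<^sub>L S = id_blinfun)"

definition inv_op :: "('h::chilbert_space \<Rightarrow>\<^sub>L 'h) \<Rightarrow> ('h \<Rightarrow>\<^sub>L 'h)" where
  "inv_op T = (THE S. S o\<^sub>L T = id_blinfun \<and> T o\<^sub>L S = id_blinfun)"

definition unitary_op :: "('h::chilbert_space \<Rightarrow>\<^sub>L 'h) \<Rightarrow> bool" where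
  "unitary_op U \<longleftrightarrow> bop U \<and> (\<forall>x y. cinner (U x) (U y) = cinner x y) \<and> surj (blinfun_apply U)"

definition compact_op :: "('h::chilbert_space \<Rightarrow>\<^sub>L 'h) \<Rightarrow> bool" where
  "compact_op T \<longleftrightarrow> compact (closure (blinfun_apply T ` cball 0 1))"

definition op_poly :: "real poly \<Rightarrow> ('h::chilbert_space \<Rightarrow>\<^sub>L 'h) \<Rightarrow> ('h \<Rightarrow>\<^sub>L 'h)" where
  "op_poly p T = (\<Sum>i\<le>degree p. coeff p i *\<^sub>R ((\<lambda>S. T o\<^sub>L S) ^^ i) id_blinfun)"

text \<open>Continuous functional calculus of a positive bounded operator \<open>T\<close>, whose spectrum lies in
  \<open>[0, \<parallel>T\<parallel>]\<close>: \<open>f(T)\<close> is the norm limit of \<open>p(T)\<close> as the polynomials \<open>p\<close> tend to \<open>f\<close>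
  uniformly on \<open>[0, \<parallel>T\<parallel>]\<close>.\<close>

definition pos_calculus :: "(real \<Rightarrow> real) \<Rightarrow> ('h::chilbert_space \<Rightarrow>\<^sub>L 'h) \<Rightarrow> ('h \<Rightarrow>\<^sub>L 'h)" where
  "pos_calculus f T = (THE S. \<forall>\<epsilon>>0. \<exists>\<delta>>0. \<forall>p.
     (\<forall>x\<in>{0..norm T}. \<bar>poly p x - f x\<bar> \<le> \<delta>) \<longrightarrow> norm (op_poly p T - S) \<le> \<epsilon>)"


section \<open>Unbounded operators\<close>

text \<open>A possibly unbounded operator is identified with its graph, so that inclusion of graphs is
  extension of operators and \<^const>\<open>Domain\<close> is the domain. Products and differences carry
  their maximal domains.\<close>

type_synonym 'h oper = "('h \<times> 'h) set"

definition gr :: "('h::chilbert_space \<Rightarrow>\<^sub>L 'h) \<Rightarrow> 'h oper" where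
  "gr T = {(x, T x) |x. True}"

definition op_times :: "'h oper \<Rightarrow> 'h oper \<Rightarrow> 'h oper"  (infixl "\<odot>" 70) where
  "S \<odot> T = T O S"

definition op_minus :: "'h::chilbert_space oper \<Rightarrow> 'h oper \<Rightarrow> 'h oper"  (infixl "\<ominus>" 65) where
  "S \<ominus> T = {(x, y - z) |x y z. (x, y) \<in> S \<and> (x, z) \<in> T}"

definition adjoint_op :: "'h::chilbert_space oper \<Rightarrow> 'h oper" where
  "adjoint_op D = {(y, z). \<forall>(x, w)\<in>D. cinner w y = cinner x z}"

definition selfadjoint :: "'h::chilbert_space oper \<Rightarrow> bool" where
  "selfadjoint D \<longleftrightarrow> closure (Domain D) = UNIV \<and> adjoint_op D = D"

definition bounded_extension :: "'h::chilbert_space oper \<Rightarrow> ('h \<Rightarrow>\<^sub>L 'h) \<Rightarrow> bool" where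
  "bounded_extension F B \<longleftrightarrow> bop B \<and> F \<subseteq> gr B"

definition commutator :: "'h::chilbert_space oper \<Rightarrow> ('h \<Rightarrow>\<^sub>L 'h) \<Rightarrow> 'h oper" where
  "commutator D a = D \<odot> gr a \<ominus> gr a \<odot> D"

text \<open>\<open>(1 + D\<^sup>2)\<^sup>-\<^sup>1\<close>; the graph on the right is the converse of that of \<open>1 + D\<^sup>2\<close>.\<close>

definition inv_one_plus_sq :: "'h::chilbert_space oper \<Rightarrow> ('h \<Rightarrow>\<^sub>L 'h)" where
  "inv_one_plus_sq D = (THE R. gr R = {(x + z, x) |x y z. (x, y) \<in> D \<and> (y, z) \<in> D})"

text \<open>\<open>\<langle>D\<rangle>\<^sup>-\<^sup>\<alpha> = ((1 + D\<^sup>2)\<^sup>-\<^sup>1)\<^bsup>\<alpha>/2\<^esup>\<close>. The case distinction is needed because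
  \<^prop>\<open>(0::real) powr 0 = 0\<close>.\<close>

definition bracket_neg_power :: "real \<Rightarrow> 'h::chilbert_space oper \<Rightarrow> ('h \<Rightarrow>\<^sub>L 'h)" where
  "bracket_neg_power \<alpha> D =
     pos_calculus (\<lambda>x. if \<alpha> = 0 then 1 else x powr (\<alpha> / 2)) (inv_one_plus_sq D)"


section \<open>Higher-order spectral triples\<close>

definition star_representation :: "('a::cstar_algebra \<Rightarrow> ('h::chilbert_space \<Rightarrow>\<^sub>L 'h)) \<Rightarrow> bool" where
  "star_representation \<pi> \<longleftrightarrow>
     (\<forall>a. bop (\<pi> a)) \<and>
     (\<forall>a b. \<pi> (a + b) = \<pi> a + \<pi> b) \<and>
     (\<forall>c a x. \<pi> (c *\<^sub>C a) x = c *\<^sub>C \<pi> a x) \<and>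
     (\<forall>a b. \<pi> (a * b) = \<pi> a o\<^sub>L \<pi> b) \<and>
     (\<forall>a. is_adjoint (\<pi> a) (\<pi> (star a)))"

text \<open>The operators extended here and below are densely defined, so the extensions are unique.\<close>

definition Lip :: "real \<Rightarrow> 'h::chilbert_space oper \<Rightarrow> ('h \<Rightarrow>\<^sub>L 'h) set" where
  "Lip \<alpha> D = {a. bop a \<and> blinfun_apply a ` Domain D \<subseteq> Domain D \<and>
     (\<exists>B. bounded_extension (commutator D a \<odot> gr (bracket_neg_power \<alpha> D)) B) \<and>
     (\<exists>B. bounded_extension (gr (bracket_neg_power \<alpha> D) \<odot> commutator D a) B)}"

text \<open>A spectral triple of order \<open>1 / (1 - \<alpha>)\<close>.\<close>

definition spectral_triple ::
  "real \<Rightarrow> ('a::cstar_algebra \<Rightarrow> ('h::chilbert_space \<Rightarrow>\<^sub>L 'h)) \<Rightarrow> 'h oper \<Rightarrow> bool" where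
  "spectral_triple \<alpha> \<pi> D \<longleftrightarrow>
     0 \<le> \<alpha> \<and> \<alpha> < 1 \<and>
     star_representation \<pi> \<and>
     selfadjoint D \<and>
     (\<forall>a. compact_op (inv_one_plus_sq D o\<^sub>L \<pi> a)) \<and>
     range \<pi> \<subseteq> closure (Lip \<alpha> D)"


section \<open>Conformal equivariance\<close>

definition locally_compact_group :: "('g, 'x) monoid_scheme \<Rightarrow> 'g topology \<Rightarrow> bool" where
  "locally_compact_group G X \<longleftrightarrow>
     group G \<and> topspace X = carrier G \<and> Hausdorff_space X \<and> locally_compact_space X \<and>
     continuous_map (prod_topology X X) X (\<lambda>(g, h). g \<otimes>\<^bsub>G\<^esub> h) \<and>
     continuous_map X X (\<lambda>g. inv\<^bsub>G\<^esub> g)"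

definition strongly_continuous :: "'g topology \<Rightarrow> ('g \<Rightarrow> ('h::chilbert_space \<Rightarrow>\<^sub>L 'h)) \<Rightarrow> bool" where
  "strongly_continuous X F \<longleftrightarrow> (\<forall>x. continuous_map X euclidean (\<lambda>g. F g x))"

definition star_strongly_continuous ::
  "'g topology \<Rightarrow> ('g \<Rightarrow> ('h::chilbert_space \<Rightarrow>\<^sub>L 'h)) \<Rightarrow> bool" where
  "star_strongly_continuous X F \<longleftrightarrow>
     strongly_continuous X F \<and> strongly_continuous X (\<lambda>g. adj (F g))"

definition star_automorphism :: "('a::cstar_algebra \<Rightarrow> 'a) \<Rightarrow> bool" where
  "star_automorphism \<phi> \<longleftrightarrow> bij \<phi> \<and>
     (\<forall>a b. \<phi> (a + b) = \<phi> a + \<phi> b) \<and> (\<forall>c a. \<phi> (c *\<^sub>C a) = c *\<^sub>C \<phi> a) \<and>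
     (\<forall>a b. \<phi> (a * b) = \<phi> a * \<phi> b) \<and> (\<forall>a. \<phi> (star a) = star (\<phi> a))"

definition cstar_action ::
  "('g, 'x) monoid_scheme \<Rightarrow> 'g topology \<Rightarrow> ('g \<Rightarrow> 'a::cstar_algebra \<Rightarrow> 'a) \<Rightarrow> bool" where
  "cstar_action G X act \<longleftrightarrow>
     (\<forall>g\<in>carrier G. star_automorphism (act g)) \<and>
     act \<one>\<^bsub>G\<^esub> = id \<and>
     (\<forall>g\<in>carrier G. \<forall>h\<in>carrier G. act (g \<otimes>\<^bsub>G\<^esub> h) = act g \<circ> act h) \<and>
     (\<forall>a. continuous_map X euclidean (\<lambda>g. act g a))"

definition unitary_representation ::
  "('g, 'x) monoid_scheme \<Rightarrow> 'g topology \<Rightarrow> ('g \<Rightarrow> ('h::chilbert_space \<Rightarrow>\<^sub>L 'h)) \<Rightarrow> bool" where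
  "unitary_representation G X U \<longleftrightarrow>
     (\<forall>g\<in>carrier G. unitary_op (U g)) \<and>
     U \<one>\<^bsub>G\<^esub> = id_blinfun \<and>
     (\<forall>g\<in>carrier G. \<forall>h\<in>carrier G. U (g \<otimes>\<^bsub>G\<^esub> h) = U g o\<^sub>L U h) \<and>
     strongly_continuous X U"

definition star_strongly_continuous_extension ::
  "'g topology \<Rightarrow> ('g \<Rightarrow> 'h::chilbert_space oper) \<Rightarrow> bool" where
  "star_strongly_continuous_extension X F \<longleftrightarrow>
     (\<exists>B. (\<forall>g\<in>topspace X. bounded_extension (F g) (B g)) \<and> star_strongly_continuous X B)"

text \<open>\<open>U\<^sub>g D U\<^sub>g\<^sup>* a - a \<mu>\<^sub>g D \<mu>\<^sub>g\<^sup>*\<close>\<close>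

definition conformal_defect ::
  "'h::chilbert_space oper \<Rightarrow> ('g \<Rightarrow> ('h \<Rightarrow>\<^sub>L 'h)) \<Rightarrow> ('g \<Rightarrow> ('h \<Rightarrow>\<^sub>L 'h)) \<Rightarrow> ('h \<Rightarrow>\<^sub>L 'h) \<Rightarrow> 'g \<Rightarrow> 'h oper"
  where
  "conformal_defect D U \<mu> a g =
     gr (U g) \<odot> D \<odot> gr (adj (U g)) \<odot> gr a \<ominus> gr a \<odot> gr (\<mu> g) \<odot> D \<odot> gr (adj (\<mu> g))"

definition conformal_multipliers ::
  "real \<Rightarrow> ('g, 'x) monoid_scheme \<Rightarrow> 'g topology \<Rightarrow> 'h::chilbert_space oper \<Rightarrow>
   ('g \<Rightarrow> ('h \<Rightarrow>\<^sub>L 'h)) \<Rightarrow> ('g \<Rightarrow> ('h \<Rightarrow>\<^sub>L 'h)) \<Rightarrow> ('h \<Rightarrow>\<^sub>L 'h) set"  where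
  "conformal_multipliers \<alpha> G X D U \<mu> = {a \<in> Lip \<alpha> D.
     (let R = bracket_neg_power \<alpha> D; \<nu> = (\<lambda>g. adj (inv_op (\<mu> g))) in
       (\<forall>g\<in>carrier G.
          (a o\<^sub>L \<mu> g) ` Domain D \<union> (a o\<^sub>L \<nu> g) ` Domain D \<subseteq> Domain D \<inter> U g ` Domain D) \<and>
       star_strongly_continuous_extension X (\<lambda>g. conformal_defect D U \<mu> a g \<odot> gr (\<nu> g) \<odot> gr R) \<and>
       star_strongly_continuous_extension X
         (\<lambda>g. gr (U g) \<odot> gr R \<odot> gr (adj (U g)) \<odot> conformal_defect D U \<mu> a g) \<and>
       star_strongly_continuous_extension X (\<lambda>g. commutator D (a o\<^sub>L \<mu> g) \<odot> gr R) \<and>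
       star_strongly_continuous_extension X (\<lambda>g. gr R \<odot> commutator D (a o\<^sub>L \<mu> g)) \<and>
       star_strongly_continuous_extension X (\<lambda>g. commutator D (a o\<^sub>L \<nu> g) \<odot> gr R) \<and>
       star_strongly_continuous_extension X (\<lambda>g. gr R \<odot> commutator D (a o\<^sub>L \<nu> g)))}"

text \<open>The real \<^const>\<open>span\<close> below is the complex one, as the sets of products are closed under
  multiplication by complex scalars.\<close>

definition conformally_equivariant_spectral_triple ::
  "real \<Rightarrow> ('g, 'x) monoid_scheme \<Rightarrow> 'g topology \<Rightarrow> ('g \<Rightarrow> 'a::cstar_algebra \<Rightarrow> 'a) \<Rightarrow>
   ('a \<Rightarrow> ('h::chilbert_space \<Rightarrow>\<^sub>L 'h)) \<Rightarrow> 'h oper \<Rightarrow> ('g \<Rightarrow> ('h \<Rightarrow>\<^sub>L 'h)) \<Rightarrow> ('g \<Rightarrow> ('h \<Rightarrow>\<^sub>L 'h)) \<Rightarrow> bool"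
  where
  "conformally_equivariant_spectral_triple \<alpha> G X act \<pi> D U \<mu> \<longleftrightarrow>
     spectral_triple \<alpha> \<pi> D \<and>
     locally_compact_group G X \<and>
     cstar_action G X act \<and>
     unitary_representation G X U \<and>
     (\<forall>g\<in>carrier G. \<forall>a. \<pi> (act g a) = U g o\<^sub>L \<pi> a o\<^sub>L adj (U g)) \<and>
     (\<forall>g\<in>carrier G. bop (\<mu> g) \<and> invertible_op (\<mu> g)) \<and>
     star_strongly_continuous X \<mu> \<and>
     (let Q = conformal_multipliers \<alpha> G X D U \<mu> in
       range \<pi> \<subseteq> closure (span {\<pi> a o\<^sub>L q |a q. q \<in> Q}) \<inter> closure (span {q o\<^sub>L \<pi> a |a q. q \<in> Q}))"

subsection \<open>Adjoints and limits of bounded operators\<close>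

lemma cinner_add_left: "cinner (x + y) z = cinner x z + cinner (y :: 'h::chilbert_space) z"
  by (metis cinner_add_right cinner_commute complex_cnj_add)

lemma cinner_scaleC_left: "cinner (c *\<^sub>C x) y = cnj c * cinner x (y :: 'h::chilbert_space)"
  by (metis cinner_scaleC_right cinner_commute complex_cnj_mult)

lemma cinner_scaleR_left: "cinner (r *\<^sub>R x) y = r *\<^sub>R cinner x (y :: 'h::chilbert_space)"
  by (simp add: scaleR_scaleC cinner_scaleC_left scaleR_conv_of_real)

lemma cinner_scaleR_right: "cinner x (r *\<^sub>R y) = r *\<^sub>R cinner x (y :: 'h::chilbert_space)"
  by (simp add: scaleR_scaleC cinner_scaleC_right scaleR_conv_of_real)

lemma cinner_zero_left [simp]: "cinner 0 y = (0 :: complex)" for y :: "'h::chilbert_space"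
  using cinner_scaleR_left[of 0 0 y] by simp

lemma cinner_zero_right [simp]: "cinner y 0 = (0 :: complex)" for y :: "'h::chilbert_space"
  using cinner_scaleR_right[of y 0 0] by simp

lemma cinner_minus_left: "cinner (x - y) z = cinner x z - cinner (y :: 'h::chilbert_space) z"
  using cinner_add_left[of "x - y" y z] by simp

lemma cinner_minus_right: "cinner z (x - y) = cinner z x - cinner z (y :: 'h::chilbert_space)"
  using cinner_add_right[of z "x - y" y] by simp

lemma norm_cinner_le: "cmod (cinner x y) \<le> norm x * norm (y :: 'h::chilbert_space)"
proof (cases "y = 0")
  case False
  define n where "n = norm y"
  have n: "n > 0" using False by (simp add: n_def)
  define c where "c = cinner y x"
  define z where "z = complex_of_real (n\<^sup>2) *\<^sub>C x - c *\<^sub>C y"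
  have yy: "cinner y y = complex_of_real (n\<^sup>2)" and xx: "cinner x x = complex_of_real ((norm x)\<^sup>2)"
    by (simp_all add: cinner_self n_def)
  have xy: "cinner x y = cnj c" unfolding c_def by (rule cinner_commute)
  have yz: "cinner y z = 0"
    by (simp add: z_def cinner_minus_right cinner_scaleC_right yy c_def[symmetric])
  have "cinner z w = complex_of_real (n\<^sup>2) * cinner x w - cnj c * cinner y w" for w
    by (simp add: z_def cinner_minus_left cinner_scaleC_left)
  then have "cinner z z = complex_of_real (n\<^sup>2) * cinner x z"
    by (simp add: yz)
  also have "cinner x z = complex_of_real (n\<^sup>2 * (norm x)\<^sup>2 - (cmod c)\<^sup>2)"
    by (simp add: z_def cinner_minus_right cinner_scaleC_right xx xy complex_norm_square del: of_real_power)
  finally have "complex_of_real ((norm z)\<^sup>2) = complex_of_real (n\<^sup>2 * (n\<^sup>2 * (norm x)\<^sup>2 - (cmod c)\<^sup>2))"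
    unfolding cinner_self by (simp only: of_real_mult)
  then have "(norm z)\<^sup>2 = n\<^sup>2 * (n\<^sup>2 * (norm x)\<^sup>2 - (cmod c)\<^sup>2)"
    by (simp only: of_real_eq_iff)
  then have "0 \<le> n\<^sup>2 * (n\<^sup>2 * (norm x)\<^sup>2 - (cmod c)\<^sup>2)"
    by (metis zero_le_power2)
  then have "(cmod c)\<^sup>2 \<le> (norm x * n)\<^sup>2"
    using n by (simp add: zero_le_mult_iff power_mult_distrib mult.commute)
  then have "cmod c \<le> norm x * n"
    by (rule power2_le_imp_le) (use n in simp)
  then show ?thesis by (simp add: xy n_def)
qed simp

lemma bounded_bilinear_cinner:
  "bounded_bilinear (cinner :: 'h::chilbert_space \<Rightarrow> 'h \<Rightarrow> complex)"
  by standard (auto simp: cinner_add_left cinner_add_right cinner_scaleR_left cinner_scaleR_right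
      intro!: exI[of _ 1] norm_cinner_le)

lemma norm_is_adjoint_le: "is_adjoint T S \<Longrightarrow> norm S \<le> norm T"
proof (rule norm_blinfun_bound)
  fix y assume TS: "is_adjoint T S"
  have "(norm (S y))\<^sup>2 = cmod (cinner (S y) (S y))" by (simp add: cinner_self norm_power)
  also have "\<dots> = cmod (cinner (T (S y)) y)" using TS by (simp add: is_adjoint_def)
  also have "\<dots> \<le> norm (T (S y)) * norm y" by (rule norm_cinner_le)
  also have "\<dots> \<le> norm T * norm (S y) * norm y" by (intro mult_right_mono norm_blinfun) simp
  finally have "norm (S y) * norm (S y) \<le> norm (S y) * (norm T * norm y)"
    by (simp add: power2_eq_square mult_ac)
  then show "norm (S y) \<le> norm T * norm y"
    by (cases "S y = 0") (simp_all add: mult_le_cancel_left)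
qed simp

lemma is_adjoint_sym: "is_adjoint T S \<Longrightarrow> is_adjoint S T"
  unfolding is_adjoint_def by (metis cinner_commute)

lemma is_adjoint_unique: "is_adjoint T S \<Longrightarrow> is_adjoint T S' \<Longrightarrow> S = S'"
proof (rule blinfun_eqI)
  fix x assume "is_adjoint T S" "is_adjoint T S'"
  then have "cinner y (S x - S' x) = 0" for y by (simp add: is_adjoint_def cinner_minus_right)
  from this[of "S x - S' x"] show "S x = S' x" by (simp add: cinner_self)
qed

lemma adj_eqI: "is_adjoint T S \<Longrightarrow> adj T = S"
  unfolding adj_def using is_adjoint_unique by blast

lemma is_adjoint_diff: "is_adjoint T S \<Longrightarrow> is_adjoint T' S' \<Longrightarrow> is_adjoint (T - T') (S - S')"
  by (simp add: is_adjoint_def blinfun.diff_left cinner_minus_left cinner_minus_right)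

lemma is_adjoint_add: "is_adjoint T S \<Longrightarrow> is_adjoint T' S' \<Longrightarrow> is_adjoint (T + T') (S + S')"
  by (simp add: is_adjoint_def blinfun.add_left cinner_add_left cinner_add_right)

lemma is_adjoint_compose: "is_adjoint T S \<Longrightarrow> is_adjoint T' S' \<Longrightarrow> is_adjoint (T o\<^sub>L T') (S' o\<^sub>L S)"
  by (simp add: is_adjoint_def)

lemma is_adjoint_cstar: "is_adjoint T S \<Longrightarrow> norm (S o\<^sub>L T) = (norm T)\<^sup>2"
proof (rule antisym)
  assume TS: "is_adjoint T S"
  have nS: "norm S = norm T"
    using norm_is_adjoint_le[OF TS] norm_is_adjoint_le[OF is_adjoint_sym[OF TS]] by simp
  show "norm (S o\<^sub>L T) \<le> (norm T)\<^sup>2"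
    using norm_blinfun_compose[of S T] by (simp add: nS power2_eq_square)
  have "norm T \<le> sqrt (norm (S o\<^sub>L T))"
  proof (rule norm_blinfun_bound)
    fix x
    have "(norm (T x))\<^sup>2 = cmod (cinner (T x) (T x))" by (simp add: cinner_self norm_power)
    also have "\<dots> = cmod (cinner x ((S o\<^sub>L T) x))" using TS by (simp add: is_adjoint_def)
    also have "\<dots> \<le> norm x * norm ((S o\<^sub>L T) x)" by (rule norm_cinner_le)
    also have "\<dots> \<le> norm x * (norm (S o\<^sub>L T) * norm x)" by (intro mult_left_mono norm_blinfun) simp
    also have "\<dots> = (sqrt (norm (S o\<^sub>L T)) * norm x)\<^sup>2"
      by (simp add: power_mult_distrib power2_eq_square)
    finally show "norm (T x) \<le> sqrt (norm (S o\<^sub>L T)) * norm x"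
      by (rule power2_le_imp_le) simp
  qed simp
  then have "(norm T)\<^sup>2 \<le> (sqrt (norm (S o\<^sub>L T)))\<^sup>2" by (rule power_mono) simp
  then show "(norm T)\<^sup>2 \<le> norm (S o\<^sub>L T)" by simp
qed

lemma is_adjoint_limit:
  assumes "\<And>n. is_adjoint (T n) (S n)" "T \<longlonglongrightarrow> A"
  shows "\<exists>B. is_adjoint A B"
proof -
  have "Cauchy S"
  proof (rule CauchyI)
    fix e :: real assume "e > 0"
    from LIMSEQ_imp_Cauchy[OF assms(2)] \<open>e > 0\<close>
    obtain M where "\<forall>m\<ge>M. \<forall>n\<ge>M. norm (T m - T n) < e" by (blast dest: CauchyD)
    then show "\<exists>M. \<forall>m\<ge>M. \<forall>n\<ge>M. norm (S m - S n) < e"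
      using norm_is_adjoint_le[OF is_adjoint_diff[OF assms(1) assms(1)]] by (meson order_le_less_trans)
  qed
  from Cauchy_convergent[OF this] obtain B where B: "S \<longlonglongrightarrow> B"
    unfolding convergent_def by blast
  have "cinner (A x) y = cinner x (B y)" for x y
  proof (rule LIMSEQ_unique)
    have "(\<lambda>n. T n x) \<longlonglongrightarrow> A x" by (intro tendsto_intros assms)
    then show "(\<lambda>n. cinner (T n x) y) \<longlonglongrightarrow> cinner (A x) y"
      by (intro bounded_bilinear.tendsto[OF bounded_bilinear_cinner] tendsto_const)
    have "(\<lambda>n. S n y) \<longlonglongrightarrow> B y" by (intro tendsto_intros B)
    then have "(\<lambda>n. cinner x (S n y)) \<longlonglongrightarrow> cinner x (B y)"
      by (intro bounded_bilinear.tendsto[OF bounded_bilinear_cinner] tendsto_const)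
    then show "(\<lambda>n. cinner (T n x) y) \<longlonglongrightarrow> cinner x (B y)"
      using assms(1) by (simp add: is_adjoint_def)
  qed
  then show ?thesis unfolding is_adjoint_def by blast
qed

lift_definition scalar_op :: "complex \<Rightarrow> ('h::chilbert_space \<Rightarrow>\<^sub>L 'h)" is "\<lambda>c x. c *\<^sub>C x"
proof -
  fix c :: complex
  show "bounded_linear (\<lambda>x :: 'h. c *\<^sub>C x)"
    by (rule bounded_linear_intro[where K = "cmod c"])
      (simp_all add: scaleC_add_right scaleR_scaleC scaleC_scaleC norm_scaleC mult.commute)
qed

lemma scalar_op_apply [simp]: "scalar_op c x = c *\<^sub>C x"
  by (simp add: scalar_op.rep_eq)

lemma norm_scalar_op_compose: "norm (scalar_op c o\<^sub>L T) = cmod c * norm T"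
proof (rule antisym)
  show "norm (scalar_op c o\<^sub>L T) \<le> cmod c * norm T"
    by (rule norm_blinfun_bound) (simp_all add: norm_scaleC mult.assoc mult_left_mono norm_blinfun)
  show "cmod c * norm T \<le> norm (scalar_op c o\<^sub>L T)"
  proof (cases "c = 0")
    case False
    have "norm T \<le> norm (scalar_op c o\<^sub>L T) / cmod c"
    proof (rule norm_blinfun_bound)
      fix x
      show "norm (T x) \<le> norm (scalar_op c o\<^sub>L T) / cmod c * norm x"
        using norm_blinfun[of "scalar_op c o\<^sub>L T" x] False
        by (simp add: norm_scaleC field_simps)
    qed simp
    then show ?thesis using False by (simp add: field_simps)
  qed simp
qed

lemma bop_limit:
  assumes "\<And>n. bop (T n)" "T \<longlonglongrightarrow> A" shows "bop A"
  unfolding bop_def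
proof (intro allI)
  fix c x
  have "(\<lambda>n. T n (c *\<^sub>C x)) \<longlonglongrightarrow> A (c *\<^sub>C x)" by (intro tendsto_intros assms)
  moreover have "(\<lambda>n. scalar_op c (T n x)) \<longlonglongrightarrow> scalar_op c (A x)" by (intro tendsto_intros assms)
  ultimately show "A (c *\<^sub>C x) = c *\<^sub>C A x"
    using assms(1) LIMSEQ_unique by (fastforce simp: bop_def)
qed

section \<open>The Heisenberg group\<close>

text \<open>\<open>(a, b, c)\<close> stands for the unitriangular matrix \<open>heis_matrix (a, b, c)\<close>.\<close>

type_synonym heis = "real \<times> real \<times> real"

definition heis_mult :: "heis \<Rightarrow> heis \<Rightarrow> heis" where
  "heis_mult = (\<lambda>(a, b, c) (a', b', c'). (a + a', b + b', c + c' + a * b'))"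

definition heis_inv :: "heis \<Rightarrow> heis" where
  "heis_inv = (\<lambda>(a, b, c). (- a, - b, a * b - c))"

definition heis_matrix :: "heis \<Rightarrow> real^3^3" where
  "heis_matrix = (\<lambda>(a, b, c). vector [vector [1, a, c], vector [0, 1, b], vector [0, 0, 1]])"

lemma heis_matrix_mult: "heis_matrix (heis_mult x y) = heis_matrix x ** heis_matrix y"
  by (cases x; cases y)
    (simp add: heis_matrix_def heis_mult_def matrix_matrix_mult_def vec_eq_iff forall_3 sum_3 algebra_simps)

lemma heis_matrix_inv: "heis_matrix x ** heis_matrix (heis_inv x) = mat 1"
  by (cases x)
    (simp add: heis_matrix_def heis_inv_def matrix_matrix_mult_def mat_def vec_eq_iff forall_3 sum_3)

section \<open>The Hilbert space of square integrable functions with values in C2\<close>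

definition square_integrable :: "(heis \<Rightarrow> complex^2) \<Rightarrow> bool" where
  "square_integrable \<xi> \<longleftrightarrow> \<xi> \<in> borel_measurable lborel \<and> integrable lborel (\<lambda>x. (norm (\<xi> x))\<^sup>2)"

quotient_type L2_heis = "heis \<Rightarrow> complex^2" /
  partial: "\<lambda>\<xi> \<eta>. square_integrable \<xi> \<and> square_integrable \<eta> \<and> (AE x in lborel. \<xi> x = \<eta> x)"
proof (rule part_equivpI)
  show "\<exists>\<xi>. square_integrable \<xi> \<and> square_integrable \<xi> \<and> (AE x in lborel. \<xi> x = \<xi> x)"
    by (rule exI[of _ "\<lambda>_. 0"]) (simp add: square_integrable_def)
  show "symp (\<lambda>\<xi> \<eta>. square_integrable \<xi> \<and> square_integrable \<eta> \<and> (AE x in lborel. \<xi> x = \<eta> x))"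
    by (auto simp: symp_def elim: AE_mp)
  show "transp (\<lambda>\<xi> \<eta>. square_integrable \<xi> \<and> square_integrable \<eta> \<and> (AE x in lborel. \<xi> x = \<eta> x))"
    by (auto simp: transp_def elim: AE_mp)
qed

definition c2_inner :: "complex^2 \<Rightarrow> complex^2 \<Rightarrow> complex" where
  "c2_inner v w = (\<Sum>i\<in>UNIV. cnj (v $ i) * w $ i)"

lemma cdot_self: "c2_inner v v = complex_of_real ((norm v)\<^sup>2)"
proof -
  have "(norm v)\<^sup>2 = (\<Sum>i\<in>UNIV. (cmod (v $ i))\<^sup>2)"
    by (simp add: norm_vec_def L2_set_def sum_nonneg)
  then show ?thesis
    by (simp only: c2_inner_def of_real_sum complex_norm_square mult.commute)
qed

lemma Re_cdot: "Re (c2_inner v w) = v \<bullet> w"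
  by (simp add: c2_inner_def inner_vec_def inner_complex_def)

lemma norm_smult_vec: "norm (c *s v) = cmod c * norm (v :: complex^2)"
  by (simp add: norm_vec_def L2_set_def norm_mult power_mult_distrib real_sqrt_mult
      flip: sum_distrib_left)

lemma norm_cdot: "cmod (c2_inner v w) \<le> norm v * norm w"
proof -
  have "cmod (c2_inner v w) \<le> (\<Sum>i\<in>UNIV. cmod (v $ i) * cmod (w $ i))"
    unfolding c2_inner_def by (rule order_trans[OF norm_sum]) (simp add: norm_mult)
  also have "\<dots> \<le> norm v * norm w"
    using L2_set_mult_ineq[of "\<lambda>i. cmod (v $ i)" "\<lambda>i. cmod (w $ i)" UNIV]
    by (simp add: norm_vec_def)
  finally show ?thesis .
qed

lemma cdot_measurable [measurable]:
  assumes [measurable]: "f \<in> borel_measurable M" "g \<in> borel_measurable M"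
  shows "(\<lambda>x. c2_inner (f x) (g x)) \<in> borel_measurable M"
proof -
  have "continuous_on UNIV (\<lambda>p. c2_inner (fst p) (snd p))"
    unfolding c2_inner_def by (intro continuous_intros)
  then have "(\<lambda>p. c2_inner (fst p) (snd p)) \<in> borel_measurable borel"
    by (rule borel_measurable_continuous_onI)
  from measurable_compose[OF borel_measurable_Pair[OF assms] this] show ?thesis by simp
qed

lemma smult_measurable [measurable]:
  assumes "f \<in> borel_measurable M"
  shows "(\<lambda>x. c *s (f x :: complex^2)) \<in> borel_measurable M"
proof -
  have "continuous_on UNIV (\<lambda>v :: complex^2. c *s v)"
    by (simp add: vector_scalar_mult_def) (intro continuous_intros)
  then show ?thesis
    by (rule borel_measurable_continuous_on[OF _ assms])
qed

lemma square_integrable_add: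
  assumes "square_integrable f" "square_integrable g" shows "square_integrable (\<lambda>x. f x + g x)"
proof -
  have [measurable]: "f \<in> borel_measurable lborel" "g \<in> borel_measurable lborel"
    using assms by (auto simp: square_integrable_def)
  have *: "(norm (v + w))\<^sup>2 \<le> 2 * (norm v)\<^sup>2 + 2 * (norm w)\<^sup>2" for v w :: "complex^2"
  proof -
    have "(norm (v + w))\<^sup>2 \<le> (norm v + norm w)\<^sup>2"
      by (simp add: norm_triangle_ineq power_mono)
    also have "\<dots> \<le> 2 * (norm v)\<^sup>2 + 2 * (norm w)\<^sup>2"
      using sum_squares_ge_zero[of "norm v - norm w" 0] by (simp add: power2_eq_square algebra_simps)
    finally show ?thesis .
  qed
  have "integrable lborel (\<lambda>x. 2 * (norm (f x))\<^sup>2 + 2 * (norm (g x))\<^sup>2)"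
    using assms by (auto simp: square_integrable_def)
  then have "integrable lborel (\<lambda>x. (norm (f x + g x))\<^sup>2)"
    by (rule Bochner_Integration.integrable_bound) (auto intro!: AE_I2 simp: * )
  then show ?thesis by (simp add: square_integrable_def)
qed

lemma square_integrable_smult:
  assumes "square_integrable f" shows "square_integrable (\<lambda>x. c *s f x)"
  using assms by (auto simp: square_integrable_def norm_smult_vec power_mult_distrib)

lemma square_integrable_cdot:
  assumes "square_integrable f" "square_integrable g" shows "integrable lborel (\<lambda>x. c2_inner (f x) (g x))"
proof -
  have [measurable]: "f \<in> borel_measurable lborel" "g \<in> borel_measurable lborel"
    using assms by (auto simp: square_integrable_def)
  have *: "cmod (c2_inner v w) \<le> (norm v)\<^sup>2 + (norm w)\<^sup>2" for v w
  proof -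
    have "2 * (norm v * norm w) \<le> (norm v)\<^sup>2 + (norm w)\<^sup>2"
      using sum_squares_ge_zero[of "norm v - norm w" 0] by (simp add: power2_eq_square algebra_simps)
    moreover have "0 \<le> norm v * norm w" by simp
    ultimately show ?thesis using norm_cdot[of v w] by linarith
  qed
  have "integrable lborel (\<lambda>x. (norm (f x))\<^sup>2 + (norm (g x))\<^sup>2)"
    using assms by (auto simp: square_integrable_def)
  then show ?thesis
    by (rule Bochner_Integration.integrable_bound) (auto intro!: AE_I2 simp: * )
qed

lemma scaleR_smult: "r *\<^sub>R v = complex_of_real r *s (v :: complex^2)"
  unfolding vec_eq_iff vector_scaleR_component vector_smult_component
  by (simp add: scaleR_conv_of_real)

lemma square_integrable_scaleR: "square_integrable f \<Longrightarrow> square_integrable (\<lambda>x. r *\<^sub>R f x)"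
  by (simp add: scaleR_smult square_integrable_smult)

lemma square_integrable_diff: "square_integrable f \<Longrightarrow> square_integrable g \<Longrightarrow> square_integrable (\<lambda>x. f x - g x)"
  using square_integrable_add[of f "\<lambda>x. (-1) *\<^sub>R g x"] square_integrable_scaleR[of g "-1"] by simp

instantiation L2_heis :: real_vector
begin

lift_definition zero_L2_heis :: L2_heis is "\<lambda>_. 0" by (simp add: square_integrable_def)

lift_definition plus_L2_heis :: "L2_heis \<Rightarrow> L2_heis \<Rightarrow> L2_heis" is "\<lambda>f g x. f x + g x"
  by (auto intro: square_integrable_add elim: AE_mp)

lift_definition scaleR_L2_heis :: "real \<Rightarrow> L2_heis \<Rightarrow> L2_heis" is "\<lambda>r f x. r *\<^sub>R f x"
  by (auto simp: scaleR_smult intro: square_integrable_smult elim: AE_mp)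

lift_definition uminus_L2_heis :: "L2_heis \<Rightarrow> L2_heis" is "\<lambda>f x. - f x"
  by (auto simp: square_integrable_def elim: AE_mp)

lift_definition minus_L2_heis :: "L2_heis \<Rightarrow> L2_heis \<Rightarrow> L2_heis" is "\<lambda>f g x. f x - g x"
  by (auto intro: square_integrable_diff elim: AE_mp)

instance
proof
  fix a b c :: L2_heis and r s :: real
  show "a + b + c = a + (b + c)"
    by transfer (auto intro: square_integrable_add simp: add.assoc)
  show "a + b = b + a"
    by transfer (auto intro: square_integrable_add simp: add.commute)
  show "0 + a = a"
    by transfer auto
  show "- a + a = 0"
    by transfer (auto simp: square_integrable_def)
  show "a - b = a + - b"
    by transfer (auto simp: square_integrable_diff)
  show "r *\<^sub>R (a + b) = r *\<^sub>R a + r *\<^sub>R b"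
    by transfer (auto simp: scaleR_add_right intro!: square_integrable_add square_integrable_scaleR)
  show "(r + s) *\<^sub>R a = r *\<^sub>R a + s *\<^sub>R a"
    by transfer (auto simp: scaleR_add_left intro!: square_integrable_add square_integrable_scaleR)
  show "r *\<^sub>R s *\<^sub>R a = (r * s) *\<^sub>R a"
    by transfer (auto intro!: square_integrable_scaleR)
  show "1 *\<^sub>R a = a"
    by transfer auto
qed

end

instantiation L2_heis :: real_inner
begin

lift_definition inner_L2_heis :: "L2_heis \<Rightarrow> L2_heis \<Rightarrow> real"
  is "\<lambda>f g. \<integral>x. f x \<bullet> g x \<partial>lborel"
  by (rule Bochner_Integration.integral_cong_AE) (auto simp: square_integrable_def elim: AE_mp)

definition "norm (\<xi> :: L2_heis) = sqrt (\<xi> \<bullet> \<xi>)"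
definition "dist (\<xi> :: L2_heis) \<eta> = norm (\<xi> - \<eta>)"
definition "sgn (\<xi> :: L2_heis) = \<xi> /\<^sub>R norm \<xi>"
definition "uniformity = (INF e\<in>{0 <..}. principal {(x, y :: L2_heis). dist x y < e})"
definition "open S \<longleftrightarrow> (\<forall>x\<in>S. eventually (\<lambda>(x', y). x' = x \<longrightarrow> y \<in> S)
   (uniformity :: (L2_heis \<times> L2_heis) filter))"

instance
proof
  have int: "integrable lborel (\<lambda>x. f x \<bullet> g x)" if "square_integrable f" "square_integrable g" for f g
    using integrable_Re[OF square_integrable_cdot[OF that]] by (simp add: Re_cdot)
  fix a b c :: L2_heis and r s :: real
  show "dist a b = norm (a - b)" by (rule dist_L2_heis_def)
  show "sgn a = a /\<^sub>R norm a" by (rule sgn_L2_heis_def)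
  show "uniformity = (INF e\<in>{0 <..}. principal {(x, y :: L2_heis). dist x y < e})"
    by (rule uniformity_L2_heis_def)
  show "open S \<longleftrightarrow> (\<forall>x\<in>S. eventually (\<lambda>(x', y). x' = x \<longrightarrow> y \<in> S) uniformity)" for S :: "L2_heis set"
    by (rule open_L2_heis_def)
  show "a \<bullet> b = b \<bullet> a"
    by transfer (simp add: inner_commute)
  show "(a + b) \<bullet> c = a \<bullet> c + b \<bullet> c"
    by transfer (simp add: inner_add_left int)
  show "(r *\<^sub>R a) \<bullet> b = r * (a \<bullet> b)"
    by transfer (simp add: int)
  show "0 \<le> a \<bullet> a"
    by transfer simp
  show "(a \<bullet> a = 0) = (a = 0)"
  proof transfer
    fix f assume "square_integrable f \<and> square_integrable f \<and> (AE x in lborel. f x = f x)"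
    then have f: "square_integrable f" by simp
    have "((\<integral>x. f x \<bullet> f x \<partial>lborel) = 0) = (AE x in lborel. f x \<bullet> f x = 0)"
      by (rule integral_nonneg_eq_0_iff_AE[OF int[OF f f]]) simp
    then show "((\<integral>x. f x \<bullet> f x \<partial>lborel) = 0) =
         (square_integrable f \<and> square_integrable (\<lambda>_. 0) \<and> (AE x in lborel. f x = 0))"
      using f by (simp add: square_integrable_def)
  qed
  show "norm a = sqrt (a \<bullet> a)" by (rule norm_L2_heis_def)
qed

end

instantiation L2_heis :: complex_normed_vector
begin

lift_definition scaleC_L2_heis :: "complex \<Rightarrow> L2_heis \<Rightarrow> L2_heis" is "\<lambda>c f x. c *s f x"
  by (auto intro: square_integrable_smult elim: AE_mp)

instance
proof
  fix c d :: complex and r :: real and x y :: L2_heis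
  show "c *\<^sub>C (x + y) = c *\<^sub>C x + c *\<^sub>C y"
    by transfer (auto intro!: square_integrable_add square_integrable_smult simp: vector_add_ldistrib)
  show "(c + d) *\<^sub>C x = c *\<^sub>C x + d *\<^sub>C x"
    by transfer (auto intro!: square_integrable_add square_integrable_smult simp: vector_sadd_rdistrib)
  show "c *\<^sub>C d *\<^sub>C x = (c * d) *\<^sub>C x"
    by transfer (auto intro!: square_integrable_smult simp: vector_smult_assoc)
  show "r *\<^sub>R x = complex_of_real r *\<^sub>C x"
    by transfer (auto intro!: square_integrable_smult simp: scaleR_smult)
  show "norm (c *\<^sub>C x) = cmod c * norm x"
    unfolding norm_L2_heis_def
    by transfer (simp add: dot_square_norm norm_smult_vec power_mult_distrib real_sqrt_mult)
qed

end

lemma norm_abs_L2_heis: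
  assumes "square_integrable f"
  shows "(norm (abs_L2_heis f))\<^sup>2 = (\<integral>x. (norm (f x))\<^sup>2 \<partial>lborel)"
proof -
  have "abs_L2_heis f \<bullet> abs_L2_heis f = (\<integral>x. f x \<bullet> f x \<partial>lborel)"
    using assms by (intro inner_L2_heis.abs_eq) auto
  then show ?thesis
    by (simp add: power2_norm_eq_inner)
qed

lemma nn_norm_abs_L2_heis:
  assumes "square_integrable f"
  shows "(\<integral>\<^sup>+x. ennreal ((norm (f x))\<^sup>2) \<partial>lborel) = ennreal ((norm (abs_L2_heis f))\<^sup>2)"
  unfolding norm_abs_L2_heis[OF assms]
  using assms by (intro nn_integral_eq_integral) (auto simp: square_integrable_def)

lemma square_integrable_rep [simp]: "square_integrable (rep_L2_heis \<xi>)"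
  using Quotient3_rep_reflp[OF Quotient3_L2_heis, of \<xi>] by simp

lemma abs_rep_L2_heis [simp]: "abs_L2_heis (rep_L2_heis \<xi>) = \<xi>"
  by (rule Quotient3_abs_rep[OF Quotient3_L2_heis])

lemma minus_abs_L2_heis: "square_integrable f \<Longrightarrow> square_integrable g \<Longrightarrow> abs_L2_heis f - abs_L2_heis g = abs_L2_heis (\<lambda>x. f x - g x)"
  by (rule minus_L2_heis.abs_eq) auto

lemma L2_heis_complete:
  fixes X :: "nat \<Rightarrow> L2_heis"
  assumes "Cauchy X" shows "convergent X"
proof -
  have "\<exists>M. \<forall>m\<ge>M. \<forall>k\<ge>M. norm (X m - X k) < (1/2)^n" for n :: nat
    using CauchyD[OF assms, of "(1/2)^n"] by simp
  then obtain M where M: "\<And>n m k. m \<ge> M n \<Longrightarrow> k \<ge> M n \<Longrightarrow> norm (X m - X k) < (1/2)^n"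
    by metis
  define r where "r n = n + (\<Sum>i\<le>n. M i)" for n
  have rM: "M n \<le> r n" for n
    unfolding r_def using member_le_sum[of n "{..n}" M] by simp
  have r_ge: "n \<le> r n" for n unfolding r_def by simp
  have r_Suc: "r n \<le> r (Suc n)" for n unfolding r_def by simp
  define F where "F n = rep_L2_heis (X n)" for n
  have F: "square_integrable (F n)" and XF: "X n = abs_L2_heis (F n)" for n by (simp_all add: F_def)
  have Fd: "(\<integral>\<^sup>+x. ennreal ((norm (F m x - F n x))\<^sup>2) \<partial>lborel) = ennreal ((norm (X m - X n))\<^sup>2)" for m n
    using nn_norm_abs_L2_heis[OF square_integrable_diff[OF F F], of m n] by (simp add: XF minus_abs_L2_heis F)
  have [measurable]: "F n \<in> borel_measurable lborel" for n using F by (auto simp: square_integrable_def)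
  define f where "f n = F (r n)" for n
  have [measurable]: "f n \<in> borel_measurable lborel" for n unfolding f_def by simp
  define d where "d n x = 2 ^ n * (norm (f (Suc n) x - f n x))\<^sup>2" for n x
  have [measurable]: "d n \<in> borel_measurable lborel" for n unfolding d_def by measurable
  have d_nn: "d n x \<ge> 0" for n x unfolding d_def by simp
  have d_int: "(\<integral>\<^sup>+x. ennreal (d n x) \<partial>lborel) \<le> ennreal ((1/2)^n)" for n
  proof -
    have "(\<integral>\<^sup>+x. ennreal (d n x) \<partial>lborel)
        = ennreal (2^n) * (\<integral>\<^sup>+x. ennreal ((norm (f (Suc n) x - f n x))\<^sup>2) \<partial>lborel)"
      unfolding d_def by (subst nn_integral_cmult[symmetric]) (auto simp: ennreal_mult)
    also have "\<dots> = ennreal (2^n) * ennreal ((norm (X (r (Suc n)) - X (r n)))\<^sup>2)"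
      by (simp add: f_def Fd)
    also have "\<dots> = ennreal (2^n * (norm (X (r (Suc n)) - X (r n)))\<^sup>2)"
      by (rule ennreal_mult'[symmetric]) simp
    also have "\<dots> \<le> ennreal ((1/2)^n)"
    proof (rule ennreal_leI)
      have "(norm (X (r (Suc n)) - X (r n)))\<^sup>2 \<le> ((1/2)^n)\<^sup>2"
        using M[of n "r (Suc n)" "r n"] rM[of n] r_Suc[of n] by (intro power_mono) auto
      then have "2^n * (norm (X (r (Suc n)) - X (r n)))\<^sup>2 \<le> 2^n * ((1/2)^n)\<^sup>2"
        by simp
      also have "\<dots> = (1/2 :: real)^n"
        by (simp add: power2_eq_square power_divide)
      finally show "2^n * (norm (X (r (Suc n)) - X (r n)))\<^sup>2 \<le> (1/2)^n" .
    qed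
    finally show ?thesis .
  qed
  have "(\<integral>\<^sup>+x. (\<Sum>n. ennreal (d n x)) \<partial>lborel) = (\<Sum>n. \<integral>\<^sup>+x. ennreal (d n x) \<partial>lborel)"
    by (rule nn_integral_suminf) simp
  also have "\<dots> \<le> (\<Sum>n. ennreal ((1/2)^n))"
    by (intro suminf_le d_int) auto
  also have "\<dots> = ennreal (\<Sum>n. (1/2)^n)"
    by (rule suminf_ennreal2) (auto intro: summable_geometric)
  also have "\<dots> < \<infinity>" by simp
  finally have "(\<integral>\<^sup>+x. (\<Sum>n. ennreal (d n x)) \<partial>lborel) \<noteq> \<infinity>" by simp
  then have "AE x in lborel. (\<Sum>n. ennreal (d n x)) \<noteq> \<infinity>"
    by (intro nn_integral_noteq_infinite) auto
  then have AE_conv: "AE x in lborel. (\<lambda>n. f n x) \<longlonglongrightarrow> lim (\<lambda>n. f n x)"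
  proof eventually_elim
    case (elim x)
    then obtain C where C: "(\<Sum>n. ennreal (d n x)) = ennreal C" "C \<ge> 0"
      by (cases "\<Sum>n. ennreal (d n x)") auto
    have "ennreal (d n x) \<le> ennreal C" for n
      unfolding C(1)[symmetric] using sum_le_suminf[of "\<lambda>n. ennreal (d n x)" "{n}"] by simp
    then have dC: "d n x \<le> C" for n using C by simp
    have b: "norm (f (Suc n) x - f n x) \<le> sqrt C * (sqrt (1/2))^n" for n
    proof (rule power2_le_imp_le)
      have "(norm (f (Suc n) x - f n x))\<^sup>2 = d n x * (1/2)^n"
        by (simp add: d_def power_divide)
      also have "\<dots> \<le> C * (1/2)^n"
        by (intro mult_right_mono dC) simp
      also have "\<dots> = (sqrt C * sqrt (1/2) ^ n)\<^sup>2"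
      proof -
        have "(sqrt (1/2) ^ n)\<^sup>2 = ((sqrt (1/2))\<^sup>2) ^ n"
          by (simp only: power_mult[symmetric] mult.commute)
        also have "\<dots> = (1/2 :: real) ^ n" by (subst real_sqrt_pow2) simp_all
        finally show ?thesis using C(2) by (simp only: power_mult_distrib real_sqrt_pow2)
      qed
      finally show "(norm (f (Suc n) x - f n x))\<^sup>2 \<le> (sqrt C * sqrt (1/2) ^ n)\<^sup>2" .
    qed (use C in simp)
    have "sqrt (1/2) < (1::real)"
      by (simp add: real_sqrt_lt_1_iff)
    then have "summable (\<lambda>n. sqrt C * (sqrt (1/2))^n)"
      by (intro summable_mult summable_geometric) simp
    then have "summable (\<lambda>n. f (Suc n) x - f n x)"
      by (rule summable_comparison_test') (use b in auto)
    then have "(\<lambda>n. \<Sum>k<n. f (Suc k) x - f k x) \<longlonglongrightarrow> (\<Sum>k. f (Suc k) x - f k x)"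
      by (rule summable_LIMSEQ)
    then have "(\<lambda>n. f n x - f 0 x) \<longlonglongrightarrow> (\<Sum>k. f (Suc k) x - f k x)"
      by (simp only: sum_lessThan_telescope[of "\<lambda>n. f n x"])
    then have "(\<lambda>n. f n x - f 0 x + f 0 x) \<longlonglongrightarrow> (\<Sum>k. f (Suc k) x - f k x) + f 0 x"
      by (intro tendsto_add tendsto_const)
    then have "convergent (\<lambda>n. f n x)" by (auto simp: convergent_def)
    then show ?case by (rule convergent_LIMSEQ_iff[THEN iffD1])
  qed
  define L where "L x = lim (\<lambda>n. f n x)" for x
  have [measurable]: "L \<in> borel_measurable lborel"
    unfolding L_def by (rule borel_measurable_lim_metric) simp
  have L_est: "(\<integral>\<^sup>+x. ennreal ((norm (L x - F n x))\<^sup>2) \<partial>lborel) \<le> ennreal (\<epsilon>\<^sup>2)"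
    if N: "\<And>m k. m \<ge> N \<Longrightarrow> k \<ge> N \<Longrightarrow> norm (X m - X k) < \<epsilon>" and "n \<ge> N" for \<epsilon> N n
  proof -
    have "(\<integral>\<^sup>+x. ennreal ((norm (L x - F n x))\<^sup>2) \<partial>lborel)
        = (\<integral>\<^sup>+x. liminf (\<lambda>k. ennreal ((norm (f k x - F n x))\<^sup>2)) \<partial>lborel)"
      using AE_conv
    proof (intro nn_integral_cong_AE, eventually_elim)
      case (elim x)
      then have "(\<lambda>k. ennreal ((norm (f k x - F n x))\<^sup>2)) \<longlonglongrightarrow> ennreal ((norm (L x - F n x))\<^sup>2)"
        unfolding L_def by (intro tendsto_intros)
      from lim_imp_Liminf[OF trivial_limit_sequentially this] show ?case by simp
    qed
    also have "\<dots> \<le> liminf (\<lambda>k. \<integral>\<^sup>+x. ennreal ((norm (f k x - F n x))\<^sup>2) \<partial>lborel)"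
      by (rule nn_integral_liminf) simp
    also have "\<dots> \<le> ennreal (\<epsilon>\<^sup>2)"
    proof (rule Liminf_le)
      show "\<forall>\<^sub>F k in sequentially. (\<integral>\<^sup>+x. ennreal ((norm (f k x - F n x))\<^sup>2) \<partial>lborel) \<le> ennreal (\<epsilon>\<^sup>2)"
        using eventually_ge_at_top[of N]
      proof eventually_elim
        case (elim k)
        then have "norm (X (r k) - X n) < \<epsilon>"
          using r_ge[of k] \<open>n \<ge> N\<close> by (intro N) auto
        then show ?case
          unfolding f_def Fd by (intro ennreal_leI power_mono) auto
      qed
    qed simp
    finally show ?thesis .
  qed
  have L_sq: "square_integrable (\<lambda>x. L x - F n x)" 
    if N: "\<And>m k. m \<ge> N \<Longrightarrow> k \<ge> N \<Longrightarrow> norm (X m - X k) < \<epsilon>" and "n \<ge> N" for \<epsilon> N n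
  proof -
    have "(\<integral>\<^sup>+x. ennreal ((norm (L x - F n x))\<^sup>2) \<partial>lborel) \<le> ennreal (\<epsilon>\<^sup>2)"
      using that by (rule L_est)
    also have "\<dots> < \<infinity>" by simp
    finally show ?thesis
      by (simp add: square_integrable_def integrable_iff_bounded)
  qed
  obtain N0 where N0: "\<And>m k. m \<ge> N0 \<Longrightarrow> k \<ge> N0 \<Longrightarrow> norm (X m - X k) < 1"
    using CauchyD[OF assms, of 1] by auto
  have L: "square_integrable L"
    using square_integrable_add[OF L_sq[of N0 1 N0] F[of N0]] N0 by simp
  have "X \<longlonglongrightarrow> abs_L2_heis L"
  proof (rule LIMSEQ_I)
    fix e :: real assume "e > 0"
    then obtain N where N: "\<And>m k. m \<ge> N \<Longrightarrow> k \<ge> N \<Longrightarrow> norm (X m - X k) < e / 2"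
      using CauchyD[OF assms, of "e / 2"] by auto
    have "norm (X n - abs_L2_heis L) < e" if "n \<ge> N" for n
    proof -
      have "ennreal ((norm (abs_L2_heis L - X n))\<^sup>2) = (\<integral>\<^sup>+x. ennreal ((norm (L x - F n x))\<^sup>2) \<partial>lborel)"
        by (simp add: XF minus_abs_L2_heis F L square_integrable_diff nn_norm_abs_L2_heis)
      also have "\<dots> \<le> ennreal ((e/2)\<^sup>2)" using N that by (rule L_est)
      finally have "(norm (abs_L2_heis L - X n))\<^sup>2 \<le> (e/2)\<^sup>2"
        by (simp add: ennreal_le_iff)
      then have "norm (abs_L2_heis L - X n) \<le> e / 2"
        by (rule power2_le_imp_le) (use \<open>e > 0\<close> in simp)
      then show ?thesis using \<open>e > 0\<close> by (simp add: norm_minus_commute)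
    qed
    then show "\<exists>N. \<forall>n\<ge>N. norm (X n - abs_L2_heis L) < e" by blast
  qed
  then show ?thesis by (auto simp: convergent_def)
qed

instantiation L2_heis :: chilbert_space
begin

lift_definition cinner_L2_heis :: "L2_heis \<Rightarrow> L2_heis \<Rightarrow> complex"
  is "\<lambda>f g. \<integral>x. c2_inner (f x) (g x) \<partial>lborel"
  by (rule Bochner_Integration.integral_cong_AE) (auto simp: square_integrable_def elim: AE_mp)

instance
proof
  fix X :: "nat \<Rightarrow> L2_heis" assume "Cauchy X" then show "convergent X" by (rule L2_heis_complete)
next
  fix c :: complex and x y z :: L2_heis
  have 1: "c2_inner v w = cnj (c2_inner w v)" for v w
    by (simp add: c2_inner_def mult.commute)
  show "cinner x y = cnj (cinner y x)"
    by transfer (subst 1, simp)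
  have 2: "c2_inner u (v + w) = c2_inner u v + c2_inner u w" for u v w
    by (simp add: c2_inner_def algebra_simps sum.distrib)
  show "cinner x (y + z) = cinner x y + cinner x z"
    by transfer (simp add: 2 square_integrable_cdot)
  have 3: "c2_inner v (d *s w) = d * c2_inner v w" for d v w
    by (simp add: c2_inner_def algebra_simps sum_distrib_left)
  show "cinner x (c *\<^sub>C y) = c * cinner x y"
    by transfer (simp add: 3 square_integrable_cdot)
  show "cinner x x = complex_of_real ((norm x)\<^sup>2)"
    unfolding norm_L2_heis_def
    by transfer (simp add: cdot_self dot_square_norm flip: of_real_power)
qed

end

subsection \<open>Change of variables\<close>

lemma borel_measurable_fst':
  fixes f :: "'a \<Rightarrow> 'b::topological_space \<times> 'c::topological_space"
  assumes "f \<in> borel_measurable M" shows "(\<lambda>x. fst (f x)) \<in> borel_measurable M"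
  by (rule borel_measurable_continuous_on[OF _ assms]) (intro continuous_intros)

lemma borel_measurable_snd':
  fixes f :: "'a \<Rightarrow> 'b::topological_space \<times> 'c::topological_space"
  assumes "f \<in> borel_measurable M" shows "(\<lambda>x. snd (f x)) \<in> borel_measurable M"
  by (rule borel_measurable_continuous_on[OF _ assms]) (intro continuous_intros)

lemmas prod_measurable = borel_measurable_fst' borel_measurable_snd' borel_measurable_Pair

lemma nn_integral_heis:
  fixes f :: "heis \<Rightarrow> ennreal"
  assumes [measurable]: "f \<in> borel_measurable borel"
  shows "(\<integral>\<^sup>+x. f x \<partial>lborel) = (\<integral>\<^sup>+a. \<integral>\<^sup>+b. \<integral>\<^sup>+c. f (a, b, c) \<partial>lborel \<partial>lborel \<partial>lborel)"
proof -
  have "(\<integral>\<^sup>+x. f x \<partial>lborel) = (\<integral>\<^sup>+x. f x \<partial>(lborel \<Otimes>\<^sub>M lborel))"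
    by (simp add: lborel_prod)
  also have "\<dots> = (\<integral>\<^sup>+a. \<integral>\<^sup>+p. f (a, p) \<partial>lborel \<partial>lborel)"
    by (rule lborel.nn_integral_fst[symmetric]) (simp add: lborel_prod)
  also have "\<dots> = (\<integral>\<^sup>+a. \<integral>\<^sup>+b. \<integral>\<^sup>+c. f (a, b, c) \<partial>lborel \<partial>lborel \<partial>lborel)"
  proof (rule nn_integral_cong)
    fix a :: real
    have "(\<integral>\<^sup>+p. f (a, p) \<partial>lborel) = (\<integral>\<^sup>+p. f (a, p) \<partial>(lborel \<Otimes>\<^sub>M lborel))"
      by (simp add: lborel_prod)
    also have "\<dots> = (\<integral>\<^sup>+b. \<integral>\<^sup>+c. f (a, b, c) \<partial>lborel \<partial>lborel)"
      by (rule lborel.nn_integral_fst[symmetric]) (simp add: lborel_prod)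
    finally show "(\<integral>\<^sup>+p. f (a, p) \<partial>lborel) = (\<integral>\<^sup>+b. \<integral>\<^sup>+c. f (a, b, c) \<partial>lborel \<partial>lborel)" .
  qed
  finally show ?thesis .
qed

definition heis_tri :: "real \<Rightarrow> real \<Rightarrow> real \<Rightarrow> real \<Rightarrow> real \<Rightarrow> (real \<times> real \<Rightarrow> real) \<Rightarrow> heis \<Rightarrow> heis" where
  "heis_tri t1 s1 t2 s2 s3 \<phi> = (\<lambda>(a, b, c). (t1 + s1 * a, t2 + s2 * b, \<phi> (a, b) + s3 * c))"

lemma heis_tri_measurable [measurable]:
  assumes [measurable]: "\<phi> \<in> borel_measurable borel"
  shows "heis_tri t1 s1 t2 s2 s3 \<phi> \<in> borel_measurable borel"
proof -
  have "(\<lambda>x :: heis. (t1 + s1 * fst x, t2 + s2 * fst (snd x), \<phi> (fst x, fst (snd x)) + s3 * snd (snd x)))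
    \<in> borel_measurable borel"
    by (intro prod_measurable borel_measurable_add borel_measurable_times measurable_compose[OF _ assms])
      simp_all
  then show ?thesis by (simp add: heis_tri_def case_prod_beta')
qed

lemma lborel_heis_tri:
  assumes [measurable]: "\<phi> \<in> borel_measurable borel" and s: "s1 \<noteq> 0" "s2 \<noteq> 0" "s3 \<noteq> 0"
  shows "lborel = density (distr lborel borel (heis_tri t1 s1 t2 s2 s3 \<phi>)) (\<lambda>_. ennreal \<bar>s1 * s2 * s3\<bar>)"
    (is "_ = density (distr _ _ ?A) _")
proof (rule measure_eqI)
  fix X :: "heis set" assume "X \<in> sets lborel"
  then have [measurable]: "X \<in> sets borel" by simp
  define f :: "heis \<Rightarrow> ennreal" where "f = indicator X"
  have [measurable]: "f \<in> borel_measurable borel" unfolding f_def by simp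
  have "emeasure lborel X = (\<integral>\<^sup>+x. f x \<partial>lborel)" by (simp add: f_def)
  also have "\<dots> = (\<integral>\<^sup>+a. \<integral>\<^sup>+b. \<integral>\<^sup>+c. f (a, b, c) \<partial>lborel \<partial>lborel \<partial>lborel)"
    by (rule nn_integral_heis) simp
  also have "\<dots> = ennreal \<bar>s1\<bar> * (\<integral>\<^sup>+a. \<integral>\<^sup>+b. \<integral>\<^sup>+c. f (t1 + s1 * a, b, c) \<partial>lborel \<partial>lborel \<partial>lborel)"
    by (rule nn_integral_real_affine) (use s in simp_all)
  also have "\<dots> = ennreal \<bar>s1\<bar> * (\<integral>\<^sup>+a. ennreal \<bar>s2\<bar> * (\<integral>\<^sup>+b. \<integral>\<^sup>+c. f (t1 + s1 * a, t2 + s2 * b, c) \<partial>lborel \<partial>lborel) \<partial>lborel)"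
    by (intro arg_cong[where f = "\<lambda>x. ennreal \<bar>s1\<bar> * x"] nn_integral_cong nn_integral_real_affine) (use s in simp_all)
  also have "\<dots> = ennreal \<bar>s1\<bar> * (\<integral>\<^sup>+a. ennreal \<bar>s2\<bar> * (\<integral>\<^sup>+b. ennreal \<bar>s3\<bar> * (\<integral>\<^sup>+c. f (t1 + s1 * a, t2 + s2 * b, \<phi> (a, b) + s3 * c) \<partial>lborel) \<partial>lborel) \<partial>lborel)"
    by (intro arg_cong[where f = "\<lambda>x. ennreal \<bar>s1\<bar> * x"] arg_cong[where f = "\<lambda>x. ennreal \<bar>s2\<bar> * x"]
        nn_integral_cong nn_integral_real_affine) (use s in simp_all)
  also have "\<dots> = ennreal \<bar>s1 * s2 * s3\<bar> * (\<integral>\<^sup>+a. \<integral>\<^sup>+b. \<integral>\<^sup>+c. f (?A (a, b, c)) \<partial>lborel \<partial>lborel \<partial>lborel)"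
    by (simp add: nn_integral_cmult heis_tri_def abs_mult ennreal_mult mult.assoc)
  also have "\<dots> = ennreal \<bar>s1 * s2 * s3\<bar> * (\<integral>\<^sup>+x. f (?A x) \<partial>lborel)"
    by (subst nn_integral_heis) simp_all
  also have "\<dots> = emeasure (density (distr lborel borel ?A) (\<lambda>_. ennreal \<bar>s1 * s2 * s3\<bar>)) X"
  proof -
    have "emeasure (distr lborel borel ?A) X = (\<integral>\<^sup>+x. f x \<partial>distr lborel borel ?A)"
      by (simp add: f_def)
    also have "\<dots> = (\<integral>\<^sup>+x. f (?A x) \<partial>lborel)"
      by (rule nn_integral_distr) simp_all
    finally show ?thesis
      by (simp add: emeasure_density_const)
  qed
  finally show "emeasure lborel X = emeasure (density (distr lborel borel ?A) (\<lambda>_. ennreal \<bar>s1 * s2 * s3\<bar>)) X" .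
qed simp

lemma nn_integral_heis_tri:
  fixes f :: "heis \<Rightarrow> ennreal"
  assumes [measurable]: "\<phi> \<in> borel_measurable borel" "f \<in> borel_measurable borel"
    and s: "s1 \<noteq> 0" "s2 \<noteq> 0" "s3 \<noteq> 0"
  shows "(\<integral>\<^sup>+x. f x \<partial>lborel) = ennreal \<bar>s1 * s2 * s3\<bar> * (\<integral>\<^sup>+x. f (heis_tri t1 s1 t2 s2 s3 \<phi> x) \<partial>lborel)"
  by (subst lborel_heis_tri[OF assms(1) s, of t1 t2])
    (simp add: nn_integral_density nn_integral_distr nn_integral_cmult)

lemma integral_heis_tri:
  fixes f :: "heis \<Rightarrow> 'b::{banach, second_countable_topology}"
  assumes [measurable]: "\<phi> \<in> borel_measurable borel" "f \<in> borel_measurable borel"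
    and s: "s1 \<noteq> 0" "s2 \<noteq> 0" "s3 \<noteq> 0"
  shows "(\<integral>x. f x \<partial>lborel) = \<bar>s1 * s2 * s3\<bar> *\<^sub>R (\<integral>x. f (heis_tri t1 s1 t2 s2 s3 \<phi> x) \<partial>lborel)"
  by (subst lborel_heis_tri[OF assms(1) s, of t1 t2])
    (simp add: integral_density integral_distr del: abs_mult)

lemma integrable_heis_tri:
  fixes f :: "heis \<Rightarrow> 'b::{banach, second_countable_topology}"
  assumes [measurable]: "\<phi> \<in> borel_measurable borel" and f: "integrable lborel f"
    and s: "s1 \<noteq> 0" "s2 \<noteq> 0" "s3 \<noteq> 0"
  shows "integrable lborel (\<lambda>x. f (heis_tri t1 s1 t2 s2 s3 \<phi> x))"
proof -
  have [measurable]: "f \<in> borel_measurable borel"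
    using borel_measurable_integrable[OF f] by simp
  have "ennreal \<bar>s1 * s2 * s3\<bar> * (\<integral>\<^sup>+x. norm (f (heis_tri t1 s1 t2 s2 s3 \<phi> x)) \<partial>lborel) < \<infinity>"
    using nn_integral_heis_tri[of \<phi> "\<lambda>x. ennreal (norm (f x))" s1 s2 s3 t1 t2] f s
    by (simp add: integrable_iff_bounded)
  then have "(\<integral>\<^sup>+x. norm (f (heis_tri t1 s1 t2 s2 s3 \<phi> x)) \<partial>lborel) < \<infinity>"
    using s by (auto simp: ennreal_mult_less_top)
  then show ?thesis by (simp add: integrable_iff_bounded)
qed

lemma heis_inv_tri: "heis_inv = heis_tri 0 (-1) 0 (-1) (-1) (\<lambda>p. fst p * snd p)"
  by (auto simp: heis_inv_def heis_tri_def)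

lemma heis_mult_tri: "heis_mult (a, b, c) = heis_tri a 1 b 1 1 (\<lambda>p. c + a * snd p)"
  by (auto simp: heis_mult_def heis_tri_def)

lemma heis_mult_tri_measurable [simp]:
  "(\<lambda>p :: real \<times> real. c + a * snd p) \<in> borel_measurable borel"
  by (intro borel_measurable_add borel_measurable_times prod_measurable) simp_all

lemma heis_inv_tri_measurable [simp]:
  "(\<lambda>p :: real \<times> real. fst p * snd p) \<in> borel_measurable borel"
  by (intro borel_measurable_times prod_measurable) simp_all

lemma heis_mult_measurable [measurable]:
  assumes [measurable]: "f \<in> borel_measurable M" "g \<in> borel_measurable M"
  shows "(\<lambda>x. heis_mult (f x) (g x)) \<in> borel_measurable M"
proof -
  have "(\<lambda>x. (fst (f x) + fst (g x), fst (snd (f x)) + fst (snd (g x)),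
     snd (snd (f x)) + snd (snd (g x)) + fst (f x) * fst (snd (g x)))) \<in> borel_measurable M"
    by (intro prod_measurable borel_measurable_add borel_measurable_times assms)
  then show ?thesis by (simp add: heis_mult_def case_prod_beta')
qed

lemma heis_inv_measurable [measurable]: "heis_inv \<in> borel_measurable borel"
  unfolding heis_inv_tri
  by (intro heis_tri_measurable borel_measurable_times prod_measurable) simp_all

section \<open>The group C*-algebra\<close>

text \<open>Lebesgue measure is a two-sided Haar measure of the (unimodular) group, so no modular
  function occurs in the involution of \<open>L\<^sup>1\<close>.\<close>

definition L1_conv :: "(heis \<Rightarrow> complex) \<Rightarrow> (heis \<Rightarrow> complex) \<Rightarrow> heis \<Rightarrow> complex" where
  "L1_conv f g x = (\<integral>y. f y * g (heis_mult (heis_inv y) x) \<partial>lborel)"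

definition L1_invol :: "(heis \<Rightarrow> complex) \<Rightarrow> heis \<Rightarrow> complex" where
  "L1_invol f x = cnj (f (heis_inv x))"

lemma integrable_translate:
  fixes f :: "heis \<Rightarrow> 'b::{banach, second_countable_topology}"
  shows "integrable lborel f \<Longrightarrow> integrable lborel (\<lambda>x. f (heis_mult y x))"
  by (cases y) (simp add: heis_mult_tri integrable_heis_tri)

lemma integral_translate:
  fixes f :: "heis \<Rightarrow> 'b::{banach, second_countable_topology}"
  assumes "f \<in> borel_measurable borel"
  shows "(\<integral>x. f (heis_mult y x) \<partial>lborel) = (\<integral>x. f x \<partial>lborel)"
proof (cases y)
  case (fields a b c)
  show ?thesis
    unfolding fields heis_mult_tri using assms
    by (subst integral_heis_tri[of "\<lambda>p. c + a * snd p" f 1 1 1 a b]) simp_all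
qed

lemma integrable_invol: "integrable lborel f \<Longrightarrow> integrable lborel (L1_invol f)"
  unfolding L1_invol_def heis_inv_tri by (intro integrable_cnj integrable_heis_tri) simp_all

lemma integrable_conv:
  assumes f: "integrable lborel f" and g: "integrable lborel g"
  shows "integrable lborel (L1_conv f g)"
proof -
  have [measurable]: "f \<in> borel_measurable borel" "g \<in> borel_measurable borel"
    using borel_measurable_integrable[OF f] borel_measurable_integrable[OF g] by simp_all
  have "integrable (lborel \<Otimes>\<^sub>M lborel) (\<lambda>(y, x). f y * g (heis_mult (heis_inv y) x))"
  proof (rule lborel_pair.Fubini_integrable)
    show "(\<lambda>(y, x). f y * g (heis_mult (heis_inv y) x)) \<in> borel_measurable (lborel \<Otimes>\<^sub>M lborel)"
      by measurable
    have "(\<integral>x. norm (f y * g (heis_mult (heis_inv y) x)) \<partial>lborel) = norm (f y) * (\<integral>x. norm (g x) \<partial>lborel)" for y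
      using integral_translate[of "\<lambda>x. norm (g x)"] by (simp add: norm_mult)
    then show "integrable lborel (\<lambda>y. \<integral>x. norm (case (y, x) of (y, x) \<Rightarrow> f y * g (heis_mult (heis_inv y) x)) \<partial>lborel)"
      using f by simp
    show "AE y in lborel. integrable lborel (\<lambda>x. case (y, x) of (y, x) \<Rightarrow> f y * g (heis_mult (heis_inv y) x))"
      using integrable_translate[OF g] by simp
  qed
  from lborel_pair.integrable_snd[OF this] show ?thesis
    by (simp add: L1_conv_def[abs_def])
qed

definition L1_star_rep :: "((heis \<Rightarrow> complex) \<Rightarrow> (L2_heis \<Rightarrow>\<^sub>L L2_heis)) \<Rightarrow> bool" where
  "L1_star_rep \<sigma> \<longleftrightarrow> (\<forall>f. integrable lborel f \<longrightarrow>
     bop (\<sigma> f) \<and> norm (\<sigma> f) \<le> (\<integral>x. norm (f x) \<partial>lborel) \<and>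
     (\<forall>c \<xi>. \<sigma> (\<lambda>x. c * f x) \<xi> = c *\<^sub>C \<sigma> f \<xi>) \<and>
     is_adjoint (\<sigma> f) (\<sigma> (L1_invol f)) \<and>
     (\<forall>g. integrable lborel g \<longrightarrow>
        \<sigma> (\<lambda>x. f x + g x) = \<sigma> f + \<sigma> g \<and> \<sigma> (L1_conv f g) = \<sigma> f o\<^sub>L \<sigma> g))"


lemma scaleC_zero_right [simp]: "c *\<^sub>C 0 = (0 :: 'a::complex_normed_vector)"
  using norm_scaleC[of c "0 :: 'a"] by simp

lemma zero_L1_star_rep: "L1_star_rep (\<lambda>_. 0)"
  by (simp add: L1_star_rep_def bop_def is_adjoint_def)

text \<open>Representations may be degenerate. Every cyclic \<open>*\<close>-representation of \<open>L\<^sup>1(H\<^sup>3)\<close> acts on a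
  separable space, hence is equivalent to the nondegenerate part of some representation on
  \<^typ>\<open>L2_heis\<close>, which is separable and infinite dimensional. Therefore the supremum of
  \<open>\<parallel>\<sigma>(f)\<parallel>\<close> over this type is the universal C*-norm of \<open>f\<close>.\<close>

typedef L1_rep = "{\<sigma>. L1_star_rep \<sigma>}"
  morphisms rep_apply Abs_L1_rep
  using zero_L1_star_rep by blast

lemma
  assumes "integrable lborel f"
  shows bop_rep_apply: "bop (rep_apply \<sigma> f)"
    and norm_rep_apply: "norm (rep_apply \<sigma> f) \<le> (\<integral>x. norm (f x) \<partial>lborel)"
    and rep_apply_scaleC: "rep_apply \<sigma> (\<lambda>x. c * f x) \<xi> = c *\<^sub>C rep_apply \<sigma> f \<xi>"
    and is_adjoint_rep_apply: "is_adjoint (rep_apply \<sigma> f) (rep_apply \<sigma> (L1_invol f))"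
    and rep_apply_add: "integrable lborel g \<Longrightarrow> rep_apply \<sigma> (\<lambda>x. f x + g x) = rep_apply \<sigma> f + rep_apply \<sigma> g"
    and rep_apply_conv: "integrable lborel g \<Longrightarrow> rep_apply \<sigma> (L1_conv f g) = rep_apply \<sigma> f o\<^sub>L rep_apply \<sigma> g"
  using rep_apply[of \<sigma>] assms by (simp_all add: L1_star_rep_def)

text \<open>The full group C*-algebra, as the norm closure of the image of \<open>L\<^sup>1(H\<^sup>3)\<close> in the direct sum of
  all representations \<^typ>\<open>L1_rep\<close>.\<close>

definition heis_cstar_carrier :: "(L1_rep \<Rightarrow> (L2_heis \<Rightarrow>\<^sub>L L2_heis)) set" where
  "heis_cstar_carrier = {a. \<forall>\<epsilon>>0. \<exists>f. integrable lborel f \<and> (\<forall>\<sigma>. norm (a \<sigma> - rep_apply \<sigma> f) \<le> \<epsilon>)}"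

lemma cstar_carrierD:
  assumes "a \<in> heis_cstar_carrier" "0 < \<epsilon>"
  shows "\<exists>f. integrable lborel f \<and> (\<forall>\<sigma>. norm (a \<sigma> - rep_apply \<sigma> f) \<le> \<epsilon>)"
  using assms unfolding heis_cstar_carrier_def by blast

lemma cstar_carrierI:
  assumes "\<And>\<epsilon>. 0 < \<epsilon> \<Longrightarrow> \<exists>f. integrable lborel f \<and> (\<forall>\<sigma>. norm (a \<sigma> - rep_apply \<sigma> f) \<le> \<epsilon>)"
  shows "a \<in> heis_cstar_carrier"
  using assms unfolding heis_cstar_carrier_def by blast

lemma carrier_L1: "integrable lborel f \<Longrightarrow> (\<lambda>\<sigma>. rep_apply \<sigma> f) \<in> heis_cstar_carrier"
  by (rule cstar_carrierI) (auto intro!: exI[of _ f])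

lemma rep_apply_zero: "rep_apply \<sigma> (\<lambda>_. 0) = 0"
  using norm_rep_apply[of "\<lambda>_. 0" \<sigma>] by simp

lemma carrier_zero: "(\<lambda>_. 0) \<in> heis_cstar_carrier"
  using carrier_L1[of "\<lambda>_. 0"] by (simp add: rep_apply_zero)

lemma carrier_add:
  assumes "a \<in> heis_cstar_carrier" "b \<in> heis_cstar_carrier"
  shows "(\<lambda>\<sigma>. a \<sigma> + b \<sigma>) \<in> heis_cstar_carrier"
proof (rule cstar_carrierI)
  fix \<epsilon> :: real assume "0 < \<epsilon>"
  then have e: "0 < \<epsilon> / 2" by simp
  obtain f where f: "integrable lborel f" "\<And>\<sigma>. norm (a \<sigma> - rep_apply \<sigma> f) \<le> \<epsilon> / 2"
    using cstar_carrierD[OF assms(1) e] by blast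
  obtain g where g: "integrable lborel g" "\<And>\<sigma>. norm (b \<sigma> - rep_apply \<sigma> g) \<le> \<epsilon> / 2"
    using cstar_carrierD[OF assms(2) e] by blast
  have "norm (a \<sigma> + b \<sigma> - rep_apply \<sigma> (\<lambda>x. f x + g x)) \<le> \<epsilon>" for \<sigma>
    using norm_add_rule_thm[OF f(2)[of \<sigma>] g(2)[of \<sigma>]]
    by (simp add: rep_apply_add f g add_diff_add)
  then show "\<exists>h. integrable lborel h \<and> (\<forall>\<sigma>. norm (a \<sigma> + b \<sigma> - rep_apply \<sigma> h) \<le> \<epsilon>)"
    using f g by (intro exI[of _ "\<lambda>x. f x + g x"]) simp
qed

lemma carrier_scalar:
  assumes "a \<in> heis_cstar_carrier"
  shows "(\<lambda>\<sigma>. scalar_op c o\<^sub>L a \<sigma>) \<in> heis_cstar_carrier"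
proof (rule cstar_carrierI)
  fix \<epsilon> :: real assume "0 < \<epsilon>"
  then have e: "0 < \<epsilon> / (cmod c + 1)"
    by (simp add: add_nonneg_pos)
  obtain f where f: "integrable lborel f" "\<And>\<sigma>. norm (a \<sigma> - rep_apply \<sigma> f) \<le> \<epsilon> / (cmod c + 1)"
    using cstar_carrierD[OF assms(1) e] by blast
  have "norm ((scalar_op c o\<^sub>L a \<sigma>) - rep_apply \<sigma> (\<lambda>x. c * f x)) \<le> \<epsilon>" for \<sigma>
  proof -
    have "(scalar_op c o\<^sub>L a \<sigma>) - rep_apply \<sigma> (\<lambda>x. c * f x) = scalar_op c o\<^sub>L (a \<sigma> - rep_apply \<sigma> f)"
      by (rule blinfun_eqI)
        (simp add: rep_apply_scaleC f blinfun.diff_left blinfun.diff_right flip: scalar_op_apply)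
    then have "norm ((scalar_op c o\<^sub>L a \<sigma>) - rep_apply \<sigma> (\<lambda>x. c * f x)) \<le> cmod c * (\<epsilon> / (cmod c + 1))"
      using f(2)[of \<sigma>] by (simp add: norm_scalar_op_compose mult_left_mono del: times_divide_eq_right)
    also have "\<dots> \<le> (cmod c + 1) * (\<epsilon> / (cmod c + 1))"
      by (rule mult_right_mono) (use e in simp_all)
    also have "\<dots> = \<epsilon>" by (smt (verit) norm_ge_zero nonzero_mult_div_cancel_left times_divide_eq_right)
    finally show ?thesis .
  qed
  then show "\<exists>h. integrable lborel h \<and> (\<forall>\<sigma>. norm ((scalar_op c o\<^sub>L a \<sigma>) - rep_apply \<sigma> h) \<le> \<epsilon>)"
    using f by (intro exI[of _ "\<lambda>x. c * f x"]) simp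
qed

lemma scalar_op_of_real: "scalar_op (complex_of_real r) o\<^sub>L T = r *\<^sub>R T"
  by (rule blinfun_eqI) (simp add: blinfun.scaleR_left scaleR_scaleC)

lemma carrier_scaleR: "a \<in> heis_cstar_carrier \<Longrightarrow> (\<lambda>\<sigma>. r *\<^sub>R a \<sigma>) \<in> heis_cstar_carrier"
  using carrier_scalar[of a "complex_of_real r"] by (simp add: scalar_op_of_real)

lemma carrier_uminus: "a \<in> heis_cstar_carrier \<Longrightarrow> (\<lambda>\<sigma>. - a \<sigma>) \<in> heis_cstar_carrier"
  using carrier_scaleR[of a "-1"] by simp

lemma carrier_minus:
  "a \<in> heis_cstar_carrier \<Longrightarrow> b \<in> heis_cstar_carrier \<Longrightarrow> (\<lambda>\<sigma>. a \<sigma> - b \<sigma>) \<in> heis_cstar_carrier"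
  using carrier_add[OF _ carrier_uminus, of a b] by simp

lemma carrier_bounded:
  assumes "a \<in> heis_cstar_carrier"
  shows "\<exists>K>0. \<forall>\<sigma>. norm (a \<sigma>) \<le> K"
proof -
  obtain f where f: "integrable lborel f" "\<And>\<sigma>. norm (a \<sigma> - rep_apply \<sigma> f) \<le> 1"
    using cstar_carrierD[OF assms zero_less_one] by blast
  have "norm (a \<sigma>) \<le> (\<integral>x. norm (f x) \<partial>lborel) + 1" for \<sigma>
    using norm_triangle_sub[of "a \<sigma>" "rep_apply \<sigma> f"] f(2)[of \<sigma>] norm_rep_apply[OF f(1), of \<sigma>]
    by linarith
  moreover have "(\<integral>x. norm (f x) \<partial>lborel) + 1 > 0"
    by (smt (verit) Bochner_Integration.integral_nonneg norm_ge_zero)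
  ultimately show ?thesis by blast
qed

lemma carrier_mult:
  assumes "a \<in> heis_cstar_carrier" "b \<in> heis_cstar_carrier"
  shows "(\<lambda>\<sigma>. a \<sigma> o\<^sub>L b \<sigma>) \<in> heis_cstar_carrier"
proof (rule cstar_carrierI)
  fix \<epsilon> :: real assume e: "0 < \<epsilon>"
  obtain K where K: "K > 0" "\<And>\<sigma>. norm (b \<sigma>) \<le> K"
    using carrier_bounded[OF assms(2)] by blast
  obtain f where f: "integrable lborel f" "\<And>\<sigma>. norm (a \<sigma> - rep_apply \<sigma> f) \<le> \<epsilon> / (2 * K)"
    using cstar_carrierD[OF assms(1), of "\<epsilon> / (2 * K)"] e K by auto
  define J where "J = (\<integral>x. norm (f x) \<partial>lborel) + 1"
  have J: "J > 0"
    unfolding J_def by (smt (verit) Bochner_Integration.integral_nonneg norm_ge_zero)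
  have fJ: "norm (rep_apply \<sigma> f) \<le> J" for \<sigma>
    using norm_rep_apply[OF f(1), of \<sigma>] by (simp add: J_def)
  obtain g where g: "integrable lborel g" "\<And>\<sigma>. norm (b \<sigma> - rep_apply \<sigma> g) \<le> \<epsilon> / (2 * J)"
    using cstar_carrierD[OF assms(2), of "\<epsilon> / (2 * J)"] e J by auto
  have "norm ((a \<sigma> o\<^sub>L b \<sigma>) - rep_apply \<sigma> (L1_conv f g)) \<le> \<epsilon>" for \<sigma>
  proof -
    have "(a \<sigma> o\<^sub>L b \<sigma>) - rep_apply \<sigma> (L1_conv f g)
        = ((a \<sigma> - rep_apply \<sigma> f) o\<^sub>L b \<sigma>) + (rep_apply \<sigma> f o\<^sub>L (b \<sigma> - rep_apply \<sigma> g))"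
      by (rule blinfun_eqI)
        (simp add: rep_apply_conv f g blinfun.diff_left blinfun.diff_right blinfun.add_left)
    also have "norm \<dots> \<le> \<epsilon> / (2 * K) * K + J * (\<epsilon> / (2 * J))"
    proof (rule norm_add_rule_thm)
      have "norm ((a \<sigma> - rep_apply \<sigma> f) o\<^sub>L b \<sigma>) \<le> norm (a \<sigma> - rep_apply \<sigma> f) * norm (b \<sigma>)"
        by (rule norm_blinfun_compose)
      also have "\<dots> \<le> \<epsilon> / (2 * K) * K"
        by (intro mult_mono f K) (use e K in simp_all)
      finally show "norm ((a \<sigma> - rep_apply \<sigma> f) o\<^sub>L b \<sigma>) \<le> \<epsilon> / (2 * K) * K" .
      have "norm (rep_apply \<sigma> f o\<^sub>L (b \<sigma> - rep_apply \<sigma> g)) \<le> norm (rep_apply \<sigma> f) * norm (b \<sigma> - rep_apply \<sigma> g)"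
        by (rule norm_blinfun_compose)
      also have "\<dots> \<le> J * (\<epsilon> / (2 * J))"
        by (intro mult_mono fJ g) (use J in simp_all)
      finally show "norm (rep_apply \<sigma> f o\<^sub>L (b \<sigma> - rep_apply \<sigma> g)) \<le> J * (\<epsilon> / (2 * J))" .
    qed
    also have "\<dots> = \<epsilon>" using J K by simp
    finally show ?thesis .
  qed
  then show "\<exists>h. integrable lborel h \<and> (\<forall>\<sigma>. norm ((a \<sigma> o\<^sub>L b \<sigma>) - rep_apply \<sigma> h) \<le> \<epsilon>)"
    using integrable_conv[OF f(1) g(1)] by blast
qed

lemma carrier_approx_seq:
  assumes "a \<in> heis_cstar_carrier"
  obtains f where "\<And>n. integrable lborel (f n)" "\<And>\<sigma>. (\<lambda>n. rep_apply \<sigma> (f n)) \<longlonglongrightarrow> a \<sigma>"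
proof -
  have "\<exists>f. integrable lborel f \<and> (\<forall>\<sigma>. norm (a \<sigma> - rep_apply \<sigma> f) \<le> inverse (real (Suc n)))" for n
    using assms unfolding heis_cstar_carrier_def by simp
  then obtain f where f: "\<And>n. integrable lborel (f n)"
    "\<And>n \<sigma>. norm (a \<sigma> - rep_apply \<sigma> (f n)) \<le> inverse (real (Suc n))"
    by metis
  have "(\<lambda>n. rep_apply \<sigma> (f n)) \<longlonglongrightarrow> a \<sigma>" for \<sigma>
  proof (rule LIM_zero_cancel, rule Lim_null_comparison)
    show "\<forall>\<^sub>F n in sequentially. norm (rep_apply \<sigma> (f n) - a \<sigma>) \<le> inverse (real (Suc n))"
      using f(2) by (simp add: norm_minus_commute)
  qed (rule LIMSEQ_inverse_real_of_nat)
  with f show thesis using that by blast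
qed

lemma carrier_bop:
  assumes "a \<in> heis_cstar_carrier" shows "bop (a \<sigma>)"
proof -
  obtain f where f: "\<And>n. integrable lborel (f n)" "(\<lambda>n. rep_apply \<sigma> (f n)) \<longlonglongrightarrow> a \<sigma>"
    using carrier_approx_seq[OF assms] by metis
  show ?thesis by (rule bop_limit[OF bop_rep_apply[OF f(1)] f(2)])
qed

lemma carrier_is_adjoint:
  assumes "a \<in> heis_cstar_carrier" shows "is_adjoint (a \<sigma>) (adj (a \<sigma>))"
proof -
  obtain f where f: "\<And>n. integrable lborel (f n)" "(\<lambda>n. rep_apply \<sigma> (f n)) \<longlonglongrightarrow> a \<sigma>"
    using carrier_approx_seq[OF assms] by metis
  obtain B where "is_adjoint (a \<sigma>) B"
    using is_adjoint_limit[OF is_adjoint_rep_apply[OF f(1)] f(2)] by blast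
  then show ?thesis using adj_eqI by metis
qed

lemma carrier_adj:
  assumes "a \<in> heis_cstar_carrier"
  shows "(\<lambda>\<sigma>. adj (a \<sigma>)) \<in> heis_cstar_carrier"
proof (rule cstar_carrierI)
  fix \<epsilon> :: real assume e: "0 < \<epsilon>"
  obtain f where f: "integrable lborel f" "\<And>\<sigma>. norm (a \<sigma> - rep_apply \<sigma> f) \<le> \<epsilon>"
    using cstar_carrierD[OF assms e] by blast
  have "norm (adj (a \<sigma>) - rep_apply \<sigma> (L1_invol f)) \<le> \<epsilon>" for \<sigma>
    using norm_is_adjoint_le[OF is_adjoint_diff[OF carrier_is_adjoint[OF assms] is_adjoint_rep_apply[OF f(1)]]]
      f(2)[of \<sigma>] order_trans by blast
  then show "\<exists>h. integrable lborel h \<and> (\<forall>\<sigma>. norm (adj (a \<sigma>) - rep_apply \<sigma> h) \<le> \<epsilon>)"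
    using integrable_invol[OF f(1)] by blast
qed

typedef heis_cstar = heis_cstar_carrier
  morphisms cstar_apply Abs_heis_cstar
  using carrier_zero by blast

setup_lifting type_definition_heis_cstar

lemma cstar_eqI: "(\<And>\<sigma>. cstar_apply a \<sigma> = cstar_apply b \<sigma>) \<Longrightarrow> a = b"
  using cstar_apply_inject by blast

instantiation heis_cstar :: real_vector
begin

lift_definition zero_heis_cstar :: heis_cstar is "\<lambda>_. 0" by (rule carrier_zero)
lift_definition plus_heis_cstar :: "heis_cstar \<Rightarrow> heis_cstar \<Rightarrow> heis_cstar" is "\<lambda>a b \<sigma>. a \<sigma> + b \<sigma>"
  by (rule carrier_add)
lift_definition minus_heis_cstar :: "heis_cstar \<Rightarrow> heis_cstar \<Rightarrow> heis_cstar" is "\<lambda>a b \<sigma>. a \<sigma> - b \<sigma>"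
  by (rule carrier_minus)
lift_definition uminus_heis_cstar :: "heis_cstar \<Rightarrow> heis_cstar" is "\<lambda>a \<sigma>. - a \<sigma>"
  by (rule carrier_uminus)
lift_definition scaleR_heis_cstar :: "real \<Rightarrow> heis_cstar \<Rightarrow> heis_cstar" is "\<lambda>r a \<sigma>. r *\<^sub>R a \<sigma>"
  by (rule carrier_scaleR)

instance
  by standard (transfer; simp add: algebra_simps)+

end

instantiation heis_cstar :: real_normed_vector
begin

definition norm_heis_cstar :: "heis_cstar \<Rightarrow> real" where
  "norm_heis_cstar a = (SUP \<sigma>. norm (cstar_apply a \<sigma>))"
definition "dist (a :: heis_cstar) b = norm (a - b)"
definition "sgn (a :: heis_cstar) = a /\<^sub>R norm a"
definition "uniformity = (INF e\<in>{0 <..}. principal {(x, y :: heis_cstar). dist x y < e})"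
definition "open S \<longleftrightarrow> (\<forall>x\<in>S. eventually (\<lambda>(x', y). x' = x \<longrightarrow> y \<in> S)
   (uniformity :: (heis_cstar \<times> heis_cstar) filter))"

lemma norm_cstar_apply: "norm (cstar_apply a \<sigma>) \<le> norm a"
proof -
  obtain K where "\<And>\<sigma>. norm (cstar_apply a \<sigma>) \<le> K"
    using carrier_bounded[OF cstar_apply] by blast
  then have "bdd_above (range (\<lambda>\<sigma>. norm (cstar_apply a \<sigma>)))" by (auto intro!: bdd_aboveI)
  then show ?thesis unfolding norm_heis_cstar_def by (rule cSUP_upper[rotated]) simp
qed

lemma norm_cstar_le: "(\<And>\<sigma>. norm (cstar_apply a \<sigma>) \<le> K) \<Longrightarrow> norm a \<le> K"
  unfolding norm_heis_cstar_def by (rule cSUP_least) auto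

lemma norm_cstar_nonneg: "0 \<le> norm (a :: heis_cstar)"
  using norm_cstar_apply norm_ge_zero order_trans by metis

instance
proof
  fix a b :: heis_cstar and r :: real
  show "dist a b = norm (a - b)" by (rule dist_heis_cstar_def)
  show "sgn a = a /\<^sub>R norm a" by (rule sgn_heis_cstar_def)
  show "uniformity = (INF e\<in>{0 <..}. principal {(x, y :: heis_cstar). dist x y < e})"
    by (rule uniformity_heis_cstar_def)
  show "open S \<longleftrightarrow> (\<forall>x\<in>S. eventually (\<lambda>(x', y). x' = x \<longrightarrow> y \<in> S) uniformity)" for S :: "heis_cstar set"
    by (rule open_heis_cstar_def)
  show "(norm a = 0) = (a = 0)"
  proof
    assume "norm a = 0"
    then have "cstar_apply a \<sigma> = 0" for \<sigma> using norm_cstar_apply[of a \<sigma>] by simp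
    then show "a = 0" by (intro cstar_eqI) (simp add: zero_heis_cstar.rep_eq)
  next
    assume "a = 0"
    then have "norm a \<le> 0" by (intro norm_cstar_le) (simp add: zero_heis_cstar.rep_eq)
    then show "norm a = 0" using norm_cstar_nonneg[of a] by simp
  qed
  show "norm (a + b) \<le> norm a + norm b"
    by (rule norm_cstar_le)
      (simp add: plus_heis_cstar.rep_eq norm_add_rule_thm[OF norm_cstar_apply norm_cstar_apply])
  show "norm (r *\<^sub>R a) = \<bar>r\<bar> * norm a"
  proof (rule antisym)
    show "norm (r *\<^sub>R a) \<le> \<bar>r\<bar> * norm a"
      by (rule norm_cstar_le) (simp add: scaleR_heis_cstar.rep_eq mult_left_mono norm_cstar_apply)
    show "\<bar>r\<bar> * norm a \<le> norm (r *\<^sub>R a)"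
    proof (cases "r = 0")
      case False
      have "norm a \<le> norm (r *\<^sub>R a) / \<bar>r\<bar>"
      proof (rule norm_cstar_le)
        fix \<sigma>
        show "norm (cstar_apply a \<sigma>) \<le> norm (r *\<^sub>R a) / \<bar>r\<bar>"
          using norm_cstar_apply[of "r *\<^sub>R a" \<sigma>] False
          by (simp add: scaleR_heis_cstar.rep_eq field_simps)
      qed
      then show ?thesis using False by (simp add: field_simps)
    qed (simp add: norm_cstar_nonneg)
  qed
qed

end

lemma heis_cstar_complete:
  fixes X :: "nat \<Rightarrow> heis_cstar"
  assumes "Cauchy X" shows "convergent X"
proof -
  have conv: "convergent (\<lambda>n. cstar_apply (X n) \<sigma>)" for \<sigma>
  proof (rule Cauchy_convergent, rule CauchyI)
    fix e :: real assume "e > 0"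
    from CauchyD[OF assms this] obtain M where "\<forall>m\<ge>M. \<forall>n\<ge>M. norm (X m - X n) < e" by blast
    then show "\<exists>M. \<forall>m\<ge>M. \<forall>n\<ge>M. norm (cstar_apply (X m) \<sigma> - cstar_apply (X n) \<sigma>) < e"
      using norm_cstar_apply[of "X _ - X _" \<sigma>] by (metis minus_heis_cstar.rep_eq order_le_less_trans)
  qed
  define a where "a \<sigma> = lim (\<lambda>n. cstar_apply (X n) \<sigma>)" for \<sigma>
  have lim: "(\<lambda>n. cstar_apply (X n) \<sigma>) \<longlonglongrightarrow> a \<sigma>" for \<sigma>
    using conv[of \<sigma>] by (simp add: a_def convergent_LIMSEQ_iff)
  have est: "norm (cstar_apply (X n) \<sigma> - a \<sigma>) \<le> e"
    if N: "\<forall>m\<ge>N. \<forall>k\<ge>N. norm (X m - X k) < e" and "n \<ge> N" for n N e \<sigma>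
  proof (rule LIMSEQ_le_const2)
    show "(\<lambda>m. norm (cstar_apply (X n) \<sigma> - cstar_apply (X m) \<sigma>)) \<longlonglongrightarrow> norm (cstar_apply (X n) \<sigma> - a \<sigma>)"
      by (intro tendsto_intros lim)
    show "\<exists>N. \<forall>m\<ge>N. norm (cstar_apply (X n) \<sigma> - cstar_apply (X m) \<sigma>) \<le> e"
    proof (intro exI allI impI)
      fix m assume "m \<ge> N"
      then have "norm (X n - X m) < e" using N \<open>n \<ge> N\<close> by blast
      then show "norm (cstar_apply (X n) \<sigma> - cstar_apply (X m) \<sigma>) \<le> e"
        using norm_cstar_apply[of "X n - X m" \<sigma>] by (simp add: minus_heis_cstar.rep_eq)
    qed
  qed
  have aC: "a \<in> heis_cstar_carrier"
  proof (rule cstar_carrierI)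
    fix e :: real assume "e > 0"
    then have e: "0 < e / 2" by simp
    obtain N where N: "\<forall>m\<ge>N. \<forall>k\<ge>N. norm (X m - X k) < e / 2"
      using CauchyD[OF assms e] by blast
    obtain f where f: "integrable lborel f" "\<And>\<sigma>. norm (cstar_apply (X N) \<sigma> - rep_apply \<sigma> f) \<le> e / 2"
      using cstar_carrierD[OF cstar_apply e] by blast
    have "norm (a \<sigma> - rep_apply \<sigma> f) \<le> e" for \<sigma>
    proof -
      have "a \<sigma> - rep_apply \<sigma> f = (cstar_apply (X N) \<sigma> - rep_apply \<sigma> f) - (cstar_apply (X N) \<sigma> - a \<sigma>)"
        by simp
      also have "norm \<dots> \<le> e / 2 + e / 2"
        using norm_triangle_ineq4 f(2)[of \<sigma>] est[OF N order_refl, of \<sigma>] by (meson add_mono order_trans)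
      finally show ?thesis by simp
    qed
    with f(1) show "\<exists>f. integrable lborel f \<and> (\<forall>\<sigma>. norm (a \<sigma> - rep_apply \<sigma> f) \<le> e)" by blast
  qed
  have "X \<longlonglongrightarrow> Abs_heis_cstar a"
  proof (rule LIMSEQ_I)
    fix e :: real assume "e > 0"
    then have e: "0 < e / 2" by simp
    obtain N where N: "\<forall>m\<ge>N. \<forall>k\<ge>N. norm (X m - X k) < e / 2"
      using CauchyD[OF assms e] by blast
    have "norm (X n - Abs_heis_cstar a) < e" if "n \<ge> N" for n
    proof -
      have "norm (X n - Abs_heis_cstar a) \<le> e / 2"
        using est[OF N that]
        by (intro norm_cstar_le) (simp add: minus_heis_cstar.rep_eq Abs_heis_cstar_inverse aC)
      then show ?thesis using \<open>e > 0\<close> by simp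
    qed
    then show "\<exists>N. \<forall>n\<ge>N. norm (X n - Abs_heis_cstar a) < e" by blast
  qed
  then show ?thesis unfolding convergent_def by blast
qed

instantiation heis_cstar :: cstar_algebra
begin

lift_definition scaleC_heis_cstar :: "complex \<Rightarrow> heis_cstar \<Rightarrow> heis_cstar" is "\<lambda>c a \<sigma>. scalar_op c o\<^sub>L a \<sigma>"
  by (rule carrier_scalar)
lift_definition times_heis_cstar :: "heis_cstar \<Rightarrow> heis_cstar \<Rightarrow> heis_cstar" is "\<lambda>a b \<sigma>. a \<sigma> o\<^sub>L b \<sigma>"
  by (rule carrier_mult)
lift_definition star_heis_cstar :: "heis_cstar \<Rightarrow> heis_cstar" is "\<lambda>a \<sigma>. adj (a \<sigma>)"
  by (rule carrier_adj)

instance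
proof
  fix X :: "nat \<Rightarrow> heis_cstar" assume "Cauchy X" then show "convergent X" by (rule heis_cstar_complete)
next
  fix a b c :: heis_cstar and z w :: complex and r :: real
  note rep_eqs = plus_heis_cstar.rep_eq times_heis_cstar.rep_eq scaleC_heis_cstar.rep_eq
    scaleR_heis_cstar.rep_eq star_heis_cstar.rep_eq
  have isadj: "is_adjoint (cstar_apply a \<sigma>) (adj (cstar_apply a \<sigma>))" for a \<sigma>
    by (rule carrier_is_adjoint[OF cstar_apply])
  have bop: "cstar_apply a \<sigma> (c *\<^sub>C \<xi>) = c *\<^sub>C cstar_apply a \<sigma> \<xi>" for a \<sigma> c \<xi>
    using carrier_bop[OF cstar_apply] by (simp add: bop_def)
  show "a * b * c = a * (b * c)"
    by (rule cstar_eqI, rule blinfun_eqI) (simp add: rep_eqs)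
  show "(a + b) * c = a * c + b * c"
    by (rule cstar_eqI, rule blinfun_eqI) (simp add: rep_eqs blinfun.add_left)
  show "a * (b + c) = a * b + a * c"
    by (rule cstar_eqI, rule blinfun_eqI) (simp add: rep_eqs blinfun.add_left blinfun.add_right)
  show "r *\<^sub>R a * b = r *\<^sub>R (a * b)"
    by (rule cstar_eqI, rule blinfun_eqI) (simp add: rep_eqs blinfun.scaleR_left)
  show "a * r *\<^sub>R b = r *\<^sub>R (a * b)"
    by (rule cstar_eqI, rule blinfun_eqI) (simp add: rep_eqs blinfun.scaleR_left blinfun.scaleR_right)
  show "norm (a * b) \<le> norm a * norm b"
  proof (rule norm_cstar_le)
    fix \<sigma>
    have "norm (cstar_apply (a * b) \<sigma>) \<le> norm (cstar_apply a \<sigma>) * norm (cstar_apply b \<sigma>)"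
      by (simp add: rep_eqs norm_blinfun_compose)
    also have "\<dots> \<le> norm a * norm b" by (intro mult_mono norm_cstar_apply) simp_all
    finally show "norm (cstar_apply (a * b) \<sigma>) \<le> norm a * norm b" .
  qed
  show "z *\<^sub>C (a + b) = z *\<^sub>C a + z *\<^sub>C b"
    by (rule cstar_eqI, rule blinfun_eqI) (simp add: rep_eqs blinfun.add_left scaleC_add_right)
  show "(z + w) *\<^sub>C a = z *\<^sub>C a + w *\<^sub>C a"
    by (rule cstar_eqI, rule blinfun_eqI) (simp add: rep_eqs blinfun.add_left scaleC_add_left)
  show "z *\<^sub>C w *\<^sub>C a = (z * w) *\<^sub>C a"
    by (rule cstar_eqI, rule blinfun_eqI) (simp add: rep_eqs scaleC_scaleC)
  show "r *\<^sub>R a = complex_of_real r *\<^sub>C a"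
    by (rule cstar_eqI) (simp add: rep_eqs scalar_op_of_real)
  show "norm (z *\<^sub>C a) = cmod z * norm a"
  proof (rule antisym)
    show "norm (z *\<^sub>C a) \<le> cmod z * norm a"
      by (rule norm_cstar_le) (simp add: rep_eqs norm_scalar_op_compose mult_left_mono norm_cstar_apply)
    show "cmod z * norm a \<le> norm (z *\<^sub>C a)"
    proof (cases "z = 0")
      case False
      have "norm a \<le> norm (z *\<^sub>C a) / cmod z"
      proof (rule norm_cstar_le)
        fix \<sigma>
        show "norm (cstar_apply a \<sigma>) \<le> norm (z *\<^sub>C a) / cmod z"
          using norm_cstar_apply[of "z *\<^sub>C a" \<sigma>] False
          by (simp add: rep_eqs norm_scalar_op_compose field_simps)
      qed
      then show ?thesis using False by (simp add: field_simps)
    qed simp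
  qed
  show "z *\<^sub>C a * b = z *\<^sub>C (a * b)"
    by (rule cstar_eqI, rule blinfun_eqI) (simp add: rep_eqs)
  show "a * z *\<^sub>C b = z *\<^sub>C (a * b)"
    by (rule cstar_eqI, rule blinfun_eqI) (simp add: rep_eqs bop)
  show "star (star a) = a"
    by (rule cstar_eqI) (simp add: rep_eqs adj_eqI[OF is_adjoint_sym[OF isadj]])
  show "star (a + b) = star a + star b"
    by (rule cstar_eqI) (simp add: rep_eqs adj_eqI[OF is_adjoint_add[OF isadj isadj]])
  show "star (z *\<^sub>C a) = cnj z *\<^sub>C star a"
  proof (rule cstar_eqI)
    fix \<sigma>
    have "is_adjoint (scalar_op z) (scalar_op (cnj z) :: L2_heis \<Rightarrow>\<^sub>L L2_heis)"
      by (simp add: is_adjoint_def cinner_scaleC_left cinner_scaleC_right)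
    from adj_eqI[OF is_adjoint_compose[OF this isadj[of a \<sigma>]]]
    have "cstar_apply (star (z *\<^sub>C a)) \<sigma> = cstar_apply (star a) \<sigma> o\<^sub>L scalar_op (cnj z)"
      by (simp add: rep_eqs)
    also have "\<dots> = cstar_apply (cnj z *\<^sub>C star a) \<sigma>"
      by (rule blinfun_eqI) (simp add: scaleC_heis_cstar.rep_eq bop)
    finally show "cstar_apply (star (z *\<^sub>C a)) \<sigma> = cstar_apply (cnj z *\<^sub>C star a) \<sigma>" .
  qed
  show "star (a * b) = star b * star a"
    by (rule cstar_eqI) (simp add: rep_eqs adj_eqI[OF is_adjoint_compose[OF isadj isadj]])
  have eq: "norm (cstar_apply (star a * a) \<sigma>) = (norm (cstar_apply a \<sigma>))\<^sup>2" for \<sigma>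
    by (simp add: rep_eqs is_adjoint_cstar[OF isadj])
  show "norm (star a * a) = (norm a)\<^sup>2"
  proof (rule antisym)
    show "norm (star a * a) \<le> (norm a)\<^sup>2"
      by (rule norm_cstar_le) (simp only: eq power_mono[OF norm_cstar_apply] norm_ge_zero)
    have "norm a \<le> sqrt (norm (star a * a))"
      by (rule norm_cstar_le) (rule real_le_rsqrt, metis eq norm_cstar_apply)
    then have "(norm a)\<^sup>2 \<le> (sqrt (norm (star a * a)))\<^sup>2" by (rule power_mono) simp
    then show "(norm a)\<^sup>2 \<le> norm (star a * a)" by simp
  qed
qed

end

section \<open>The dilation action\<close>

definition heis_dil :: "real \<Rightarrow> heis \<Rightarrow> heis" where
  "heis_dil t = (\<lambda>(a, b, c). (t * a, t * b, t\<^sup>2 * c))"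

text \<open>The map on \<open>L\<^sup>1\<close> induced by the automorphism \<open>heis_dil t\<close>, whose modulus is \<open>t\<^sup>4\<close>; it is extended to
  the C*-algebra through its universal representation.\<close>

definition L1_dil :: "real \<Rightarrow> (heis \<Rightarrow> complex) \<Rightarrow> heis \<Rightarrow> complex" where
  "L1_dil t f x = f (heis_dil (inverse t) x) / t ^ 4"

definition rep_dil :: "real \<Rightarrow> L1_rep \<Rightarrow> L1_rep" where
  "rep_dil t \<sigma> = Abs_L1_rep (\<lambda>f. rep_apply \<sigma> (L1_dil t f))"

definition cstar_dil :: "real \<Rightarrow> heis_cstar \<Rightarrow> heis_cstar" where
  "cstar_dil t a = Abs_heis_cstar (\<lambda>\<sigma>. cstar_apply a (rep_dil t \<sigma>))"

lemma heis_dil_tri: "heis_dil t = heis_tri 0 t 0 t (t\<^sup>2) (\<lambda>_. 0)"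
  by (auto simp: heis_dil_def heis_tri_def)

lemma heis_dil_mult: "heis_dil t (heis_mult x y) = heis_mult (heis_dil t x) (heis_dil t y)"
  by (cases x; cases y) (simp add: heis_dil_def heis_mult_def algebra_simps power2_eq_square)

lemma heis_dil_inv: "heis_dil t (heis_inv x) = heis_inv (heis_dil t x)"
  by (cases x) (simp add: heis_dil_def heis_inv_def algebra_simps power2_eq_square)

lemma heis_dil_measurable [measurable]: "heis_dil t \<in> borel_measurable borel"
  unfolding heis_dil_tri by (rule heis_tri_measurable) simp

lemma integrable_L1_dil:
  assumes "0 < t" "integrable lborel f" shows "integrable lborel (L1_dil t f)"
  unfolding L1_dil_def heis_dil_tri
  by (intro integrable_divide_zero integrable_heis_tri) (use assms in simp_all)

lemma integral_heis_dil:
  fixes f :: "heis \<Rightarrow> 'b::{banach, second_countable_topology}"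
  assumes "0 < t" "f \<in> borel_measurable borel"
  shows "(\<integral>x. f (heis_dil (inverse t) x) \<partial>lborel) = t ^ 4 *\<^sub>R (\<integral>x. f x \<partial>lborel)"
proof -
  have "(\<integral>x. f x \<partial>lborel) = inverse (t ^ 4) *\<^sub>R (\<integral>x. f (heis_dil (inverse t) x) \<partial>lborel)"
    unfolding heis_dil_tri using assms
    by (subst integral_heis_tri[of "\<lambda>_. 0" f "inverse t" "inverse t" "(inverse t)\<^sup>2" 0 0])
      (simp_all add: abs_mult power2_eq_square power4_eq_xxxx mult.assoc)
  then show ?thesis using assms by simp
qed

lemma conv_L1_dil:
  assumes "0 < t" "f \<in> borel_measurable borel" "g \<in> borel_measurable borel"
  shows "L1_conv (L1_dil t f) (L1_dil t g) = L1_dil t (L1_conv f g)"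
proof
  fix x
  note [measurable] = assms(2,3)
  define d where "d = heis_dil (inverse t)"
  have "L1_conv (L1_dil t f) (L1_dil t g) x
      = (\<integral>y. f (d y) * g (heis_mult (heis_inv (d y)) (d x)) / (t ^ 4 * t ^ 4) \<partial>lborel)"
    unfolding L1_conv_def L1_dil_def by (simp add: d_def heis_dil_mult heis_dil_inv)
  also have "\<dots> = (\<integral>y. f (d y) * g (heis_mult (heis_inv (d y)) (d x)) \<partial>lborel) / (t ^ 4 * t ^ 4)"
    by (simp only: integral_divide_zero)
  also have "\<dots> = (t ^ 4 *\<^sub>R L1_conv f g (d x)) / (t ^ 4 * t ^ 4)"
    unfolding L1_conv_def d_def
    by (subst integral_heis_dil[OF assms(1), of "\<lambda>y. f y * g (heis_mult (heis_inv y) (heis_dil (inverse t) x))"])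
      simp_all
  also have "\<dots> = L1_dil t (L1_conv f g) x"
    using assms(1) by (simp add: L1_dil_def d_def scaleR_conv_of_real divide_simps flip: power_add)
  finally show "L1_conv (L1_dil t f) (L1_dil t g) x = L1_dil t (L1_conv f g) x" .
qed

lemma L1_star_rep_dil:
  assumes t: "0 < t"
  shows "L1_star_rep (\<lambda>f. rep_apply \<sigma> (L1_dil t f))"
  unfolding L1_star_rep_def
proof (intro allI impI conjI)
  fix f :: "heis \<Rightarrow> complex" assume f: "integrable lborel f"
  then have [measurable]: "f \<in> borel_measurable borel"
    using borel_measurable_integrable[OF f] by simp
  note tf = integrable_L1_dil[OF t f]
  show "bop (rep_apply \<sigma> (L1_dil t f))" by (rule bop_rep_apply[OF tf])
  have "norm (rep_apply \<sigma> (L1_dil t f)) \<le> (\<integral>x. norm (L1_dil t f x) \<partial>lborel)"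
    by (rule norm_rep_apply[OF tf])
  also have "\<dots> = (\<integral>x. norm (f (heis_dil (inverse t) x)) \<partial>lborel) / t ^ 4"
    using t by (simp add: L1_dil_def norm_divide norm_power)
  also have "\<dots> = (\<integral>x. norm (f x) \<partial>lborel)"
    using t by (subst integral_heis_dil[of t "\<lambda>x. norm (f x)"]) simp_all
  finally show "norm (rep_apply \<sigma> (L1_dil t f)) \<le> (\<integral>x. norm (f x) \<partial>lborel)" .
  have "L1_dil t (\<lambda>x. c * f x) = (\<lambda>x. c * L1_dil t f x)" for c
    by (auto simp: L1_dil_def)
  then show "rep_apply \<sigma> (L1_dil t (\<lambda>x. c * f x)) \<xi> = c *\<^sub>C rep_apply \<sigma> (L1_dil t f) \<xi>" for c \<xi>
    by (simp add: rep_apply_scaleC[OF tf])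
  have "L1_dil t (L1_invol f) = L1_invol (L1_dil t f)"
    by (auto simp: L1_dil_def L1_invol_def heis_dil_inv)
  then show "is_adjoint (rep_apply \<sigma> (L1_dil t f)) (rep_apply \<sigma> (L1_dil t (L1_invol f)))"
    by (simp add: is_adjoint_rep_apply[OF tf])
  fix g :: "heis \<Rightarrow> complex" assume g: "integrable lborel g"
  then have [measurable]: "g \<in> borel_measurable borel"
    using borel_measurable_integrable[OF g] by simp
  note tg = integrable_L1_dil[OF t g]
  have "L1_dil t (\<lambda>x. f x + g x) = (\<lambda>x. L1_dil t f x + L1_dil t g x)"
    by (auto simp: L1_dil_def add_divide_distrib)
  then show "rep_apply \<sigma> (L1_dil t (\<lambda>x. f x + g x)) = rep_apply \<sigma> (L1_dil t f) + rep_apply \<sigma> (L1_dil t g)"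
    by (simp add: rep_apply_add[OF tf tg])
  show "rep_apply \<sigma> (L1_dil t (L1_conv f g)) = rep_apply \<sigma> (L1_dil t f) o\<^sub>L rep_apply \<sigma> (L1_dil t g)"
    by (simp add: rep_apply_conv[OF tf tg] t flip: conv_L1_dil)
qed

lemma rep_apply_rep_dil: "0 < t \<Longrightarrow> rep_apply (rep_dil t \<sigma>) f = rep_apply \<sigma> (L1_dil t f)"
  unfolding rep_dil_def by (subst Abs_L1_rep_inverse) (simp_all add: L1_star_rep_dil)

lemma cstar_apply_cstar_dil:
  assumes t: "0 < t"
  shows "cstar_apply (cstar_dil t a) \<sigma> = cstar_apply a (rep_dil t \<sigma>)"
proof -
  have "(\<lambda>\<sigma>. cstar_apply a (rep_dil t \<sigma>)) \<in> heis_cstar_carrier"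
  proof (rule cstar_carrierI)
    fix \<epsilon> :: real assume "0 < \<epsilon>"
    then obtain f where f: "integrable lborel f" "\<And>\<sigma>. norm (cstar_apply a \<sigma> - rep_apply \<sigma> f) \<le> \<epsilon>"
      using cstar_carrierD[OF cstar_apply] by blast
    have "norm (cstar_apply a (rep_dil t \<sigma>) - rep_apply \<sigma> (L1_dil t f)) \<le> \<epsilon>" for \<sigma>
      using f(2)[of "rep_dil t \<sigma>"] by (simp add: rep_apply_rep_dil t)
    then show "\<exists>f. integrable lborel f \<and> (\<forall>\<sigma>. norm (cstar_apply a (rep_dil t \<sigma>) - rep_apply \<sigma> f) \<le> \<epsilon>)"
      using integrable_L1_dil[OF t f(1)] by blast
  qed
  then show ?thesis
    unfolding cstar_dil_def by (simp add: Abs_heis_cstar_inverse)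
qed

section \<open>The spectral triple\<close>

definition L2_dil :: "real \<Rightarrow> (L2_heis \<Rightarrow>\<^sub>L L2_heis)" where
  "L2_dil t = Blinfun (\<lambda>\<xi>. abs_L2_heis (\<lambda>x. (1 / t\<^sup>2) *\<^sub>R rep_L2_heis \<xi> (heis_dil (inverse t) x)))"

definition left_conv :: "(heis \<Rightarrow> complex) \<Rightarrow> (heis \<Rightarrow> complex^2) \<Rightarrow> heis \<Rightarrow> complex^2" where
  "left_conv f \<xi> x = (\<integral>y. f y *s \<xi> (heis_mult (heis_inv y) x) \<partial>lborel)"

text \<open>The integrated form \<open>f \<mapsto> \<integral> f(y) \<lambda>(y) dy\<close> of \<open>(\<lambda>(y) \<xi>)(x) = \<xi>(y\<^sup>-\<^sup>1 x)\<close>; it is an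
  \<^const>\<open>L1_star_rep\<close> by Young's inequality.\<close>

definition left_regular :: L1_rep where
  "left_regular = Abs_L1_rep (\<lambda>f. Blinfun (\<lambda>\<xi>. abs_L2_heis (left_conv f (rep_L2_heis \<xi>))))"

definition left_regular_rep :: "heis_cstar \<Rightarrow> (L2_heis \<Rightarrow>\<^sub>L L2_heis)" where
  "left_regular_rep a = cstar_apply a left_regular"

text \<open>Multiplication by a matrix valued function, on its maximal domain.\<close>

definition mult_op :: "(heis \<Rightarrow> complex^2^2) \<Rightarrow> L2_heis oper" where
  "mult_op m = {(\<xi>, \<eta>). AE x in lborel. rep_L2_heis \<eta> x = m x *v rep_L2_heis \<xi> x}"

definition ell :: "complex^2^2 \<Rightarrow> complex^2^2 \<Rightarrow> complex^2^2 \<Rightarrow> heis \<Rightarrow> complex^2^2" where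
  "ell \<gamma>1 \<gamma>2 \<gamma>3 = (\<lambda>(a, b, c).
     sqrt (a\<^sup>2 + b\<^sup>2) *\<^sub>R (a *\<^sub>R \<gamma>1 + b *\<^sub>R \<gamma>2) + c *\<^sub>R \<gamma>3)"

definition conj_transpose :: "complex^2^2 \<Rightarrow> complex^2^2" where
  "conj_transpose A = (\<chi> i j. cnj (A $ j $ i))"

definition clifford_generators :: "complex^2^2 \<Rightarrow> complex^2^2 \<Rightarrow> complex^2^2 \<Rightarrow> bool" where
  "clifford_generators \<gamma>1 \<gamma>2 \<gamma>3 \<longleftrightarrow>
     (\<forall>\<gamma>\<in>{\<gamma>1, \<gamma>2, \<gamma>3}. conj_transpose \<gamma> = \<gamma> \<and>
        \<gamma> ** conj_transpose \<gamma> = mat 1 \<and> conj_transpose \<gamma> ** \<gamma> = mat 1) \<and>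
     \<gamma>1 ** \<gamma>2 = - (\<gamma>2 ** \<gamma>1) \<and> \<gamma>1 ** \<gamma>3 = - (\<gamma>3 ** \<gamma>1) \<and> \<gamma>2 ** \<gamma>3 = - (\<gamma>3 ** \<gamma>2)"

definition pos_reals :: "real monoid" where
  "pos_reals = \<lparr>carrier = {0<..}, monoid.mult = (*), one = 1\<rparr>"

end

theory Submission
  imports Defs
begin

text \<open>
  Write \<open>D\<close> for the operator of multiplication by \<open>\<ell>\<close> and \<open>N\<close> for the Koranyi norm
  \<open>N(a, b, c) = ((a\<^sup>2 + b\<^sup>2)\<^sup>2 + c\<^sup>2)\<^bsup>1/4\<^esup>\<close>. The Clifford relations give \<open>\<ell>(x)\<^sup>2 = N(x)\<^sup>4\<close>, so that every
  function of \<open>D\<^sup>2\<close> that occurs is an explicit multiplication operator: \<open>(1 + D\<^sup>2)\<^sup>-\<^sup>1\<close> multiplies by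
  \<open>1 / (1 + N\<^sup>4)\<close> and \<open>\<langle>D\<rangle>\<^bsup>-1/2\<^esup>\<close> by \<open>(1 + N\<^sup>4)\<^bsup>-1/4\<^esup>\<close>
  (\<open>inv_one_plus_sq_D\<close>, \<open>bracket_neg_power_D\<close>).

  Since \<open>C\<^sup>*(H\<^sup>3)\<close> is the closure of the operators of convolution with continuous functions \<open>f\<close> of compact
  support (\<open>cont_supp_dense_cstar\<close>), the two analytic conditions need only be verified for these.

  The commutator of \<open>D\<close> with the convolution by \<open>f\<close> has the kernel \<open>f(y) (\<ell>(x) - \<ell>(y\<^sup>-\<^sup>1 x))\<close>. The function
  \<open>\<ell>\<close> has homogeneous degree 2, and its difference along a translation by a bounded \<open>y\<close> has degree 1: it is
  \<open>O(1 + \<bar>(a, b)\<bar>)\<close>, hence \<open>O((1 + N\<^sup>4)\<^bsup>1/4\<^esup>)\<close>, at either of the two points (\<open>ell_mult_diff\<close>). This is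
  exactly what \<open>\<langle>D\<rangle>\<^bsup>-1/2\<^esup>\<close> compensates on either side, after which Young's inequality bounds the operator
  (\<open>conv_op_in_Lip\<close>). This explains the order 2.

  For the compactness of \<open>(1 + D\<^sup>2)\<^sup>-\<^sup>1\<close> times a convolution, the weight \<open>1 / (1 + N\<^sup>4)\<close> vanishes at
  infinity, which leaves a continuous kernel over a compact set; such a kernel is uniformly approximated by
  kernels that are step functions in \<open>x\<close>, which have finite rank (\<open>compact_weight_conv_op\<close>).

  Finally \<open>\<ell>(t x) = t\<^sup>2 \<ell>(x)\<close> for the dilations, so \<open>U\<^sub>t D U\<^sub>t\<^sup>* = t\<^sup>-\<^sup>2 D = \<mu>\<^sub>t D \<mu>\<^sub>t\<^sup>*\<close> with \<open>\<mu>\<^sub>t = t\<^sup>-\<^sup>1\<close>. With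
  scalar conformal factors, all conformal defects and commutators of the identity operator vanish. Therefore
  the identity is itself a conformal multiplier (\<open>id_conformal_multiplier\<close>), and the density conditions
  on \<open>A\<Q>\<close> and \<open>\<Q>A\<close> are immediate. What remains is the continuity of the dilations in \<open>L\<^sup>1\<close> and \<open>L\<^sup>2\<close>, by
  dominated convergence on continuous functions of compact support (\<open>dilation_tendsto\<close>), and the covariance
  of the regular representation.
\<close>

section \<open>Representatives of square integrable functions\<close>

abbreviation rep :: "L2_heis \<Rightarrow> heis \<Rightarrow> complex^2" where
  "rep \<equiv> rep_L2_heis"

abbreviation ldiv :: "heis \<Rightarrow> heis \<Rightarrow> heis" where
  "ldiv y x \<equiv> heis_mult (heis_inv y) x"

lemma rep_abs_L2_heis: "square_integrable f \<Longrightarrow> AE x in lborel. rep (abs_L2_heis f) x = f x"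
  using Quotient3_rep_abs[OF Quotient3_L2_heis, of f] by simp

lemma L2_heis_eqI: "AE x in lborel. rep \<xi> x = rep \<eta> x \<Longrightarrow> \<xi> = \<eta>"
  using Quotient3_rel_rep[OF Quotient3_L2_heis, of \<xi> \<eta>] by simp

lemma abs_L2_heis_cong:
  "square_integrable f \<Longrightarrow> square_integrable g \<Longrightarrow> AE x in lborel. f x = g x \<Longrightarrow> abs_L2_heis f = abs_L2_heis g"
  using Quotient3_rel_abs[OF Quotient3_L2_heis, of f g] by simp

lemma rep_L2_heis_measurable [measurable]: "rep \<xi> \<in> borel_measurable borel"
  using square_integrable_rep[of \<xi>] by (simp add: square_integrable_def)

lemma rep_L2_heis_add: "AE x in lborel. rep (\<xi> + \<eta>) x = rep \<xi> x + rep \<eta> x"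
  using rep_abs_L2_heis[OF square_integrable_add[OF square_integrable_rep square_integrable_rep]]
    plus_L2_heis.abs_eq[of "rep \<xi>" "rep \<eta>"] by simp

lemma rep_L2_heis_diff: "AE x in lborel. rep (\<xi> - \<eta>) x = rep \<xi> x - rep \<eta> x"
  using rep_abs_L2_heis[OF square_integrable_diff[OF square_integrable_rep square_integrable_rep]]
    minus_L2_heis.abs_eq[of "rep \<xi>" "rep \<eta>"] by simp

lemma rep_L2_heis_scaleC: "AE x in lborel. rep (c *\<^sub>C \<xi>) x = c *s rep \<xi> x"
  using rep_abs_L2_heis[OF square_integrable_smult[OF square_integrable_rep]]
    scaleC_L2_heis.abs_eq[of "rep \<xi>"] by simp

lemma rep_L2_heis_scaleR: "AE x in lborel. rep (r *\<^sub>R \<xi>) x = r *\<^sub>R rep \<xi> x"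
  using rep_L2_heis_scaleC[of "complex_of_real r"] by (simp add: scaleR_scaleC scaleR_smult)

lemma rep_L2_heis_zero: "AE x in lborel. rep 0 x = 0"
  using rep_L2_heis_scaleR[of 0 0] by simp

lemma cinner_L2_heis_eq: "cinner \<xi> \<eta> = (\<integral>x. c2_inner (rep \<xi> x) (rep \<eta> x) \<partial>lborel)"
  using cinner_L2_heis.abs_eq[of "rep \<xi>" "rep \<eta>"] by simp

lemma norm_L2_heis_eq: "(norm \<xi>)\<^sup>2 = (\<integral>x. (norm (rep \<xi> x))\<^sup>2 \<partial>lborel)"
  using norm_abs_L2_heis[of "rep \<xi>"] by simp

lemma nn_norm_L2_heis: "(\<integral>\<^sup>+x. ennreal ((norm (rep \<xi> x))\<^sup>2) \<partial>lborel) = ennreal ((norm \<xi>)\<^sup>2)"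
  using nn_norm_abs_L2_heis[of "rep \<xi>"] by simp

lemma square_integrable_nn_bound:
  assumes "f \<in> borel_measurable borel" "(\<integral>\<^sup>+x. ennreal ((norm (f x))\<^sup>2) \<partial>lborel) \<le> ennreal C"
  shows "square_integrable f"
  using assms by (auto simp: square_integrable_def integrable_iff_bounded intro: order.strict_trans1)

lemma norm_abs_L2_heis_le:
  assumes "square_integrable f" "(\<integral>\<^sup>+x. ennreal ((norm (f x))\<^sup>2) \<partial>lborel) \<le> ennreal (C\<^sup>2)" "0 \<le> C"
  shows "norm (abs_L2_heis f) \<le> C"
  using assms by (auto simp: nn_norm_abs_L2_heis ennreal_le_iff intro: power2_le_imp_le)

text \<open>The bounded operators below are all given by a formula \<open>F\<close> on representatives; linearity of \<open>F\<close> need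
  hold only up to null sets.\<close>

lemma L2_operator:
  fixes F :: "L2_heis \<Rightarrow> heis \<Rightarrow> complex^2"
  assumes sq: "\<And>\<xi>. square_integrable (F \<xi>)"
    and add: "\<And>\<xi> \<eta>. AE x in lborel. F (\<xi> + \<eta>) x = F \<xi> x + F \<eta> x"
    and scale: "\<And>c \<xi>. AE x in lborel. F (c *\<^sub>C \<xi>) x = c *s F \<xi> x"
    and bound: "\<And>\<xi>. (\<integral>\<^sup>+x. ennreal ((norm (F \<xi> x))\<^sup>2) \<partial>lborel) \<le> ennreal ((C * norm \<xi>)\<^sup>2)"
    and C: "0 \<le> C"
  defines "T \<equiv> Blinfun (\<lambda>\<xi>. abs_L2_heis (F \<xi>))"
  shows "blinfun_apply T \<xi> = abs_L2_heis (F \<xi>)" "bop T" "norm T \<le> C"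
    "AE x in lborel. rep (blinfun_apply T \<xi>) x = F \<xi> x"
proof -
  have scaleC: "abs_L2_heis (F (c *\<^sub>C \<xi>)) = c *\<^sub>C abs_L2_heis (F \<xi>)" for c \<xi>
  proof -
    have "abs_L2_heis (F (c *\<^sub>C \<xi>)) = abs_L2_heis (\<lambda>x. c *s F \<xi> x)"
      by (intro abs_L2_heis_cong sq square_integrable_smult scale)
    then show ?thesis using scaleC_L2_heis.abs_eq[of "F \<xi>" c] sq by simp
  qed
  have b: "norm (abs_L2_heis (F \<xi>)) \<le> C * norm \<xi>" for \<xi>
    by (rule norm_abs_L2_heis_le[OF sq bound]) (use C in simp)
  have "bounded_linear (\<lambda>\<xi>. abs_L2_heis (F \<xi>))"
  proof (rule bounded_linear_intro[where K = C])
    fix \<xi> \<eta> r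
    have "abs_L2_heis (F (\<xi> + \<eta>)) = abs_L2_heis (\<lambda>x. F \<xi> x + F \<eta> x)"
      by (intro abs_L2_heis_cong sq square_integrable_add add)
    then show "abs_L2_heis (F (\<xi> + \<eta>)) = abs_L2_heis (F \<xi>) + abs_L2_heis (F \<eta>)"
      using plus_L2_heis.abs_eq[of "F \<xi>" "F \<eta>"] sq by simp
    show "abs_L2_heis (F (r *\<^sub>R \<xi>)) = r *\<^sub>R abs_L2_heis (F \<xi>)"
      by (simp add: scaleR_scaleC scaleC)
    show "norm (abs_L2_heis (F \<xi>)) \<le> norm \<xi> * C" using b[of \<xi>] by (simp add: mult.commute)
  qed
  then have T: "blinfun_apply T \<xi> = abs_L2_heis (F \<xi>)" for \<xi>
    unfolding T_def by (simp add: bounded_linear_Blinfun_apply)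
  show "blinfun_apply T \<xi> = abs_L2_heis (F \<xi>)" by (rule T)
  show "bop T" by (simp add: bop_def T scaleC)
  show "norm T \<le> C" by (rule norm_blinfun_bound[OF C]) (simp add: T b)
  show "AE x in lborel. rep (blinfun_apply T \<xi>) x = F \<xi> x"
    unfolding T by (rule rep_abs_L2_heis[OF sq])
qed

lemma norm_L2_heis_mono:
  assumes "AE x in lborel. norm (rep \<zeta> x) \<le> C * norm (rep \<xi> x)" "0 \<le> C"
  shows "norm \<zeta> \<le> C * norm \<xi>"
proof (rule power2_le_imp_le)
  have "(norm \<zeta>)\<^sup>2 \<le> (\<integral>x. C\<^sup>2 * (norm (rep \<xi> x))\<^sup>2 \<partial>lborel)"
    unfolding norm_L2_heis_eq
  proof (rule integral_mono_AE)
    show "AE x in lborel. (norm (rep \<zeta> x))\<^sup>2 \<le> C\<^sup>2 * (norm (rep \<xi> x))\<^sup>2"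
      using assms(1)
    proof eventually_elim
      case (elim x)
      then show ?case using power_mono[OF elim, of 2] by (simp add: power_mult_distrib)
    qed
  qed (use square_integrable_rep in \<open>simp_all add: square_integrable_def\<close>)
  then show "(norm \<zeta>)\<^sup>2 \<le> (C * norm \<xi>)\<^sup>2" by (simp add: norm_L2_heis_eq power_mult_distrib)
qed (use assms(2) in simp)

lemma rep_L2_heis_sum:
  "finite I \<Longrightarrow> AE x in lborel. rep (\<Sum>i\<in>I. h i) x = (\<Sum>i\<in>I. rep (h i) x)"
proof (induction I rule: finite_induct)
  case empty
  then show ?case using rep_L2_heis_zero by simp
next
  case (insert i I)
  then show ?case using rep_L2_heis_add[of "h i" "\<Sum>i\<in>I. h i"] by (auto elim: AE_mp)
qed

lemma tendsto_L2_heisI: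
  fixes X :: "nat \<Rightarrow> L2_heis"
  assumes lim: "AE x in lborel. (\<lambda>n. rep (X n) x) \<longlonglongrightarrow> rep \<xi> x"
    and bound: "\<And>n. AE x in lborel. norm (rep (X n) x - rep \<xi> x) \<le> h x"
    and h: "integrable lborel (\<lambda>x. (h x)\<^sup>2)"
  shows "X \<longlonglongrightarrow> \<xi>"
proof -
  have "(\<lambda>n. \<integral>x. (norm (rep (X n) x - rep \<xi> x))\<^sup>2 \<partial>lborel) \<longlonglongrightarrow> (\<integral>x. 0 \<partial>(lborel :: heis measure))"
  proof (rule integral_dominated_convergence[where w = "\<lambda>x. (h x)\<^sup>2"])
    show "AE x in lborel. (\<lambda>n. (norm (rep (X n) x - rep \<xi> x))\<^sup>2) \<longlonglongrightarrow> 0"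
      using lim
    proof eventually_elim
      case (elim x)
      from tendsto_power[OF tendsto_norm[OF LIM_zero[OF elim]], of 2] show ?case by simp
    qed
    show "AE x in lborel. norm ((norm (rep (X n) x - rep \<xi> x))\<^sup>2) \<le> (h x)\<^sup>2" for n
      using bound[of n] by eventually_elim (simp add: power_mono)
  qed (use h in simp_all)
  moreover have "(\<integral>x. (norm (rep (X n) x - rep \<xi> x))\<^sup>2 \<partial>lborel) = (norm (X n - \<xi>))\<^sup>2" for n
    unfolding norm_L2_heis_eq using rep_L2_heis_diff[of "X n" \<xi>]
    by (intro Bochner_Integration.integral_cong_AE) (auto elim: AE_mp)
  ultimately have "(\<lambda>n. (norm (X n - \<xi>))\<^sup>2) \<longlonglongrightarrow> 0" by simp
  from tendsto_real_sqrt[OF this] have "(\<lambda>n. norm (X n - \<xi>)) \<longlonglongrightarrow> 0" by simp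
  then show ?thesis by (rule LIM_zero_cancel[OF tendsto_norm_zero_cancel])
qed

section \<open>Multiplication operators\<close>

lemma matrix_vector_measurable [measurable]:
  fixes m :: "'a \<Rightarrow> complex^2^2"
  assumes [measurable]: "m \<in> borel_measurable M" "f \<in> borel_measurable M"
  shows "(\<lambda>x. m x *v f x) \<in> borel_measurable M"
proof -
  have "continuous_on UNIV (\<lambda>p :: (complex^2^2) \<times> (complex^2). fst p *v snd p)"
    unfolding matrix_vector_mult_def by (intro continuous_intros)
  then have "(\<lambda>p :: (complex^2^2) \<times> (complex^2). fst p *v snd p) \<in> borel_measurable borel"
    by (rule borel_measurable_continuous_onI)
  from measurable_compose[OF borel_measurable_Pair[OF assms] this] show ?thesis by simp
qed

lemma matrix_vector_scaleR:
  fixes A :: "complex^2^2"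
  shows "(r *\<^sub>R A) *v v = r *\<^sub>R (A *v v)" "A *v (r *\<^sub>R v) = r *\<^sub>R (A *v v)"
  by (simp_all add: vec_eq_iff matrix_vector_mult_def sum_2 algebra_simps)

lemma matrix_vector_smult: "A *v (c *s v) = c *s (A *v v)" for A :: "complex^2^2"
  by (simp add: vec_eq_iff matrix_vector_mult_def sum_2 algebra_simps)

lemma c2_inner_conj_transpose: "c2_inner (A *v v) w = c2_inner v (conj_transpose A *v w)"
  by (simp add: c2_inner_def matrix_vector_mult_def conj_transpose_def sum_2 algebra_simps)

text \<open>The constant \<open>C\<close> bounds the operator norms of the matrices, in a form in which the Clifford relations
  provide it.\<close>

definition bounded_field :: "real \<Rightarrow> (heis \<Rightarrow> complex^2^2) \<Rightarrow> bool" where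
  "bounded_field C m \<longleftrightarrow> m \<in> borel_measurable borel \<and> 0 \<le> C \<and> (\<forall>x v. norm (m x *v v) \<le> C * norm v)"

definition bmult :: "(heis \<Rightarrow> complex^2^2) \<Rightarrow> (L2_heis \<Rightarrow>\<^sub>L L2_heis)" where
  "bmult m = Blinfun (\<lambda>\<xi>. abs_L2_heis (\<lambda>x. m x *v rep \<xi> x))"

lemma
  assumes m: "bounded_field C m"
  shows rep_bmult: "AE x in lborel. rep (bmult m \<xi>) x = m x *v rep \<xi> x"
    and norm_bmult: "norm (bmult m) \<le> C"
proof -
  have [measurable]: "m \<in> borel_measurable borel" and C: "0 \<le> C"
    and le: "\<And>x v. norm (m x *v v) \<le> C * norm v"
    using m by (auto simp: bounded_field_def)
  have bound: "(\<integral>\<^sup>+x. ennreal ((norm (m x *v rep \<xi> x))\<^sup>2) \<partial>lborel) \<le> ennreal ((C * norm \<xi>)\<^sup>2)" for \<xi>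
  proof -
    have "(\<integral>\<^sup>+x. ennreal ((norm (m x *v rep \<xi> x))\<^sup>2) \<partial>lborel)
        \<le> (\<integral>\<^sup>+x. ennreal (C\<^sup>2) * ennreal ((norm (rep \<xi> x))\<^sup>2) \<partial>lborel)"
      using power_mono[OF le, of _ _ 2]
      by (intro nn_integral_mono) (simp add: power_mult_distrib flip: ennreal_mult)
    also have "\<dots> = ennreal ((C * norm \<xi>)\<^sup>2)"
      by (subst nn_integral_cmult) (simp_all add: nn_norm_L2_heis power_mult_distrib flip: ennreal_mult)
    finally show ?thesis .
  qed
  have sq: "square_integrable (\<lambda>x. m x *v rep \<xi> x)" for \<xi>
    by (rule square_integrable_nn_bound[OF _ bound]) simp
  have add: "AE x in lborel. m x *v rep (\<xi> + \<eta>) x = m x *v rep \<xi> x + m x *v rep \<eta> x" for \<xi> \<eta>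
    using rep_L2_heis_add[of \<xi> \<eta>] by eventually_elim (simp add: matrix_vector_right_distrib)
  have scale: "AE x in lborel. m x *v rep (c *\<^sub>C \<xi>) x = c *s (m x *v rep \<xi> x)" for c \<xi>
    using rep_L2_heis_scaleC[of c \<xi>] by eventually_elim (simp add: matrix_vector_smult)
  note * = L2_operator[OF sq add scale bound C, folded bmult_def]
  show "AE x in lborel. rep (bmult m \<xi>) x = m x *v rep \<xi> x" "norm (bmult m) \<le> C"
    by (rule * )+
qed

text \<open>The maximal domain of a bounded multiplication operator is the whole space; this transfers facts
  about \<^const>\<open>mult_op\<close> to bounded operators.\<close>

lemma gr_bmult:
  assumes m: "bounded_field C m"
  shows "gr (bmult m) = mult_op m"
proof -
  have "(\<xi>, \<eta>) \<in> mult_op m \<longleftrightarrow> \<eta> = bmult m \<xi>" for \<xi> \<eta>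
  proof
    assume "(\<xi>, \<eta>) \<in> mult_op m"
    then have "AE x in lborel. rep \<eta> x = m x *v rep \<xi> x" by (simp add: mult_op_def)
    then have "AE x in lborel. rep \<eta> x = rep (bmult m \<xi>) x"
      using rep_bmult[OF m, of \<xi>] by eventually_elim simp
    then show "\<eta> = bmult m \<xi>" by (rule L2_heis_eqI)
  qed (use rep_bmult[OF m, of \<xi>] in \<open>simp add: mult_op_def\<close>)
  then show ?thesis by (auto simp: gr_def)
qed

lemma mult_op_unique:
  assumes "(\<xi>, \<eta>) \<in> mult_op m" "(\<xi>, \<eta>') \<in> mult_op m" shows "\<eta> = \<eta>'"
proof (rule L2_heis_eqI)
  show "AE x in lborel. rep \<eta> x = rep \<eta>' x"
    using assms unfolding mult_op_def mem_Collect_eq case_prod_conv by eventually_elim simp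
qed

lemma bounded_field_scaleR:
  assumes "r \<in> borel_measurable borel" "\<And>x. \<bar>r x\<bar> \<le> C"
  shows "bounded_field C (\<lambda>x. r x *\<^sub>R mat 1)"
proof -
  have "0 \<le> C" using assms(2)[of undefined] by linarith
  moreover have "(\<lambda>x. r x *\<^sub>R (mat 1 :: complex^2^2)) \<in> borel_measurable borel"
    using assms(1) by (intro borel_measurable_scaleR) simp_all
  ultimately show ?thesis using assms(2) by (simp add: bounded_field_def matrix_vector_scaleR mult_right_mono)
qed

lemma cinner_mult_op:
  assumes "(\<xi>, \<xi>') \<in> mult_op m" "(\<eta>, \<eta>') \<in> mult_op (\<lambda>x. conj_transpose (m x))"
  shows "cinner \<xi>' \<eta> = cinner \<xi> \<eta>'"
proof -
  have "AE x in lborel. c2_inner (rep \<xi>' x) (rep \<eta> x) = c2_inner (rep \<xi> x) (rep \<eta>' x)"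
    using assms unfolding mult_op_def mem_Collect_eq case_prod_conv
    by eventually_elim (simp add: c2_inner_conj_transpose)
  then show ?thesis unfolding cinner_L2_heis_eq by (intro Bochner_Integration.integral_cong_AE) simp_all
qed

section \<open>Functional calculus of multiplication operators\<close>

abbreviation scalar_field :: "(heis \<Rightarrow> real) \<Rightarrow> heis \<Rightarrow> complex^2^2" where
  "scalar_field r \<equiv> \<lambda>x. r x *\<^sub>R mat 1"

text \<open>The functional calculus approximates by polynomials on \<open>[0, \<parallel>T\<parallel>]\<close> only, so the essential range of \<open>g\<close>
  has to lie there: testing the multiplication operator on the indicator of a bounded part of
  \<open>{g > \<parallel>T\<parallel>}\<close> shows that this set is null.\<close>

lemma AE_le_norm_bmult:
  assumes [measurable]: "g \<in> borel_measurable borel" and g: "\<And>x. 0 \<le> g x" "\<And>x. g x \<le> C"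
  shows "AE x in lborel. g x \<le> norm (bmult (scalar_field g))"
proof -
  define T where "T = bmult (scalar_field g)"
  have bf: "bounded_field C (scalar_field g)"
    by (rule bounded_field_scaleR) (use g in \<open>simp_all add: abs_le_iff order_trans[of "- _" 0]\<close>)
  define e :: "complex^2" where "e = axis 1 1"
  have e: "norm e = 1" by (simp add: e_def norm_vec_def L2_set_def sum_2 axis_def)
  have null: "AE x in lborel. g x \<le> norm T \<or> x \<notin> cball 0 (real n)" for n
  proof -
    define A where "A = {x. norm T < g x} \<inter> cball (0 :: heis) (real n)"
    have [measurable]: "A \<in> sets borel" unfolding A_def by measurable
    have "emeasure lborel A \<le> emeasure lborel (cball (0 :: heis) (real n))"
      by (rule emeasure_mono) (auto simp: A_def)
    then have fin: "emeasure lborel A < \<infinity>"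
      using emeasure_lborel_cball_finite[of "0 :: heis" "real n"] by (simp add: top.not_eq_extremum order.strict_trans1)
    have intA: "integrable lborel (\<lambda>x. k x * indicator A x)" if "k \<in> borel_measurable borel" "\<And>x. \<bar>k x\<bar> \<le> B" for k :: "heis \<Rightarrow> real" and B
    proof (rule Bochner_Integration.integrable_bound)
      show "integrable lborel (\<lambda>x. B * indicator A x)" using fin by simp
      show "AE x in lborel. norm (k x * indicator A x) \<le> norm (B * indicator A x)"
      proof (rule AE_I2)
        fix x have "\<bar>k x\<bar> \<le> \<bar>B\<bar>" using that(2)[of x] by linarith
        then show "norm (k x * indicator A x) \<le> norm (B * indicator A x)" by (simp split: split_indicator)
      qed
    qed (use that(1) in simp)
    define \<omega> where "\<omega> = abs_L2_heis (\<lambda>x. indicator A x *\<^sub>R e)"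
    have ind2: "indicat_real A x * indicat_real A x = indicat_real A x" for x by (simp split: split_indicator)
    have sq: "square_integrable (\<lambda>x. indicator A x *\<^sub>R e)"
      using intA[of "\<lambda>_. 1" 1] by (simp add: square_integrable_def e ind2 power2_eq_square)
    have rep: "AE x in lborel. rep \<omega> x = indicator A x *\<^sub>R e"
      unfolding \<omega>_def by (rule rep_abs_L2_heis[OF sq])
    have nn: "0 \<le> ((g x)\<^sup>2 - (norm T)\<^sup>2) * indicator A x" for x
      by (auto simp: A_def split: split_indicator intro!: power_mono)
    have "(norm (T \<omega>))\<^sup>2 \<le> (norm T * norm \<omega>)\<^sup>2" by (intro power_mono norm_blinfun) simp
    also have "\<dots> = (\<integral>x. (norm T)\<^sup>2 * indicator A x \<partial>lborel)"
      unfolding power_mult_distrib \<omega>_def norm_abs_L2_heis[OF sq]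
      by (simp add: e ind2 power2_eq_square)
    finally have "(norm (T \<omega>))\<^sup>2 \<le> (\<integral>x. (norm T)\<^sup>2 * indicator A x \<partial>lborel)" .
    moreover have "(norm (T \<omega>))\<^sup>2 = (\<integral>x. (g x)\<^sup>2 * indicator A x \<partial>lborel)"
      unfolding norm_L2_heis_eq
    proof (rule Bochner_Integration.integral_cong_AE)
      show "AE x in lborel. (norm (rep (T \<omega>) x))\<^sup>2 = (g x)\<^sup>2 * indicator A x"
        using rep rep_bmult[OF bf, of \<omega>, folded T_def]
        by eventually_elim (simp add: matrix_vector_scaleR e g power_mult_distrib split: split_indicator)
    qed simp_all
    moreover have g2: "\<bar>(g x)\<^sup>2\<bar> \<le> C\<^sup>2" for x using power_mono[OF g(2) g(1), of x 2] by simp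
    moreover have "(\<integral>x. ((g x)\<^sup>2 - (norm T)\<^sup>2) * indicator A x \<partial>lborel)
       = (\<integral>x. (g x)\<^sup>2 * indicator A x \<partial>lborel) - (\<integral>x. (norm T)\<^sup>2 * indicator A x \<partial>lborel)"
      unfolding left_diff_distrib
      by (intro Bochner_Integration.integral_diff intA[of _ "C\<^sup>2"] intA[of _ "(norm T)\<^sup>2"] g2) simp_all
    ultimately have "(\<integral>x. ((g x)\<^sup>2 - (norm T)\<^sup>2) * indicator A x \<partial>lborel) = 0"
      using Bochner_Integration.integral_nonneg[of lborel "\<lambda>x. ((g x)\<^sup>2 - (norm T)\<^sup>2) * indicator A x", OF nn] by linarith
    moreover have "integrable lborel (\<lambda>x. ((g x)\<^sup>2 - (norm T)\<^sup>2) * indicator A x)"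
      unfolding left_diff_distrib
      by (intro Bochner_Integration.integrable_diff intA[of _ "C\<^sup>2"] intA[of _ "(norm T)\<^sup>2"] g2) simp_all
    ultimately have "AE x in lborel. ((g x)\<^sup>2 - (norm T)\<^sup>2) * indicator A x = 0"
      using integral_nonneg_eq_0_iff_AE[of lborel "\<lambda>x. ((g x)\<^sup>2 - (norm T)\<^sup>2) * indicator A x"] nn by simp
    then show ?thesis
    proof eventually_elim
      case (elim x)
      have "x \<notin> A"
      proof
        assume "x \<in> A"
        then have "(norm T)\<^sup>2 < (g x)\<^sup>2" by (intro power_strict_mono) (auto simp: A_def)
        with elim \<open>x \<in> A\<close> show False by simp
      qed
      then show ?case by (auto simp: A_def)
    qed
  qed
  have "AE x in lborel. \<forall>n. g x \<le> norm T \<or> x \<notin> cball 0 (real n)"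
    unfolding AE_all_countable using null by blast
  then show ?thesis
  proof eventually_elim
    case (elim x)
    obtain n where "norm x \<le> real n" using real_arch_simple by blast
    then have "x \<in> cball 0 (real n)" by simp
    with elim show ?case by (auto simp: T_def)
  qed
qed

lemma rep_op_poly_bmult:
  assumes bf: "bounded_field C (scalar_field g)"
  shows "AE x in lborel. rep (op_poly p (bmult (scalar_field g)) \<xi>) x = poly p (g x) *\<^sub>R rep \<xi> x"
proof -
  define T where "T = bmult (scalar_field g)"
  have pow: "AE x in lborel. rep ((((\<lambda>S. T o\<^sub>L S) ^^ i) id_blinfun) \<xi>) x = g x ^ i *\<^sub>R rep \<xi> x" for i
  proof (induction i)
    case (Suc i)
    show ?case
      using Suc rep_bmult[OF bf, of "(((\<lambda>S. T o\<^sub>L S) ^^ i) id_blinfun) \<xi>", folded T_def]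
      by eventually_elim (simp add: matrix_vector_scaleR)
  qed simp
  have term': "AE x in lborel. rep (coeff p i *\<^sub>R (((\<lambda>S. T o\<^sub>L S) ^^ i) id_blinfun) \<xi>) x
      = (coeff p i * g x ^ i) *\<^sub>R rep \<xi> x" for i
    using pow[of i] rep_L2_heis_scaleR[of "coeff p i" "(((\<lambda>S. T o\<^sub>L S) ^^ i) id_blinfun) \<xi>"]
    by eventually_elim simp
  then have "AE x in lborel. \<forall>i. rep (coeff p i *\<^sub>R (((\<lambda>S. T o\<^sub>L S) ^^ i) id_blinfun) \<xi>) x
      = (coeff p i * g x ^ i) *\<^sub>R rep \<xi> x" by (simp add: AE_all_countable)
  moreover have "op_poly p T \<xi> = (\<Sum>i\<le>degree p. coeff p i *\<^sub>R (((\<lambda>S. T o\<^sub>L S) ^^ i) id_blinfun) \<xi>)"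
    unfolding op_poly_def by (simp add: blinfun.sum_left blinfun.scaleR_left)
  ultimately show ?thesis
    using rep_L2_heis_sum[of "{..degree p}" "\<lambda>i. coeff p i *\<^sub>R (((\<lambda>S. T o\<^sub>L S) ^^ i) id_blinfun) \<xi>"]
    unfolding T_def[symmetric] by (auto simp: poly_altdef scaleR_sum_left elim!: AE_mp)
qed

lemma poly_approx:
  fixes f :: "real \<Rightarrow> real"
  assumes "continuous_on {0..b} f" "0 < \<delta>"
  obtains p where "\<And>x. x \<in> {0..b} \<Longrightarrow> \<bar>poly p x - f x\<bar> \<le> \<delta>"
proof -
  obtain q where q: "real_polynomial_function q" "\<And>x. x \<in> {0..b} \<Longrightarrow> \<bar>f x - q x\<bar> < \<delta>"
    using Stone_Weierstrass_real_polynomial_function[OF compact_Icc assms] by metis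
  obtain a n where an: "q = (\<lambda>x. \<Sum>i\<le>n. a i * x ^ i)"
    using q(1) unfolding real_polynomial_function_iff_sum by auto
  have "poly (\<Sum>i\<le>n. monom (a i) i) x = q x" for x
    by (simp add: an poly_sum poly_monom)
  then show thesis using q(2) that[of "\<Sum>i\<le>n. monom (a i) i"] by (fastforce simp: abs_minus_commute)
qed

text \<open>Polynomials of a multiplication operator multiply by the polynomials of the function, so the norm limit
  exists and is multiplication by \<open>f \<circ> g\<close>. It is the only one by the theorem of Weierstrass: without an
  approximating polynomial for each accuracy the defining condition would be vacuous.\<close>

lemma pos_calculus_bmult:
  assumes g [measurable]: "g \<in> borel_measurable borel" and g0: "\<And>x. 0 \<le> g x" and gC: "\<And>x. g x \<le> C"
    and f: "continuous_on {0..norm (bmult (scalar_field g))} f"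
    and fg: "(\<lambda>x. f (g x)) \<in> borel_measurable borel" "\<And>x. \<bar>f (g x)\<bar> \<le> B"
  shows "pos_calculus f (bmult (scalar_field g)) = bmult (scalar_field (\<lambda>x. f (g x)))"
proof -
  define T where "T = bmult (scalar_field g)"
  define S where "S = bmult (scalar_field (\<lambda>x. f (g x)))"
  have bf: "bounded_field C (scalar_field g)"
    by (rule bounded_field_scaleR) (use g0 gC in \<open>simp_all add: abs_le_iff order_trans[of "- _" 0]\<close>)
  have bfS: "bounded_field B (scalar_field (\<lambda>x. f (g x)))" by (rule bounded_field_scaleR[OF fg])
  have approx: "norm (op_poly p T - S) \<le> \<delta>"
    if \<delta>: "0 < \<delta>" and p: "\<forall>x\<in>{0..norm T}. \<bar>poly p x - f x\<bar> \<le> \<delta>" for p \<delta>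
  proof (rule norm_blinfun_bound)
    fix \<xi>
    have "AE x in lborel. norm (rep ((op_poly p T - S) \<xi>) x) \<le> \<delta> * norm (rep \<xi> x)"
      unfolding blinfun.diff_left
      using AE_le_norm_bmult[OF g g0 gC, folded T_def] rep_op_poly_bmult[OF bf, of p \<xi>, folded T_def]
        rep_bmult[OF bfS, of \<xi>, folded S_def] rep_L2_heis_diff[of "op_poly p T \<xi>" "S \<xi>"]
    proof eventually_elim
      case (elim x)
      have "\<bar>poly p (g x) - f (g x)\<bar> \<le> \<delta>" using p g0[of x] elim(1) by simp
      moreover have "rep (op_poly p T \<xi> - S \<xi>) x = (poly p (g x) - f (g x)) *\<^sub>R rep \<xi> x"
        using elim by (simp add: matrix_vector_scaleR scaleR_diff_left)
      ultimately show ?case by (simp add: mult_right_mono)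
    qed
    then show "norm ((op_poly p T - S) \<xi>) \<le> \<delta> * norm \<xi>"
      by (rule norm_L2_heis_mono) (use \<delta> in simp)
  qed (use \<delta> in simp)
  have "pos_calculus f T = S"
    unfolding pos_calculus_def
  proof (rule the_equality)
    show "\<forall>\<epsilon>>0. \<exists>\<delta>>0. \<forall>p. (\<forall>x\<in>{0..norm T}. \<bar>poly p x - f x\<bar> \<le> \<delta>) \<longrightarrow> norm (op_poly p T - S) \<le> \<epsilon>"
      using approx by blast
    fix S' assume S': "\<forall>\<epsilon>>0. \<exists>\<delta>>0. \<forall>p. (\<forall>x\<in>{0..norm T}. \<bar>poly p x - f x\<bar> \<le> \<delta>) \<longrightarrow> norm (op_poly p T - S') \<le> \<epsilon>"
    have "norm (S' - S) \<le> \<epsilon>" if \<epsilon>: "0 < \<epsilon>" for \<epsilon>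
    proof -
      from S' \<epsilon> obtain \<delta> where \<delta>: "0 < \<delta>"
        "\<And>p. (\<forall>x\<in>{0..norm T}. \<bar>poly p x - f x\<bar> \<le> \<delta>) \<Longrightarrow> norm (op_poly p T - S') \<le> \<epsilon> / 2"
        by (meson half_gt_zero)
      obtain p where p: "\<And>x. x \<in> {0..norm T} \<Longrightarrow> \<bar>poly p x - f x\<bar> \<le> min \<delta> (\<epsilon> / 2)"
        using poly_approx[OF f[folded T_def], of "min \<delta> (\<epsilon> / 2)"] \<delta>(1) \<epsilon> by auto
      have "norm (op_poly p T - S') \<le> \<epsilon> / 2" by (rule \<delta>(2)) (use p in simp)
      moreover have "norm (op_poly p T - S) \<le> \<epsilon> / 2" by (rule approx) (use p \<epsilon> in simp_all)
      ultimately have "norm ((op_poly p T - S) - (op_poly p T - S')) \<le> \<epsilon> / 2 + \<epsilon> / 2"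
        by (meson add_mono norm_triangle_ineq4 order_trans)
      then show ?thesis by simp
    qed
    then have "norm (S' - S) \<le> 0" by (rule field_le_epsilon[of _ 0, simplified])
    then show "S' = S" by simp
  qed
  then show ?thesis by (simp add: T_def S_def)
qed

section \<open>The operator of multiplication by ell\<close>

lemma c2_inner_scaleR: "c2_inner v (r *\<^sub>R w) = complex_of_real r * c2_inner v w"
  unfolding scaleR_smult by (simp add: c2_inner_def sum_2 algebra_simps)

locale clifford =
  fixes \<gamma>1 \<gamma>2 \<gamma>3 :: "complex^2^2"
  assumes generators: "clifford_generators \<gamma>1 \<gamma>2 \<gamma>3"
begin

definition cliff :: "real \<Rightarrow> real \<Rightarrow> real \<Rightarrow> complex^2^2" where
  "cliff p q s = p *\<^sub>R \<gamma>1 + q *\<^sub>R \<gamma>2 + s *\<^sub>R \<gamma>3"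

lemma conj_transpose_cliff: "conj_transpose (cliff p q s) = cliff p q s"
proof -
  have "conj_transpose \<gamma>1 = \<gamma>1" "conj_transpose \<gamma>2 = \<gamma>2" "conj_transpose \<gamma>3 = \<gamma>3"
    using generators by (auto simp: clifford_generators_def)
  moreover have "conj_transpose (cliff p q s)
      = p *\<^sub>R conj_transpose \<gamma>1 + q *\<^sub>R conj_transpose \<gamma>2 + s *\<^sub>R conj_transpose \<gamma>3"
    by (simp add: cliff_def conj_transpose_def vec_eq_iff)
  ultimately show ?thesis by (simp add: cliff_def)
qed

text \<open>The mixed terms cancel by anticommutation.\<close>

lemma cliff_square: "cliff p q s *v (cliff p q s *v v) = (p\<^sup>2 + q\<^sup>2 + s\<^sup>2) *\<^sub>R v"
proof -
  have sq: "\<gamma>1 *v (\<gamma>1 *v v) = v" "\<gamma>2 *v (\<gamma>2 *v v) = v" "\<gamma>3 *v (\<gamma>3 *v v) = v"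
    using generators unfolding clifford_generators_def by (auto simp: matrix_vector_mul_assoc)
  have "\<gamma>1 ** \<gamma>2 + \<gamma>2 ** \<gamma>1 = 0" "\<gamma>1 ** \<gamma>3 + \<gamma>3 ** \<gamma>1 = 0" "\<gamma>2 ** \<gamma>3 + \<gamma>3 ** \<gamma>2 = 0"
    using generators unfolding clifford_generators_def by auto
  then have anti: "\<gamma>1 *v (\<gamma>2 *v v) + \<gamma>2 *v (\<gamma>1 *v v) = 0" "\<gamma>1 *v (\<gamma>3 *v v) + \<gamma>3 *v (\<gamma>1 *v v) = 0"
    "\<gamma>2 *v (\<gamma>3 *v v) + \<gamma>3 *v (\<gamma>2 *v v) = 0"
    by (simp_all add: matrix_vector_mul_assoc flip: matrix_vector_mult_add_rdistrib)
  have "cliff p q s *v (cliff p q s *v v)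
      = p\<^sup>2 *\<^sub>R (\<gamma>1 *v (\<gamma>1 *v v)) + q\<^sup>2 *\<^sub>R (\<gamma>2 *v (\<gamma>2 *v v)) + s\<^sup>2 *\<^sub>R (\<gamma>3 *v (\<gamma>3 *v v))
      + (p * q) *\<^sub>R (\<gamma>1 *v (\<gamma>2 *v v) + \<gamma>2 *v (\<gamma>1 *v v)) + (p * s) *\<^sub>R (\<gamma>1 *v (\<gamma>3 *v v) + \<gamma>3 *v (\<gamma>1 *v v))
      + (q * s) *\<^sub>R (\<gamma>2 *v (\<gamma>3 *v v) + \<gamma>3 *v (\<gamma>2 *v v))"
    by (simp add: cliff_def matrix_vector_mult_add_rdistrib matrix_vector_right_distrib matrix_vector_scaleR
        algebra_simps power2_eq_square)
  then show ?thesis by (simp add: sq anti scaleR_add_left)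
qed

lemma norm_cliff: "norm (cliff p q s *v v) = sqrt (p\<^sup>2 + q\<^sup>2 + s\<^sup>2) * norm v"
proof -
  have "complex_of_real ((norm (cliff p q s *v v))\<^sup>2) = c2_inner v ((p\<^sup>2 + q\<^sup>2 + s\<^sup>2) *\<^sub>R v)"
    unfolding cdot_self[symmetric] by (simp add: c2_inner_conj_transpose conj_transpose_cliff cliff_square)
  also have "\<dots> = complex_of_real (p\<^sup>2 + q\<^sup>2 + s\<^sup>2) * c2_inner v v"
    by (rule c2_inner_scaleR)
  also have "\<dots> = complex_of_real ((sqrt (p\<^sup>2 + q\<^sup>2 + s\<^sup>2) * norm v)\<^sup>2)"
    unfolding cdot_self by (simp add: power_mult_distrib)
  finally have "(norm (cliff p q s *v v))\<^sup>2 = (sqrt (p\<^sup>2 + q\<^sup>2 + s\<^sup>2) * norm v)\<^sup>2"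
    by (simp only: of_real_eq_iff)
  then show ?thesis by (rule power2_eq_imp_eq) simp_all
qed

end

text \<open>The fourth power of the Koranyi norm, which is homogeneous of degree 4 under the dilations.\<close>

definition koranyi4 :: "heis \<Rightarrow> real" where
  "koranyi4 = (\<lambda>(a, b, c). (a\<^sup>2 + b\<^sup>2)\<^sup>2 + c\<^sup>2)"

text \<open>The function by which \<open>(1 + D\<^sup>2)\<^sup>-\<^sup>1\<close> multiplies.\<close>

definition weight :: "heis \<Rightarrow> real" where
  "weight x = 1 / (1 + koranyi4 x)"

lemma koranyi4_nonneg: "0 \<le> koranyi4 x"
  by (cases x) (simp add: koranyi4_def)

lemma continuous_koranyi4: "continuous_on S koranyi4"
  unfolding koranyi4_def case_prod_beta by (intro continuous_intros)

lemma koranyi4_measurable [measurable]: "koranyi4 \<in> borel_measurable borel"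
  by (intro borel_measurable_continuous_onI continuous_koranyi4)

lemma weight_measurable [measurable]: "weight \<in> borel_measurable borel"
  unfolding weight_def[abs_def] by measurable

lemma weight_pos: "0 < weight x" and weight_le_1: "weight x \<le> 1"
  using koranyi4_nonneg[of x] by (simp_all add: weight_def add_pos_nonneg)

lemma weight_times: "weight x * (1 + koranyi4 x) = 1"
  using koranyi4_nonneg[of x] by (simp add: weight_def)

lemma continuous_weight: "continuous_on S weight"
  unfolding weight_def[abs_def]
proof (intro continuous_intros continuous_koranyi4 ballI)
  fix x show "1 + koranyi4 x \<noteq> 0" using koranyi4_nonneg[of x] by linarith
qed

lemma bounded_field_weight: "bounded_field 1 (scalar_field weight)"
  by (rule bounded_field_scaleR) (simp_all add: weight_le_1 weight_pos less_imp_le)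

text \<open>The function by which \<open>\<langle>D\<rangle>\<^bsup>-1/2\<^esup>\<close> multiplies: \<open>\<langle>D\<rangle>\<^sup>-\<^sup>2\<close> is raised to the power \<open>1/4\<close>.\<close>

definition root_weight :: "heis \<Rightarrow> real" where
  "root_weight x = weight x powr (1 / 4)"

lemma root_weight_measurable [measurable]: "root_weight \<in> borel_measurable borel"
  unfolding root_weight_def[abs_def] by measurable

lemma root_weight_pos: "0 < root_weight x" and root_weight_le_1: "root_weight x \<le> 1"
  using weight_pos[of x] weight_le_1[of x] by (simp_all add: root_weight_def powr_le1)

lemma bounded_field_root_weight: "bounded_field 1 (scalar_field root_weight)"
  by (rule bounded_field_scaleR) (simp_all add: root_weight_le_1 root_weight_pos less_imp_le)

context clifford
begin

abbreviation "L \<equiv> ell \<gamma>1 \<gamma>2 \<gamma>3"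

abbreviation "D \<equiv> mult_op L"

lemma ell_cliff: "L (a, b, c) = cliff (sqrt (a\<^sup>2 + b\<^sup>2) * a) (sqrt (a\<^sup>2 + b\<^sup>2) * b) c"
  by (simp add: ell_def cliff_def scaleR_add_right)

lemma continuous_ell: "continuous_on S L"
  unfolding ell_def case_prod_beta by (intro continuous_intros)

lemma ell_measurable [measurable]: "L \<in> borel_measurable borel"
  by (intro borel_measurable_continuous_onI continuous_ell)

lemma conj_transpose_ell: "conj_transpose (L x) = L x"
  by (cases x) (simp add: ell_cliff conj_transpose_cliff)

lemma ell_square: "L x *v (L x *v v) = koranyi4 x *\<^sub>R v"
  by (cases x) (simp add: ell_cliff cliff_square koranyi4_def power_mult_distrib power2_eq_square[of "_ + _"] algebra_simps)

lemma norm_ell: "norm (L x *v v) = sqrt (koranyi4 x) * norm v"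
  by (cases x) (simp add: ell_cliff norm_cliff koranyi4_def power_mult_distrib power2_eq_square[of "_ + _"] algebra_simps)

lemma bounded_field_truncated_ell:
  assumes [measurable]: "r \<in> borel_measurable borel" and r: "\<And>x. \<bar>r x\<bar> * sqrt (koranyi4 x) \<le> C"
  shows "bounded_field C (\<lambda>x. r x *\<^sub>R L x)"
proof -
  have "norm ((r x *\<^sub>R L x) *v v) \<le> C * norm v" for x v
    using mult_right_mono[OF r, of "norm v" x] by (simp add: matrix_vector_scaleR norm_ell mult.assoc)
  moreover have "0 \<le> C" using order_trans[OF mult_nonneg_nonneg r[of 0]] koranyi4_nonneg[of 0] by simp
  ultimately show ?thesis by (simp add: bounded_field_def)
qed

lemma weight_ell_bound: "\<bar>weight x\<bar> * sqrt (koranyi4 x) \<le> 1"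
proof -
  have "sqrt (koranyi4 x) \<le> 1 + koranyi4 x"
    using koranyi4_nonneg[of x] by (intro real_le_lsqrt) (simp_all add: power2_eq_square algebra_simps)
  then show ?thesis using koranyi4_nonneg[of x] by (simp add: weight_def divide_simps)
qed

lemma bounded_field_weight_ell: "bounded_field 1 (\<lambda>x. weight x *\<^sub>R L x)"
  by (rule bounded_field_truncated_ell[OF weight_measurable weight_ell_bound])

text \<open>The bounded operator \<open>D (1 + D\<^sup>2)\<^sup>-\<^sup>1\<close> multiplies by \<open>\<ell> / (1 + N\<^sup>4)\<close>. Vectors in the range of
  \<open>(1 + D\<^sup>2)\<^sup>-\<^sup>1\<close> serve as test vectors for the adjoint of \<open>D\<close>.\<close>

lemma weight_in_domain: "(bmult (scalar_field weight) \<xi>, bmult (\<lambda>x. weight x *\<^sub>R L x) \<xi>) \<in> D"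
  unfolding mult_op_def mem_Collect_eq case_prod_conv
  using rep_bmult[OF bounded_field_weight, of \<xi>] rep_bmult[OF bounded_field_weight_ell, of \<xi>]
  by eventually_elim (simp add: matrix_vector_scaleR)

lemma inv_one_plus_sq_D: "inv_one_plus_sq D = bmult (scalar_field weight)"
proof -
  let ?R = "bmult (scalar_field weight)"
  have gr_eq: "gr ?R = {(x + z, x) |x y z. (x, y) \<in> D \<and> (y, z) \<in> D}" (is "_ = ?G")
  proof (intro subset_antisym subsetI)
    fix p assume "p \<in> gr ?R"
    then obtain \<zeta> where p: "p = (\<zeta>, ?R \<zeta>)" by (auto simp: gr_def)
    let ?y = "bmult (\<lambda>x. weight x *\<^sub>R L x) \<zeta>"
    \<comment> \<open>\<open>z = D\<^sup>2 (1 + D\<^sup>2)\<^sup>-\<^sup>1 \<zeta> = \<zeta> - (1 + D\<^sup>2)\<^sup>-\<^sup>1 \<zeta>\<close>\<close>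
    have "(?y, \<zeta> - ?R \<zeta>) \<in> D"
      unfolding mult_op_def mem_Collect_eq case_prod_conv
      using rep_bmult[OF bounded_field_weight, of \<zeta>] rep_bmult[OF bounded_field_weight_ell, of \<zeta>]
        rep_L2_heis_diff[of \<zeta> "?R \<zeta>"]
    proof eventually_elim
      case (elim x)
      have "1 - weight x = weight x * koranyi4 x" using weight_times[of x] by (simp add: algebra_simps)
      then have "rep \<zeta> x - weight x *\<^sub>R rep \<zeta> x = (weight x * koranyi4 x) *\<^sub>R rep \<zeta> x"
        by (metis scaleR_diff_left scaleR_one)
      then show ?case using elim by (simp add: matrix_vector_scaleR ell_square)
    qed
    with weight_in_domain[of \<zeta>] have "(?R \<zeta> + (\<zeta> - ?R \<zeta>), ?R \<zeta>) \<in> ?G" by blast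
    then show "p \<in> ?G" by (simp add: p)
  next
    fix p assume "p \<in> ?G"
    then obtain x y z where p: "p = (x + z, x)" and D: "(x, y) \<in> D" "(y, z) \<in> D" by blast
    have "AE h in lborel. rep (?R (x + z)) h = rep x h"
      using D[unfolded mult_op_def mem_Collect_eq case_prod_conv] rep_L2_heis_add[of x z]
        rep_bmult[OF bounded_field_weight, of "x + z"]
    proof eventually_elim
      case (elim h)
      have "rep (?R (x + z)) h = weight h *\<^sub>R (rep x h + koranyi4 h *\<^sub>R rep x h)"
        using elim by (simp add: matrix_vector_scaleR ell_square)
      also have "\<dots> = (weight h * (1 + koranyi4 h)) *\<^sub>R rep x h"
        by (simp add: algebra_simps)
      finally show ?case by (simp add: weight_times)
    qed
    then have "?R (x + z) = x" by (rule L2_heis_eqI)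
    then show "p \<in> gr ?R" by (auto simp: gr_def p)
  qed
  show ?thesis
    unfolding inv_one_plus_sq_def
  proof (rule the_equality, rule gr_eq)
    fix R' assume "gr R' = ?G"
    then have "gr R' = gr ?R" using gr_eq by simp
    then show "R' = ?R" by (intro blinfun_eqI) (auto simp: gr_def set_eq_iff)
  qed
qed

lemma bracket_neg_power_D: "bracket_neg_power (1 / 2) D = bmult (scalar_field root_weight)"
proof -
  have "continuous_on {0..b} (\<lambda>x :: real. x powr (1 / 4))" for b
    by (intro continuous_intros continuous_on_powr') auto
  then show ?thesis
    unfolding bracket_neg_power_def inv_one_plus_sq_D root_weight_def[abs_def]
    by (subst pos_calculus_bmult[of weight 1 _ 1])
      (simp_all add: weight_pos less_imp_le weight_le_1 powr_le1)
qed

text \<open>Cutting a vector off outside \<open>{N\<^sup>4 \<le> n}\<close> puts it into the domain.\<close>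

lemma closure_Domain_D: "closure (Domain D) = UNIV"
proof -
  have "\<xi> \<in> closure (Domain D)" for \<xi>
  proof -
    define r :: "nat \<Rightarrow> heis \<Rightarrow> real" where "r n = indicator {x. koranyi4 x \<le> real n}" for n
    have [measurable]: "r n \<in> borel_measurable borel" for n unfolding r_def by measurable
    have bf: "bounded_field 1 (scalar_field (r n))" for n
      by (rule bounded_field_scaleR) (simp_all add: r_def split: split_indicator)
    have bfl: "bounded_field (sqrt (real n)) (\<lambda>x. r n x *\<^sub>R L x)" for n
      by (rule bounded_field_truncated_ell) (simp_all add: r_def split: split_indicator)
    have "(bmult (scalar_field (r n)) \<xi>, bmult (\<lambda>x. r n x *\<^sub>R L x) \<xi>) \<in> D" for n
      unfolding mult_op_def mem_Collect_eq case_prod_conv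
      using rep_bmult[OF bf, of n \<xi>] rep_bmult[OF bfl, of n \<xi>]
      by eventually_elim (simp add: matrix_vector_scaleR)
    moreover have "(\<lambda>n. bmult (scalar_field (r n)) \<xi>) \<longlonglongrightarrow> \<xi>"
    proof (rule tendsto_L2_heisI)
      have "AE x in lborel. \<forall>n. rep (bmult (scalar_field (r n)) \<xi>) x = r n x *\<^sub>R rep \<xi> x"
        unfolding AE_all_countable using rep_bmult[OF bf] by (auto simp: matrix_vector_scaleR)
      then show "AE x in lborel. (\<lambda>n. rep (bmult (scalar_field (r n)) \<xi>) x) \<longlonglongrightarrow> rep \<xi> x"
      proof eventually_elim
        case (elim x)
        obtain N where "koranyi4 x \<le> real N" using real_arch_simple by blast
        then have "\<forall>\<^sub>F n in sequentially. r n x = 1"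
          by (intro eventually_mono[OF eventually_ge_at_top[of N]]) (simp add: r_def)
        then have "\<forall>\<^sub>F n in sequentially. rep (bmult (scalar_field (r n)) \<xi>) x = rep \<xi> x"
          by eventually_elim (simp add: elim)
        then show ?case by (rule tendsto_eventually)
      qed
      show "AE x in lborel. norm (rep (bmult (scalar_field (r n)) \<xi>) x - rep \<xi> x) \<le> norm (rep \<xi> x)" for n
        using rep_bmult[OF bf, of n \<xi>] by eventually_elim (simp add: matrix_vector_scaleR r_def split: split_indicator)
      show "integrable lborel (\<lambda>x. (norm (rep \<xi> x))\<^sup>2)"
        using square_integrable_rep by (simp add: square_integrable_def)
    qed
    ultimately show ?thesis unfolding closure_sequential by (meson DomainI)
  qed
  then show ?thesis by auto
qed

text \<open>The matrices \<open>\<ell>(x)\<close> are Hermitian, so \<open>D\<close> is symmetric. If \<open>(y, z)\<close> is in the graph of the adjoint, testing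
  against the vectors \<open>(1 + D\<^sup>2)\<^sup>-\<^sup>1 \<zeta>\<close> gives \<open>w \<ell> y = w z\<close> for the weight \<open>w > 0\<close>, and \<open>w\<close> cancels pointwise.\<close>

lemma selfadjoint_D: "selfadjoint D"
proof -
  have "adjoint_op D = D"
  proof (intro subset_antisym subsetI)
    fix p assume "p \<in> D"
    then show "p \<in> adjoint_op D"
      by (auto simp: adjoint_op_def conj_transpose_ell intro!: cinner_mult_op)
  next
    fix p assume "p \<in> adjoint_op D"
    moreover obtain y z where p: "p = (y, z)" by (cases p)
    ultimately have yz: "\<And>x w. (x, w) \<in> D \<Longrightarrow> cinner w y = cinner x z"
      by (auto simp: adjoint_op_def)
    let ?u = "bmult (\<lambda>x. weight x *\<^sub>R L x) y" and ?v = "bmult (scalar_field weight) z"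
    have self: "conj_transpose (weight x *\<^sub>R L x) = weight x *\<^sub>R L x"
      "conj_transpose (weight x *\<^sub>R mat 1) = weight x *\<^sub>R mat 1" for x
      using conj_transpose_ell[of x] by (auto simp: conj_transpose_def vec_eq_iff mat_def)
    have "cinner \<zeta> (?u - ?v) = 0" for \<zeta>
    proof -
      have "cinner \<zeta> ?u = cinner (bmult (\<lambda>x. weight x *\<^sub>R L x) \<zeta>) y"
        by (rule cinner_mult_op[symmetric, of _ _ "\<lambda>x. weight x *\<^sub>R L x"])
          (simp_all add: self gr_bmult[OF bounded_field_weight_ell, symmetric] gr_def)
      also have "\<dots> = cinner (bmult (scalar_field weight) \<zeta>) z" by (rule yz[OF weight_in_domain])
      also have "\<dots> = cinner \<zeta> ?v"
        by (rule cinner_mult_op[of _ _ "scalar_field weight"])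
          (simp_all add: self gr_bmult[OF bounded_field_weight, symmetric] gr_def)
      finally show ?thesis by (simp add: cinner_minus_right)
    qed
    from this[of "?u - ?v"] have uv: "?u = ?v" by (simp add: cinner_self)
    have "AE x in lborel. rep z x = L x *v rep y x"
      using rep_bmult[OF bounded_field_weight, of z] rep_bmult[OF bounded_field_weight_ell, of y]
    proof eventually_elim
      case (elim x)
      then have "weight x *\<^sub>R (L x *v rep y x) = weight x *\<^sub>R rep z x"
        by (metis uv matrix_vector_scaleR(1) matrix_vector_mul_lid)
      then show ?case using weight_pos[of x] by simp
    qed
    then show "p \<in> D" by (simp add: p mult_op_def)
  qed
  then show ?thesis by (simp add: selfadjoint_def closure_Domain_D)
qed

end

section \<open>Unitaries induced by changes of variables\<close>

text \<open>Translations, the inversion and the dilations of the Heisenberg group all multiply Lebesgue measure by a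
  constant; this is the only property of them that the induced operators use.\<close>

definition measure_scaling :: "real \<Rightarrow> (heis \<Rightarrow> heis) \<Rightarrow> bool" where
  "measure_scaling c \<phi> \<longleftrightarrow> 0 < c \<and> \<phi> \<in> borel_measurable borel \<and>
     distr lborel borel \<phi> = density lborel (\<lambda>_. ennreal c)"

lemma nn_integral_measure_scaling:
  assumes "measure_scaling c \<phi>" and [measurable]: "f \<in> borel_measurable borel"
  shows "(\<integral>\<^sup>+x. f (\<phi> x) \<partial>lborel) = ennreal c * (\<integral>\<^sup>+x. f x \<partial>lborel)"
proof -
  have [measurable]: "\<phi> \<in> borel_measurable borel" and d: "distr lborel borel \<phi> = density lborel (\<lambda>_. ennreal c)"
    using assms by (auto simp: measure_scaling_def)
  have "(\<integral>\<^sup>+x. f (\<phi> x) \<partial>lborel) = integral\<^sup>N (distr lborel borel \<phi>) f"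
    by (rule nn_integral_distr[symmetric]) simp_all
  then show ?thesis by (simp add: d nn_integral_density nn_integral_cmult)
qed

lemma integral_measure_scaling:
  fixes f :: "heis \<Rightarrow> 'b::{banach, second_countable_topology}"
  assumes "measure_scaling c \<phi>" and [measurable]: "f \<in> borel_measurable borel"
  shows "(\<integral>x. f (\<phi> x) \<partial>lborel) = c *\<^sub>R (\<integral>x. f x \<partial>lborel)"
proof -
  have [measurable]: "\<phi> \<in> borel_measurable borel" and d: "distr lborel borel \<phi> = density lborel (\<lambda>_. ennreal c)"
    and c: "0 < c" using assms by (auto simp: measure_scaling_def)
  have "(\<integral>x. f (\<phi> x) \<partial>lborel) = integral\<^sup>L (distr lborel borel \<phi>) f"
    by (rule integral_distr[symmetric]) simp_all
  then show ?thesis using c by (simp add: d integral_density)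
qed

lemma AE_measure_scaling:
  assumes "measure_scaling c \<phi>" "AE x in lborel. P x"
  shows "AE x in lborel. P (\<phi> x)"
proof (rule AE_distrD[where f = \<phi> and P = P and M' = borel])
  show "\<phi> \<in> lborel \<rightarrow>\<^sub>M borel" using assms by (simp add: measure_scaling_def)
  have "AE x in density lborel (\<lambda>_. ennreal c). P x" using assms(2) by (simp add: AE_density)
  moreover have "distr lborel borel \<phi> = density lborel (\<lambda>_. ennreal c)"
    using assms(1) by (simp add: measure_scaling_def)
  ultimately show "AE x in distr lborel borel \<phi>. P x" by (simp only:)
qed

lemma measure_scalingI:
  assumes "0 < c" and [measurable]: "\<phi> \<in> borel_measurable borel"
    and "\<And>f. f \<in> borel_measurable borel \<Longrightarrow> (\<integral>\<^sup>+x. f (\<phi> x) \<partial>lborel) = ennreal c * (\<integral>\<^sup>+x. f x \<partial>lborel)"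
  shows "measure_scaling c \<phi>"
  unfolding measure_scaling_def
proof (intro conjI measure_eqI)
  fix X :: "heis set" assume "X \<in> sets (distr lborel borel \<phi>)"
  then have [measurable]: "X \<in> sets borel" by simp
  have "emeasure (distr lborel borel \<phi>) X = (\<integral>\<^sup>+x. indicator X x \<partial>distr lborel borel \<phi>)" by simp
  also have "\<dots> = (\<integral>\<^sup>+x. indicator X (\<phi> x) \<partial>lborel)" by (rule nn_integral_distr) simp_all
  also have "\<dots> = ennreal c * emeasure lborel X" by (subst assms(3)) simp_all
  finally show "emeasure (distr lborel borel \<phi>) X = emeasure (density lborel (\<lambda>_. ennreal c)) X"
    by (simp add: emeasure_density_const)
qed (use assms in simp_all)

lemma measure_scaling_compose:
  assumes "measure_scaling c \<phi>" "measure_scaling d \<psi>"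
  shows "measure_scaling (c * d) (\<lambda>x. \<phi> (\<psi> x))"
proof (rule measure_scalingI)
  have [measurable]: "\<phi> \<in> borel_measurable borel" "\<psi> \<in> borel_measurable borel"
    using assms by (simp_all add: measure_scaling_def)
  show "(\<lambda>x. \<phi> (\<psi> x)) \<in> borel_measurable borel" by measurable
  show "0 < c * d" using assms by (simp add: measure_scaling_def)
  fix f :: "heis \<Rightarrow> ennreal" assume [measurable]: "f \<in> borel_measurable borel"
  show "(\<integral>\<^sup>+x. f (\<phi> (\<psi> x)) \<partial>lborel) = ennreal (c * d) * (\<integral>\<^sup>+x. f x \<partial>lborel)"
    using assms nn_integral_measure_scaling[OF assms(2), of "\<lambda>x. f (\<phi> x)"]
      nn_integral_measure_scaling[OF assms(1), of f]
    by (simp add: measure_scaling_def ennreal_mult mult_ac)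
qed

lemma measure_scaling_heis_tri:
  assumes "\<phi> \<in> borel_measurable borel" "s1 \<noteq> 0" "s2 \<noteq> 0" "s3 \<noteq> 0"
  shows "measure_scaling (1 / \<bar>s1 * s2 * s3\<bar>) (heis_tri t1 s1 t2 s2 s3 \<phi>)"
proof (rule measure_scalingI)
  let ?s = "\<bar>s1 * s2 * s3\<bar>"
  show s: "0 < 1 / ?s" using assms by simp
  fix f :: "heis \<Rightarrow> ennreal" assume f: "f \<in> borel_measurable borel"
  let ?I = "\<integral>\<^sup>+x. f (heis_tri t1 s1 t2 s2 s3 \<phi> x) \<partial>lborel"
  have "ennreal (1 / ?s) * (\<integral>\<^sup>+x. f x \<partial>lborel) = ennreal (1 / ?s) * (ennreal ?s * ?I)"
    by (subst nn_integral_heis_tri[OF assms(1) f assms(2-4)]) simp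
  also have "\<dots> = ennreal (1 / ?s * ?s) * ?I"
    using s by (simp only: ennreal_mult mult.assoc abs_ge_zero less_imp_le)
  also have "1 / ?s * ?s = 1" using assms by simp
  finally show "?I = ennreal (1 / ?s) * (\<integral>\<^sup>+x. f x \<partial>lborel)" by simp
qed (use assms in simp)

lemma measure_scaling_heis_mult: "measure_scaling 1 (heis_mult y)"
  using measure_scaling_heis_tri[of "\<lambda>p. snd (snd y) + fst y * snd p" 1 1 1 "fst y" "fst (snd y)"]
  by (cases y) (simp add: heis_mult_tri)

lemma measure_scaling_heis_inv: "measure_scaling 1 heis_inv"
  using measure_scaling_heis_tri[of "\<lambda>p. fst p * snd p" "-1" "-1" "-1" 0 0] by (simp add: heis_inv_tri)

lemma measure_scaling_heis_dil: "0 < t \<Longrightarrow> measure_scaling (1 / t ^ 4) (heis_dil t)"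
  using measure_scaling_heis_tri[of "\<lambda>_. 0" t t "t\<^sup>2" 0 0]
  by (simp add: heis_dil_tri power2_eq_square power4_eq_xxxx mult.assoc)

lemma heis_mult_assoc: "heis_mult (heis_mult x y) z = heis_mult x (heis_mult y z)"
  by (cases x; cases y; cases z) (simp add: heis_mult_def algebra_simps)

lemma heis_inv_cancel [simp]:
  "heis_mult (heis_inv x) (heis_mult x y) = y" "heis_mult x (heis_mult (heis_inv x) y) = y"
  by (cases x; cases y; simp add: heis_mult_def heis_inv_def algebra_simps)+

lemma heis_inv_mult: "heis_inv (heis_mult x y) = heis_mult (heis_inv y) (heis_inv x)"
  by (cases x; cases y) (simp add: heis_mult_def heis_inv_def algebra_simps)

lemma heis_inv_inv [simp]: "heis_inv (heis_inv x) = x"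
  by (cases x) (simp add: heis_inv_def)

lemma measure_scaling_right_quotient: "measure_scaling 1 (\<lambda>y. heis_mult x (heis_inv y))"
  using measure_scaling_compose[OF measure_scaling_heis_mult measure_scaling_heis_inv] by simp

lemma measure_scaling_left_quotient: "measure_scaling 1 (\<lambda>y. ldiv y x)"
  using measure_scaling_compose[OF measure_scaling_heis_inv measure_scaling_heis_mult[of "heis_inv x"]]
  by (simp add: heis_inv_mult)

lemma cinner_eqI: "(\<And>\<eta>. cinner \<eta> \<xi> = cinner \<eta> \<xi>') \<Longrightarrow> \<xi> = (\<xi>' :: 'h::chilbert_space)"
proof -
  assume "\<And>\<eta>. cinner \<eta> \<xi> = cinner \<eta> \<xi>'"
  then have "cinner (\<xi> - \<xi>') (\<xi> - \<xi>') = 0" by (simp add: cinner_minus_right)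
  then show ?thesis by (simp add: cinner_self)
qed

text \<open>Unitary if \<open>\<phi>\<close> scales the measure by \<open>1 / s\<^sup>2\<close>.\<close>

definition pullback :: "real \<Rightarrow> (heis \<Rightarrow> heis) \<Rightarrow> (L2_heis \<Rightarrow>\<^sub>L L2_heis)" where
  "pullback s \<phi> = Blinfun (\<lambda>\<xi>. abs_L2_heis (\<lambda>x. s *\<^sub>R rep \<xi> (\<phi> x)))"

lemma
  assumes \<phi>: "measure_scaling (1 / s\<^sup>2) \<phi>"
  shows rep_pullback: "AE x in lborel. rep (pullback s \<phi> \<xi>) x = s *\<^sub>R rep \<xi> (\<phi> x)"
    and bop_pullback: "bop (pullback s \<phi>)"
    and cinner_pullback: "cinner (pullback s \<phi> \<xi>) (pullback s \<phi> \<eta>) = cinner \<xi> \<eta>"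
proof -
  have [measurable]: "\<phi> \<in> borel_measurable borel" and s: "s \<noteq> 0" using \<phi> by (auto simp: measure_scaling_def)
  have bound: "(\<integral>\<^sup>+x. ennreal ((norm (s *\<^sub>R rep \<xi> (\<phi> x)))\<^sup>2) \<partial>lborel) \<le> ennreal ((1 * norm \<xi>)\<^sup>2)" for \<xi>
  proof -
    have "(\<integral>\<^sup>+x. ennreal ((norm (s *\<^sub>R rep \<xi> (\<phi> x)))\<^sup>2) \<partial>lborel)
        = ennreal (s\<^sup>2) * (\<integral>\<^sup>+x. ennreal ((norm (rep \<xi> (\<phi> x)))\<^sup>2) \<partial>lborel)"
      by (subst nn_integral_cmult[symmetric]) (simp_all add: power_mult_distrib flip: ennreal_mult)
    also have "\<dots> = ennreal ((norm \<xi>)\<^sup>2)"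
      using s by (subst nn_integral_measure_scaling[OF \<phi>, of "\<lambda>x. ennreal ((norm (rep \<xi> x))\<^sup>2)"])
        (simp_all add: nn_norm_L2_heis flip: ennreal_mult)
    finally show ?thesis by simp
  qed
  have sq: "square_integrable (\<lambda>x. s *\<^sub>R rep \<xi> (\<phi> x))" for \<xi>
    by (rule square_integrable_nn_bound[OF _ bound]) simp
  have add: "AE x in lborel. s *\<^sub>R rep (\<xi> + \<eta>) (\<phi> x) = s *\<^sub>R rep \<xi> (\<phi> x) + s *\<^sub>R rep \<eta> (\<phi> x)" for \<xi> \<eta>
    using AE_measure_scaling[OF \<phi> rep_L2_heis_add[of \<xi> \<eta>]] by eventually_elim (simp add: scaleR_add_right)
  have scale: "AE x in lborel. s *\<^sub>R rep (c *\<^sub>C \<xi>) (\<phi> x) = c *s (s *\<^sub>R rep \<xi> (\<phi> x))" for c \<xi>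
    using AE_measure_scaling[OF \<phi> rep_L2_heis_scaleC[of c \<xi>]]
    by eventually_elim (simp add: scaleR_smult vector_smult_assoc mult.commute)
  note * = L2_operator[OF sq add scale bound zero_le_one, folded pullback_def]
  show rep: "AE x in lborel. rep (pullback s \<phi> \<xi>) x = s *\<^sub>R rep \<xi> (\<phi> x)" for \<xi> by (rule *(4))
  show "bop (pullback s \<phi>)" by (rule *(2))
  have "cinner (pullback s \<phi> \<xi>) (pullback s \<phi> \<eta>)
      = (\<integral>x. s\<^sup>2 *\<^sub>R c2_inner (rep \<xi> (\<phi> x)) (rep \<eta> (\<phi> x)) \<partial>lborel)"
    unfolding cinner_L2_heis_eq
  proof (rule Bochner_Integration.integral_cong_AE)
    show "AE x in lborel. c2_inner (rep (pullback s \<phi> \<xi>) x) (rep (pullback s \<phi> \<eta>) x)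
        = s\<^sup>2 *\<^sub>R c2_inner (rep \<xi> (\<phi> x)) (rep \<eta> (\<phi> x))"
      using rep[of \<xi>] rep[of \<eta>]
    proof eventually_elim
      case (elim x)
      have "c2_inner (s *\<^sub>R v) (s *\<^sub>R w) = s\<^sup>2 *\<^sub>R c2_inner v w" for v w
        unfolding scaleR_smult by (simp add: c2_inner_def sum_2 scaleR_conv_of_real power2_eq_square algebra_simps)
      then show ?case by (simp add: elim)
    qed
  qed measurable
  also have "\<dots> = cinner \<xi> \<eta>"
    unfolding cinner_L2_heis_eq integral_scaleR_right
    by (subst integral_measure_scaling[OF \<phi>, of "\<lambda>x. c2_inner (rep \<xi> x) (rep \<eta> x)"]) (simp_all add: s)
  finally show "cinner (pullback s \<phi> \<xi>) (pullback s \<phi> \<eta>) = cinner \<xi> \<eta>" .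
qed

lemma pullback_compose:
  assumes \<phi>: "measure_scaling (1 / s\<^sup>2) \<phi>" and \<psi>: "measure_scaling (1 / r\<^sup>2) \<psi>"
  shows "pullback s \<phi> (pullback r \<psi> \<xi>) = pullback (s * r) (\<lambda>x. \<psi> (\<phi> x)) \<xi>"
proof (rule L2_heis_eqI)
  have c: "measure_scaling (1 / (s * r)\<^sup>2) (\<lambda>x. \<psi> (\<phi> x))"
    using measure_scaling_compose[OF \<psi> \<phi>] by (simp add: power_mult_distrib mult.commute)
  show "AE x in lborel. rep (pullback s \<phi> (pullback r \<psi> \<xi>)) x = rep (pullback (s * r) (\<lambda>x. \<psi> (\<phi> x)) \<xi>) x"
    using rep_pullback[OF c, of \<xi>] rep_pullback[OF \<phi>, of "pullback r \<psi> \<xi>"]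
      AE_measure_scaling[OF \<phi> rep_pullback[OF \<psi>, of \<xi>]]
    by eventually_elim simp
qed

lemma pullback_id: "pullback 1 (\<lambda>x. x) \<xi> = \<xi>"
proof (rule L2_heis_eqI)
  have "measure_scaling (1 / 1\<^sup>2) (\<lambda>x. x)" by (rule measure_scalingI) simp_all
  from rep_pullback[OF this, of \<xi>]
  show "AE x in lborel. rep (pullback 1 (\<lambda>x. x) \<xi>) x = rep \<xi> x" by simp
qed

lemma is_adjoint_pullback:
  assumes \<phi>: "measure_scaling (1 / s\<^sup>2) \<phi>" and \<psi>: "measure_scaling (1 / (1 / s)\<^sup>2) \<psi>"
    and inv: "\<And>x. \<psi> (\<phi> x) = x"
  shows "is_adjoint (pullback s \<phi>) (pullback (1 / s) \<psi>)"
  unfolding is_adjoint_def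
proof (intro allI)
  fix \<xi> \<eta>
  have "s \<noteq> 0" using \<phi> by (auto simp: measure_scaling_def)
  then have "pullback s \<phi> (pullback (1 / s) \<psi> \<eta>) = \<eta>"
    using pullback_compose[OF \<phi> \<psi>] by (simp add: inv pullback_id)
  then show "cinner (pullback s \<phi> \<xi>) \<eta> = cinner \<xi> (pullback (1 / s) \<psi> \<eta>)"
    using cinner_pullback[OF \<phi>, of \<xi> "pullback (1 / s) \<psi> \<eta>"] by simp
qed

definition transl :: "heis \<Rightarrow> (L2_heis \<Rightarrow>\<^sub>L L2_heis)" where
  "transl y = pullback 1 (heis_mult (heis_inv y))"

lemma measure_scaling_translate: "measure_scaling (1 / 1\<^sup>2) (heis_mult y)"
  using measure_scaling_heis_mult by simp

lemma rep_transl: "AE x in lborel. rep (transl y \<xi>) x = rep \<xi> (ldiv y x)"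
  using rep_pullback[OF measure_scaling_translate] by (simp add: transl_def)

lemma norm_transl: "norm (transl y \<xi>) = norm \<xi>"
  using cinner_pullback[OF measure_scaling_translate, of "heis_inv y" \<xi> \<xi>]
  by (simp add: transl_def cinner_self flip: of_real_power)

lemma transl_mult: "transl y (transl z \<xi>) = transl (heis_mult y z) \<xi>"
  unfolding transl_def
  using pullback_compose[OF measure_scaling_translate measure_scaling_translate, of "heis_inv y" "heis_inv z" \<xi>]
  by (simp add: heis_inv_mult heis_mult_assoc[abs_def])

lemma is_adjoint_transl: "is_adjoint (transl y) (transl (heis_inv y))"
  using is_adjoint_pullback[of 1 "heis_mult (heis_inv y)" "heis_mult y"] measure_scaling_heis_mult
  by (simp add: transl_def)

text \<open>The matrix coefficients of left translation. Identities between convolution operators are proved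
  weakly, through \<open>\<langle>\<eta>, f * \<xi>\<rangle> = \<integral> f(y) \<langle>\<eta>, \<lambda>(y) \<xi>\<rangle> dy\<close>, where everything is a scalar integral against a bounded
  function.\<close>

definition coefficient :: "L2_heis \<Rightarrow> L2_heis \<Rightarrow> heis \<Rightarrow> complex" where
  "coefficient \<eta> \<xi> y = cinner \<eta> (transl y \<xi>)"

lemma coefficient_eq:
  "coefficient \<eta> \<xi> y = (\<integral>x. c2_inner (rep \<eta> x) (rep \<xi> (ldiv y x)) \<partial>lborel)"
  unfolding coefficient_def cinner_L2_heis_eq
proof (rule Bochner_Integration.integral_cong_AE)
  show "AE x in lborel. c2_inner (rep \<eta> x) (rep (transl y \<xi>) x)
      = c2_inner (rep \<eta> x) (rep \<xi> (ldiv y x))"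
    using rep_transl[of y \<xi>] by eventually_elim simp
qed measurable

lemma coefficient_measurable [measurable]: "coefficient \<eta> \<xi> \<in> borel_measurable borel"
proof -
  have "(\<lambda>y. \<integral>x. c2_inner (rep \<eta> x) (rep \<xi> (ldiv y x)) \<partial>lborel) \<in> borel_measurable lborel"
    by (rule lborel.borel_measurable_lebesgue_integral) measurable
  then show ?thesis by (simp add: coefficient_eq[abs_def])
qed

lemma norm_coefficient: "norm (coefficient \<eta> \<xi> y) \<le> norm \<eta> * norm \<xi>"
  unfolding coefficient_def using norm_cinner_le[of \<eta> "transl y \<xi>"] by (simp add: norm_transl)

section \<open>Kernel operators and the left regular representation\<close>

definition kernel_op :: "(heis \<Rightarrow> heis \<Rightarrow> complex^2^2) \<Rightarrow> (L2_heis \<Rightarrow>\<^sub>L L2_heis)" where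
  "kernel_op K = Blinfun (\<lambda>\<xi>. abs_L2_heis (\<lambda>x. \<integral>y. K y x *v rep \<xi> (ldiv y x) \<partial>lborel))"

text \<open>The variable \<open>y\<close> is the group element by which the argument of \<open>\<xi>\<close> is translated, so that a bound by an integrable
  function of \<open>y\<close> alone is what Young's inequality requires.\<close>

definition dominated_kernel :: "(heis \<Rightarrow> real) \<Rightarrow> (heis \<Rightarrow> heis \<Rightarrow> complex^2^2) \<Rightarrow> bool" where
  "dominated_kernel g K \<longleftrightarrow> integrable lborel g \<and> (\<forall>y. 0 \<le> g y) \<and>
     (\<lambda>(y, x). K y x) \<in> borel_measurable (borel \<Otimes>\<^sub>M borel) \<and> (\<forall>y x v. norm (K y x *v v) \<le> g y * norm v)"

text \<open>Cauchy-Schwarz for the measure \<open>g(y) dy\<close> gives \<open>(\<integral> g h)\<^sup>2 \<le> (\<integral> g) (\<integral> g h\<^sup>2)\<close>; integrate over \<open>x\<close> and use the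
  translation invariance of the measure.\<close>

lemma young_inequality:
  fixes g h :: "heis \<Rightarrow> real"
  assumes [measurable]: "g \<in> borel_measurable borel" "h \<in> borel_measurable borel"
    and g0: "\<And>y. 0 \<le> g y" and h0: "\<And>y. 0 \<le> h y"
  shows "(\<integral>\<^sup>+x. (\<integral>\<^sup>+y. ennreal (g y * h (ldiv y x)) \<partial>lborel)\<^sup>2 \<partial>lborel)
    \<le> (\<integral>\<^sup>+y. ennreal (g y) \<partial>lborel)\<^sup>2 * (\<integral>\<^sup>+x. ennreal ((h x)\<^sup>2) \<partial>lborel)"
proof -
  let ?G = "\<integral>\<^sup>+y. ennreal (g y) \<partial>lborel" and ?H = "\<integral>\<^sup>+x. ennreal ((h x)\<^sup>2) \<partial>lborel"
  have cs: "(\<integral>\<^sup>+y. ennreal (g y * h (ldiv y x)) \<partial>lborel)\<^sup>2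
      \<le> ?G * (\<integral>\<^sup>+y. ennreal (g y * (h (ldiv y x))\<^sup>2) \<partial>lborel)" for x
  proof -
    have "(\<integral>\<^sup>+y. ennreal (g y * h (ldiv y x)) \<partial>lborel)
       = (\<integral>\<^sup>+y. ennreal (sqrt (g y)) * ennreal (sqrt (g y) * h (ldiv y x)) \<partial>lborel)"
      by (rule nn_integral_cong) (simp add: g0 h0 flip: ennreal_mult mult.assoc)
    also have "\<dots>\<^sup>2 \<le> (\<integral>\<^sup>+y. (ennreal (sqrt (g y)))\<^sup>2 \<partial>lborel) * (\<integral>\<^sup>+y. (ennreal (sqrt (g y) * h (ldiv y x)))\<^sup>2 \<partial>lborel)"
      by (rule Cauchy_Schwarz_nn_integral) measurable
    finally show ?thesis by (simp add: ennreal_power g0 h0 power_mult_distrib)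
  qed
  have "(\<integral>\<^sup>+x. (\<integral>\<^sup>+y. ennreal (g y * h (ldiv y x)) \<partial>lborel)\<^sup>2 \<partial>lborel)
      \<le> (\<integral>\<^sup>+x. ?G * (\<integral>\<^sup>+y. ennreal (g y * (h (ldiv y x))\<^sup>2) \<partial>lborel) \<partial>lborel)"
    by (intro nn_integral_mono cs)
  also have "\<dots> = ?G * (\<integral>\<^sup>+x. \<integral>\<^sup>+y. ennreal (g y * (h (ldiv y x))\<^sup>2) \<partial>lborel \<partial>lborel)"
    by (rule nn_integral_cmult) measurable
  also have "(\<integral>\<^sup>+x. \<integral>\<^sup>+y. ennreal (g y * (h (ldiv y x))\<^sup>2) \<partial>lborel \<partial>lborel)
      = (\<integral>\<^sup>+y. \<integral>\<^sup>+x. ennreal (g y * (h (ldiv y x))\<^sup>2) \<partial>lborel \<partial>lborel)"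
    by (rule lborel_pair.Fubini') measurable
  also have "\<dots> = (\<integral>\<^sup>+y. ennreal (g y) * ?H \<partial>lborel)"
  proof (rule nn_integral_cong)
    fix y
    have "(\<integral>\<^sup>+x. ennreal (g y * (h (ldiv y x))\<^sup>2) \<partial>lborel)
        = ennreal (g y) * (\<integral>\<^sup>+x. ennreal ((h (ldiv y x))\<^sup>2) \<partial>lborel)"
      by (subst nn_integral_cmult[symmetric]) (simp_all add: g0 ennreal_mult)
    then show "(\<integral>\<^sup>+x. ennreal (g y * (h (ldiv y x))\<^sup>2) \<partial>lborel) = ennreal (g y) * ?H"
      using nn_integral_measure_scaling[OF measure_scaling_heis_mult, of "\<lambda>x. ennreal ((h x)\<^sup>2)" "heis_inv y"] by simp
  qed
  also have "\<dots> = ?G * ?H" by (rule nn_integral_multc) measurable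
  finally show ?thesis by (simp add: power2_eq_square mult.assoc)
qed

lemma bounded_linear_smult_vec: "bounded_linear (\<lambda>v :: complex^2. c *s v)"
  by (rule bounded_linear_intro[where K = "cmod c"])
    (simp_all add: vector_add_ldistrib norm_smult_vec mult.commute scaleR_smult vector_smult_assoc)

lemma
  assumes K: "dominated_kernel g K"
  shows rep_kernel_op: "AE x in lborel. rep (kernel_op K \<xi>) x
      = (\<integral>y. K y x *v rep \<xi> (ldiv y x) \<partial>lborel)"
    and kernel_integrable: "AE x in lborel. integrable lborel (\<lambda>y. K y x *v rep \<xi> (ldiv y x))"
    and bop_kernel_op: "bop (kernel_op K)"
    and norm_kernel_op: "norm (kernel_op K) \<le> (\<integral>y. g y \<partial>lborel)"
proof -
  have g: "integrable lborel g" and g0: "\<And>y. 0 \<le> g y"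
    and [measurable]: "(\<lambda>(y, x). K y x) \<in> borel_measurable (borel \<Otimes>\<^sub>M borel)"
    and K_le: "\<And>y x v. norm (K y x *v v) \<le> g y * norm v"
    using K by (auto simp: dominated_kernel_def)
  have [measurable]: "g \<in> borel_measurable borel" using borel_measurable_integrable[OF g] by simp
  let ?G = "\<integral>y. g y \<partial>lborel"
  have G0: "0 \<le> ?G" using g0 by (rule Bochner_Integration.integral_nonneg)
  have nnG: "(\<integral>\<^sup>+y. ennreal (g y) \<partial>lborel) = ennreal ?G"
    by (rule nn_integral_eq_integral[OF g]) (simp add: g0)
  define A where "A \<xi> x = (\<integral>\<^sup>+y. ennreal (g y * norm (rep \<xi> (ldiv y x))) \<partial>lborel)" for \<xi> x
  have [measurable]: "A \<xi> \<in> borel_measurable borel" for \<xi>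
  proof -
    have "A \<xi> \<in> borel_measurable lborel"
      unfolding A_def by (rule lborel.borel_measurable_nn_integral) measurable
    then show ?thesis by simp
  qed
  have young: "(\<integral>\<^sup>+x. (A \<xi> x)\<^sup>2 \<partial>lborel) \<le> ennreal ((?G * norm \<xi>)\<^sup>2)" for \<xi>
    using young_inequality[of g "\<lambda>x. norm (rep \<xi> x)"] g0 G0
    by (simp add: A_def nn_norm_L2_heis nnG ennreal_power power_mult_distrib flip: ennreal_mult)
  have int: "AE x in lborel. integrable lborel (\<lambda>y. K y x *v rep \<xi> (ldiv y x))" for \<xi>
  proof -
    have "(\<integral>\<^sup>+x. (A \<xi> x)\<^sup>2 \<partial>lborel) \<noteq> \<infinity>" using young[of \<xi>] by (auto simp: top_unique)
    then have "AE x in lborel. (A \<xi> x)\<^sup>2 \<noteq> \<infinity>" by (intro nn_integral_noteq_infinite) auto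
    then show ?thesis
    proof eventually_elim
      case (elim x)
      have "(\<integral>\<^sup>+y. ennreal (norm (K y x *v rep \<xi> (ldiv y x))) \<partial>lborel) \<le> A \<xi> x"
        unfolding A_def by (intro nn_integral_mono ennreal_leI K_le)
      also have "\<dots> < \<infinity>" using elim by (auto simp: top.not_eq_extremum power2_eq_square ennreal_mult_eq_top_iff)
      finally show ?case by (intro integrableI_bounded) measurable
    qed
  qed
  define F where "F \<xi> x = (\<integral>y. K y x *v rep \<xi> (ldiv y x) \<partial>lborel)" for \<xi> x
  have [measurable]: "F \<xi> \<in> borel_measurable borel" for \<xi>
  proof -
    have "F \<xi> \<in> borel_measurable lborel"
      unfolding F_def by (rule lborel.borel_measurable_lebesgue_integral) measurable
    then show ?thesis by simp
  qed
  have bound: "(\<integral>\<^sup>+x. ennreal ((norm (F \<xi> x))\<^sup>2) \<partial>lborel) \<le> ennreal ((?G * norm \<xi>)\<^sup>2)" for \<xi>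
  proof -
    have "ennreal ((norm (F \<xi> x))\<^sup>2) \<le> (A \<xi> x)\<^sup>2" for x
    proof -
      have "ennreal (norm (F \<xi> x)) \<le> (\<integral>\<^sup>+y. ennreal (norm (K y x *v rep \<xi> (ldiv y x))) \<partial>lborel)"
        unfolding F_def
        by (cases "integrable lborel (\<lambda>y. K y x *v rep \<xi> (ldiv y x))")
          (simp_all add: integral_norm_bound_ennreal not_integrable_integral_eq)
      also have "\<dots> \<le> A \<xi> x" unfolding A_def by (intro nn_integral_mono ennreal_leI K_le)
      finally show ?thesis by (simp add: power_mono flip: ennreal_power)
    qed
    then have "(\<integral>\<^sup>+x. ennreal ((norm (F \<xi> x))\<^sup>2) \<partial>lborel) \<le> (\<integral>\<^sup>+x. (A \<xi> x)\<^sup>2 \<partial>lborel)"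
      by (rule nn_integral_mono)
    then show ?thesis using young[of \<xi>] by (rule order_trans)
  qed
  have sq: "square_integrable (F \<xi>)" for \<xi>
    by (rule square_integrable_nn_bound[OF _ bound]) simp
  have add: "AE x in lborel. F (\<xi> + \<eta>) x = F \<xi> x + F \<eta> x" for \<xi> \<eta>
    using int[of \<xi>] int[of \<eta>]
  proof eventually_elim
    case (elim x)
    have "F (\<xi> + \<eta>) x = (\<integral>y. K y x *v rep \<xi> (ldiv y x)
        + K y x *v rep \<eta> (ldiv y x) \<partial>lborel)"
      unfolding F_def
    proof (rule Bochner_Integration.integral_cong_AE)
      show "AE y in lborel. K y x *v rep (\<xi> + \<eta>) (ldiv y x)
        = K y x *v rep \<xi> (ldiv y x) + K y x *v rep \<eta> (ldiv y x)"
        using AE_measure_scaling[OF measure_scaling_left_quotient rep_L2_heis_add[of \<xi> \<eta>], of x]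
        by eventually_elim (simp add: matrix_vector_right_distrib)
    qed measurable
    then show ?case using elim by (simp add: F_def)
  qed
  have scale: "AE x in lborel. F (c *\<^sub>C \<xi>) x = c *s F \<xi> x" for c \<xi>
    using int[of \<xi>]
  proof eventually_elim
    case (elim x)
    have "F (c *\<^sub>C \<xi>) x = (\<integral>y. c *s (K y x *v rep \<xi> (ldiv y x)) \<partial>lborel)"
      unfolding F_def
    proof (rule Bochner_Integration.integral_cong_AE)
      show "AE y in lborel. K y x *v rep (c *\<^sub>C \<xi>) (ldiv y x)
        = c *s (K y x *v rep \<xi> (ldiv y x))"
        using AE_measure_scaling[OF measure_scaling_left_quotient rep_L2_heis_scaleC[of c \<xi>], of x]
        by eventually_elim (simp add: matrix_vector_smult)
    qed measurable
    also have "\<dots> = c *s F \<xi> x"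
      unfolding F_def by (rule integral_bounded_linear[OF bounded_linear_smult_vec elim])
    finally show ?case .
  qed
  note * = L2_operator[OF sq add scale bound G0, unfolded F_def, folded kernel_op_def]
  show "AE x in lborel. rep (kernel_op K \<xi>) x
      = (\<integral>y. K y x *v rep \<xi> (ldiv y x) \<partial>lborel)" by (rule *(4))
  show "bop (kernel_op K)" by (rule *(2))
  show "norm (kernel_op K) \<le> ?G" by (rule *(3))
  show "AE x in lborel. integrable lborel (\<lambda>y. K y x *v rep \<xi> (ldiv y x))" by (rule int)
qed

definition conv_op :: "(heis \<Rightarrow> complex) \<Rightarrow> (L2_heis \<Rightarrow>\<^sub>L L2_heis)" where
  "conv_op f = kernel_op (\<lambda>y x. mat (f y))"

lemma mat_vector_mult: "mat c *v v = c *s (v :: complex^2)"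
  by (simp add: vec_eq_iff matrix_vector_mult_def mat_def sum_2 forall_2)

lemma mat_measurable [measurable]:
  assumes [measurable]: "f \<in> borel_measurable M"
  shows "(\<lambda>x. mat (f x) :: complex^2^2) \<in> borel_measurable M"
proof -
  have "continuous_on UNIV (\<lambda>c :: complex. if i = j then c else 0)" for i j :: 2
    by (cases "i = j") simp_all
  then have "continuous_on UNIV (\<lambda>c. mat c :: complex^2^2)"
    unfolding mat_def by (intro continuous_on_vec_lambda)
  then show ?thesis by (rule borel_measurable_continuous_on) simp
qed

lemma dominated_kernel_conv:
  assumes "integrable lborel f"
  shows "dominated_kernel (\<lambda>y. norm (f y)) (\<lambda>y x. mat (f y))"
proof -
  have [measurable]: "f \<in> borel_measurable borel" using borel_measurable_integrable[OF assms] by simp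
  show ?thesis using assms by (simp add: dominated_kernel_def mat_vector_mult norm_smult_vec)
qed

text \<open>This is Fubini's theorem; the double integral converges absolutely because the integral over \<open>x\<close> is bounded
  independently of \<open>y\<close>.\<close>

lemma cinner_conv_op:
  assumes f: "integrable lborel f"
  shows "cinner \<eta> (conv_op f \<xi>) = (\<integral>y. f y * coefficient \<eta> \<xi> y \<partial>lborel)"
proof -
  have [measurable]: "f \<in> borel_measurable borel" using borel_measurable_integrable[OF f] by simp
  note K = dominated_kernel_conv[OF f]
  let ?c = "\<lambda>y x. c2_inner (rep \<eta> x) (rep \<xi> (ldiv y x))"
  have "cinner \<eta> (conv_op f \<xi>) = (\<integral>x. \<integral>y. f y * ?c y x \<partial>lborel \<partial>lborel)"
    unfolding cinner_L2_heis_eq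
  proof (rule Bochner_Integration.integral_cong_AE)
    show "AE x in lborel. c2_inner (rep \<eta> x) (rep (conv_op f \<xi>) x) = (\<integral>y. f y * ?c y x \<partial>lborel)"
      using rep_kernel_op[OF K, of \<xi>, folded conv_op_def] kernel_integrable[OF K, of \<xi>]
    proof eventually_elim
      case (elim x)
      have bl: "bounded_linear (c2_inner v)" for v
      proof (rule bounded_linear_intro[where K = "norm v"])
        show "norm (c2_inner v w) \<le> norm w * norm v" for w using norm_cdot[of v w] by (simp add: mult.commute)
        show "c2_inner v (r *\<^sub>R w) = r *\<^sub>R c2_inner v w" for r w by (simp only: c2_inner_scaleR scaleR_conv_of_real[where 'a = complex])
      qed (simp add: c2_inner_def sum_2 algebra_simps)
      have "c2_inner (rep \<eta> x) (rep (conv_op f \<xi>) x)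
          = (\<integral>y. c2_inner (rep \<eta> x) (mat (f y) *v rep \<xi> (ldiv y x)) \<partial>lborel)"
        unfolding elim(1) by (rule integral_bounded_linear[OF bl elim(2), symmetric])
      also have "\<dots> = (\<integral>y. f y * ?c y x \<partial>lborel)"
        by (simp add: mat_vector_mult c2_inner_def sum_2 algebra_simps)
      finally show ?case .
    qed
  qed measurable
  also have "\<dots> = (\<integral>y. \<integral>x. f y * ?c y x \<partial>lborel \<partial>lborel)"
  proof (rule lborel_pair.Fubini_integral)
    show "integrable (lborel \<Otimes>\<^sub>M lborel) (\<lambda>(y, x). f y * ?c y x)"
    proof (rule lborel_pair.Fubini_integrable)
      have sq: "integrable lborel (\<lambda>x. (norm (rep \<zeta> x))\<^sup>2)" for \<zeta>
        using square_integrable_rep[of \<zeta>] by (simp add: square_integrable_def)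
      have int: "integrable lborel (\<lambda>x. ?c y x)" for y
      proof -
        have "square_integrable (\<lambda>x. rep \<xi> (ldiv y x))"
          using integrable_translate[OF sq[of \<xi>], of "heis_inv y"] by (simp add: square_integrable_def)
        then show ?thesis by (rule square_integrable_cdot[OF square_integrable_rep])
      qed
      have le: "(\<integral>x. norm (?c y x) \<partial>lborel) \<le> (norm \<eta>)\<^sup>2 + (norm \<xi>)\<^sup>2" for y
      proof -
        have "(\<integral>x. norm (?c y x) \<partial>lborel)
          \<le> (\<integral>x. (norm (rep \<eta> x))\<^sup>2 + (norm (rep \<xi> (ldiv y x)))\<^sup>2 \<partial>lborel)"
        proof (rule integral_mono)
          fix x
          have "2 * (norm v * norm w) \<le> (norm v)\<^sup>2 + (norm w)\<^sup>2" for v w :: "complex^2"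
            using sum_squares_ge_zero[of "norm v - norm w" 0] by (simp add: power2_eq_square algebra_simps)
          moreover have "0 \<le> norm v * norm w" for v w :: "complex^2" by simp
          ultimately show "norm (?c y x) \<le> (norm (rep \<eta> x))\<^sup>2 + (norm (rep \<xi> (ldiv y x)))\<^sup>2"
            using norm_cdot[of "rep \<eta> x" "rep \<xi> (ldiv y x)"]
            by (smt (verit))
        qed (use int sq integrable_translate[OF sq] in simp_all)
        also have "\<dots> = (norm \<eta>)\<^sup>2 + (norm \<xi>)\<^sup>2"
          using sq integrable_translate[OF sq] integral_translate[of "\<lambda>x. (norm (rep \<xi> x))\<^sup>2"]
          by (simp add: norm_L2_heis_eq)
        finally show ?thesis .
      qed
      show "integrable lborel (\<lambda>y. \<integral>x. norm (case (y, x) of (y, x) \<Rightarrow> f y * ?c y x) \<partial>lborel)"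
      proof (rule Bochner_Integration.integrable_bound)
        show "integrable lborel (\<lambda>y. ((norm \<eta>)\<^sup>2 + (norm \<xi>)\<^sup>2) * norm (f y))" using f by simp
        show "AE y in lborel. norm (\<integral>x. norm (case (y, x) of (y, x) \<Rightarrow> f y * ?c y x) \<partial>lborel)
            \<le> norm (((norm \<eta>)\<^sup>2 + (norm \<xi>)\<^sup>2) * norm (f y))"
        proof (rule AE_I2)
          fix y
          have "norm (f y) * (\<integral>x. norm (?c y x) \<partial>lborel) \<le> norm (f y) * ((norm \<eta>)\<^sup>2 + (norm \<xi>)\<^sup>2)"
            by (intro mult_left_mono le) simp
          then show "norm (\<integral>x. norm (case (y, x) of (y, x) \<Rightarrow> f y * ?c y x) \<partial>lborel)
            \<le> norm (((norm \<eta>)\<^sup>2 + (norm \<xi>)\<^sup>2) * norm (f y))"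
            by (simp add: norm_mult abs_mult mult.commute)
        qed
      qed measurable
      show "AE y in lborel. integrable lborel (\<lambda>x. case (y, x) of (y, x) \<Rightarrow> f y * ?c y x)" using int by simp
    qed measurable
  qed
  finally show ?thesis by (simp add: coefficient_eq)
qed

lemma coefficient_transl: "coefficient (transl (heis_inv y) \<eta>) \<xi> z = coefficient \<eta> \<xi> (heis_mult y z)"
  using is_adjoint_transl[of "heis_inv y"] by (simp add: coefficient_def is_adjoint_def transl_mult)

text \<open>Both sides have the matrix coefficient \<open>\<integral>\<integral> f(y) g(z) \<langle>\<eta>, \<lambda>(yz) \<xi>\<rangle> dz dy\<close>.\<close>

lemma conv_op_L1_conv:
  assumes f: "integrable lborel f" and g: "integrable lborel g"
  shows "conv_op (L1_conv f g) = conv_op f o\<^sub>L conv_op g"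
proof (rule blinfun_eqI, rule cinner_eqI)
  fix \<xi> \<eta>
  have [measurable]: "f \<in> borel_measurable borel" "g \<in> borel_measurable borel"
    using borel_measurable_integrable[OF f] borel_measurable_integrable[OF g] by simp_all
  let ?\<phi> = "coefficient \<eta> \<xi>"
  have int: "integrable (lborel \<Otimes>\<^sub>M lborel) (\<lambda>(y, x). f y * g (ldiv y x) * ?\<phi> x)"
  proof (rule Bochner_Integration.integrable_bound)
    show "integrable (lborel \<Otimes>\<^sub>M lborel) (\<lambda>(y, x). norm \<eta> * norm \<xi> * (norm (f y) * norm (g (ldiv y x))))"
    proof (rule lborel_pair.Fubini_integrable)
      have "(\<integral>x. norm (g (ldiv y x)) \<partial>lborel) = (\<integral>x. norm (g x) \<partial>lborel)" for y
        using integral_translate[of "\<lambda>x. norm (g x)"] by simp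
      then show "integrable lborel (\<lambda>y. \<integral>x. norm (case (y, x) of (y, x) \<Rightarrow>
          norm \<eta> * norm \<xi> * (norm (f y) * norm (g (ldiv y x)))) \<partial>lborel)"
        using f by (simp add: abs_mult)
      show "AE y in lborel. integrable lborel (\<lambda>x. case (y, x) of (y, x) \<Rightarrow>
          norm \<eta> * norm \<xi> * (norm (f y) * norm (g (ldiv y x))))"
        using integrable_translate[OF g] by simp
    qed measurable
    show "AE p in lborel \<Otimes>\<^sub>M lborel. norm (case p of (y, x) \<Rightarrow> f y * g (ldiv y x) * ?\<phi> x)
        \<le> norm (case p of (y, x) \<Rightarrow> norm \<eta> * norm \<xi> * (norm (f y) * norm (g (ldiv y x))))"
    proof (rule AE_I2, clarify)
      fix y x
      have "norm (f y) * norm (g (ldiv y x)) * norm (?\<phi> x)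
        \<le> norm (f y) * norm (g (ldiv y x)) * (norm \<eta> * norm \<xi>)"
        by (intro mult_left_mono norm_coefficient) simp
      then show "norm (f y * g (ldiv y x) * ?\<phi> x)
        \<le> norm (norm \<eta> * norm \<xi> * (norm (f y) * norm (g (ldiv y x))))"
        by (simp add: norm_mult abs_mult mult_ac)
    qed
  qed measurable
  have "cinner \<eta> ((conv_op f o\<^sub>L conv_op g) \<xi>) = (\<integral>y. f y * coefficient \<eta> (conv_op g \<xi>) y \<partial>lborel)"
    by (simp add: cinner_conv_op[OF f])
  also have "\<dots> = (\<integral>y. \<integral>x. f y * g (ldiv y x) * ?\<phi> x \<partial>lborel \<partial>lborel)"
  proof (rule Bochner_Integration.integral_cong[OF refl])
    fix y
    have "coefficient \<eta> (conv_op g \<xi>) y = cinner (transl (heis_inv y) \<eta>) (conv_op g \<xi>)"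
      using is_adjoint_transl[of "heis_inv y"] by (simp add: coefficient_def is_adjoint_def)
    also have "\<dots> = (\<integral>z. g z * ?\<phi> (heis_mult y z) \<partial>lborel)"
      by (simp add: cinner_conv_op[OF g] coefficient_transl)
    also have "\<dots> = (\<integral>x. g (ldiv y x) * ?\<phi> x \<partial>lborel)"
      using integral_translate[of "\<lambda>x. g x * ?\<phi> (heis_mult y x)" "heis_inv y"] by simp
    finally have "f y * coefficient \<eta> (conv_op g \<xi>) y = f y * (\<integral>x. g (ldiv y x) * ?\<phi> x \<partial>lborel)"
      by simp
    also have "\<dots> = (\<integral>x. f y * (g (ldiv y x) * ?\<phi> x) \<partial>lborel)" by (rule integral_mult_right_zero[symmetric])
    finally show "f y * coefficient \<eta> (conv_op g \<xi>) y = (\<integral>x. f y * g (ldiv y x) * ?\<phi> x \<partial>lborel)"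
      by (simp only: mult.assoc)
  qed
  also have "\<dots> = (\<integral>x. \<integral>y. f y * g (ldiv y x) * ?\<phi> x \<partial>lborel \<partial>lborel)"
    using lborel_pair.Fubini_integral[of "\<lambda>y x. f y * g (ldiv y x) * ?\<phi> x"] int by simp
  also have "\<dots> = (\<integral>x. L1_conv f g x * ?\<phi> x \<partial>lborel)"
    by (simp add: L1_conv_def)
  finally show "cinner \<eta> (conv_op (L1_conv f g) \<xi>) = cinner \<eta> ((conv_op f o\<^sub>L conv_op g) \<xi>)"
    by (simp add: cinner_conv_op[OF integrable_conv[OF f g]])
qed

lemma is_adjoint_conv_op:
  assumes f: "integrable lborel f"
  shows "is_adjoint (conv_op f) (conv_op (L1_invol f))"
  unfolding is_adjoint_def
proof (intro allI)
  fix \<xi> \<eta>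
  have [measurable]: "f \<in> borel_measurable borel" using borel_measurable_integrable[OF f] by simp
  have c: "cnj (coefficient \<eta> \<xi> y) = coefficient \<xi> \<eta> (heis_inv y)" for y
    using is_adjoint_transl[of y] cinner_commute[of "transl y \<xi>" \<eta>] by (simp add: coefficient_def is_adjoint_def)
  have "cinner (conv_op f \<xi>) \<eta> = cnj (\<integral>y. f y * coefficient \<eta> \<xi> y \<partial>lborel)"
    by (subst cinner_commute) (simp add: cinner_conv_op[OF f])
  also have "\<dots> = (\<integral>y. cnj (f y) * coefficient \<xi> \<eta> (heis_inv y) \<partial>lborel)"
    by (subst Bochner_Integration.integral_cnj[symmetric]) (simp only: complex_cnj_mult c)
  also have "\<dots> = (\<integral>y. L1_invol f y * coefficient \<xi> \<eta> y \<partial>lborel)"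
  proof -
    have "(\<lambda>y. coefficient \<xi> \<eta> (heis_inv y)) \<in> borel_measurable borel"
      by (rule measurable_compose[OF heis_inv_measurable coefficient_measurable])
    moreover have "(\<lambda>y. cnj (f y)) \<in> borel_measurable borel"
      by (rule borel_measurable_continuous_on[of cnj]) (intro continuous_intros, simp)
    ultimately have "(\<lambda>y. cnj (f y) * coefficient \<xi> \<eta> (heis_inv y)) \<in> borel_measurable borel"
      by (intro borel_measurable_times)
    from integral_measure_scaling[OF measure_scaling_heis_inv this] show ?thesis by (simp add: L1_invol_def)
  qed
  also have "\<dots> = cinner \<xi> (conv_op (L1_invol f) \<eta>)"
    by (simp add: cinner_conv_op[OF integrable_invol[OF f]])
  finally show "cinner (conv_op f \<xi>) \<eta> = cinner \<xi> (conv_op (L1_invol f) \<eta>)" .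
qed

lemma L1_star_rep_conv_op: "L1_star_rep conv_op"
  unfolding L1_star_rep_def
proof (intro allI impI conjI)
  fix f :: "heis \<Rightarrow> complex" assume f: "integrable lborel f"
  have bd: "integrable lborel (\<lambda>y. f y * coefficient \<eta> \<xi> y)" if f: "integrable lborel f" for f \<eta> \<xi>
  proof (rule Bochner_Integration.integrable_bound)
    show "integrable lborel (\<lambda>y. norm \<eta> * norm \<xi> * norm (f y))" using f by simp
    have [measurable]: "f \<in> borel_measurable borel" using borel_measurable_integrable[OF f] by simp
    show "(\<lambda>y. f y * coefficient \<eta> \<xi> y) \<in> borel_measurable lborel" by measurable
    show "AE y in lborel. norm (f y * coefficient \<eta> \<xi> y) \<le> norm (norm \<eta> * norm \<xi> * norm (f y))"
      by (rule AE_I2) (simp add: norm_mult abs_mult mult.commute[of "cmod (f _)"] mult_right_mono norm_coefficient)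
  qed
  show "bop (conv_op f)" unfolding conv_op_def by (rule bop_kernel_op[OF dominated_kernel_conv[OF f]])
  show "norm (conv_op f) \<le> (\<integral>x. norm (f x) \<partial>lborel)"
    unfolding conv_op_def by (rule norm_kernel_op[OF dominated_kernel_conv[OF f]])
  show "conv_op (\<lambda>x. c * f x) \<xi> = c *\<^sub>C conv_op f \<xi>" for c \<xi>
    using f by (intro cinner_eqI) (simp add: cinner_conv_op cinner_scaleC_right mult.assoc)
  show "is_adjoint (conv_op f) (conv_op (L1_invol f))" by (rule is_adjoint_conv_op[OF f])
  fix g :: "heis \<Rightarrow> complex" assume g: "integrable lborel g"
  show "conv_op (\<lambda>x. f x + g x) = conv_op f + conv_op g"
    using f g bd[OF f] bd[OF g]
    by (intro blinfun_eqI cinner_eqI) (simp add: cinner_conv_op blinfun.add_left cinner_add_right distrib_right)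
  show "conv_op (L1_conv f g) = conv_op f o\<^sub>L conv_op g" by (rule conv_op_L1_conv[OF f g])
qed

lemma rep_apply_left_regular: "rep_apply left_regular f = conv_op f"
proof -
  have "left_regular = Abs_L1_rep conv_op"
    unfolding left_regular_def conv_op_def[abs_def] kernel_op_def left_conv_def[abs_def] mat_vector_mult ..
  then show ?thesis by (metis Abs_L1_rep_inverse L1_star_rep_conv_op mem_Collect_eq)
qed

section \<open>Density of the continuous functions of compact support\<close>

definition cont_supp :: "(heis \<Rightarrow> 'b::euclidean_space) \<Rightarrow> bool" where
  "cont_supp g \<longleftrightarrow> continuous_on UNIV g \<and> (\<exists>R. \<forall>x. g x \<noteq> 0 \<longrightarrow> norm x \<le> R)"

lemma cont_supp_measurable: "cont_supp g \<Longrightarrow> g \<in> borel_measurable borel"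
  unfolding cont_supp_def by (intro borel_measurable_continuous_onI) simp

lemma integrable_bounded_support:
  fixes h :: "heis \<Rightarrow> 'b::euclidean_space"
  assumes "h \<in> borel_measurable borel" "\<And>x. norm (h x) \<le> B" "\<And>x. h x \<noteq> 0 \<Longrightarrow> norm x \<le> R"
  shows "integrable lborel h"
proof (rule Bochner_Integration.integrable_bound)
  have "emeasure lborel (cball (0 :: heis) R) < \<infinity>" by (rule emeasure_lborel_cball_finite)
  then show "integrable lborel (\<lambda>x. B * indicator (cball (0 :: heis) R) x)" by simp
  show "AE x in lborel. norm (h x) \<le> norm (B * indicator (cball 0 R) x)"
  proof (rule AE_I2)
    fix x show "norm (h x) \<le> norm (B * indicator (cball 0 R) x)"
      using assms(2)[of x] assms(3)[of x] by (cases "h x = 0") (auto split: split_indicator)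
  qed
qed (use assms in simp)

lemma cont_supp_bounded:
  assumes "cont_supp g" obtains B R where "0 \<le> B" "0 \<le> R" "\<And>x. norm (g x) \<le> B" "\<And>x. g x \<noteq> 0 \<Longrightarrow> norm x \<le> R"
proof -
  from assms obtain R where g: "continuous_on UNIV g" and R: "\<And>x. g x \<noteq> 0 \<Longrightarrow> norm x \<le> R"
    by (auto simp: cont_supp_def)
  have "compact (g ` cball 0 \<bar>R\<bar>)"
    by (intro compact_continuous_image continuous_on_subset[OF g]) simp_all
  from compact_imp_bounded[OF this] obtain B where "\<forall>y\<in>g ` cball 0 \<bar>R\<bar>. norm y \<le> B"
    unfolding bounded_iff by blast
  then have B: "norm x \<le> \<bar>R\<bar> \<Longrightarrow> norm (g x) \<le> B" for x by simp
  have "norm (g x) \<le> \<bar>B\<bar>" for x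
  proof (cases "g x = 0")
    case False
    from R[OF this] have "norm x \<le> \<bar>R\<bar>" by linarith
    from B[OF this] show ?thesis by linarith
  qed simp
  then show thesis using R that[of "\<bar>B\<bar>" "\<bar>R\<bar>"] by force
qed

lemma integrable_cont_supp_power:
  fixes g :: "heis \<Rightarrow> 'b::euclidean_space"
  assumes "cont_supp g" "0 < p" shows "integrable lborel (\<lambda>x. norm (g x) ^ p)"
proof -
  obtain B R where "\<And>x. norm (g x) \<le> B" "\<And>x. g x \<noteq> 0 \<Longrightarrow> norm x \<le> R"
    using cont_supp_bounded[OF assms(1)] by metis
  then show ?thesis
    using cont_supp_measurable[OF assms(1)] assms(2)
    by (intro integrable_bounded_support[of _ "B ^ p" R]) (auto intro: power_mono)
qed

lemma integrable_cont_supp: "cont_supp g \<Longrightarrow> integrable lborel g"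
  using cont_supp_bounded cont_supp_measurable integrable_bounded_support by metis

lemma norm_power_diff_le:
  fixes u v w :: "'b::real_normed_vector"
  shows "norm (u - w) ^ p \<le> 2 ^ p * (norm (u - v) ^ p + norm (v - w) ^ p)"
proof -
  have "norm (u - w) \<le> 2 * max (norm (u - v)) (norm (v - w))"
    using norm_triangle_ineq[of "u - v" "v - w"] by simp
  from power_mono[OF this norm_ge_zero]
  have "norm (u - w) ^ p \<le> (2 * max (norm (u - v)) (norm (v - w))) ^ p" .
  also have "\<dots> = 2 ^ p * max (norm (u - v)) (norm (v - w)) ^ p" by (simp add: power_mult_distrib)
  also have "max (norm (u - v)) (norm (v - w)) ^ p \<le> norm (u - v) ^ p + norm (v - w) ^ p"
    by (auto simp: max_def)
  finally show ?thesis by simp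
qed

text \<open>A measurable function is almost everywhere a pointwise limit of continuous functions. Truncating these in
  size and in support makes the convergence dominated.\<close>

lemma cont_supp_dense_bounded:
  fixes f :: "heis \<Rightarrow> 'b::euclidean_space"
  assumes f [measurable]: "f \<in> borel_measurable borel" and B: "\<And>x. norm (f x) \<le> B" and R: "\<And>x. f x \<noteq> 0 \<Longrightarrow> norm x \<le> R"
    and p: "0 < p" and \<epsilon>: "0 < \<epsilon>"
  shows "\<exists>g. cont_supp g \<and> (\<integral>x. norm (f x - g x) ^ p \<partial>lborel) \<le> \<epsilon>"
proof -
  have "f \<in> borel_measurable (lebesgue_on UNIV)"
    by (simp add: lebesgue_on_UNIV_eq measurable_completion)
  then have "f measurable_on UNIV" by (intro lebesgue_measurable_imp_measurable_on) simp_all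
  then obtain N g where N: "negligible N" and g: "\<And>n. continuous_on UNIV (g n)"
    and lim: "\<And>x. x \<notin> N \<Longrightarrow> (\<lambda>n. g n x) \<longlonglongrightarrow> f x"
    unfolding measurable_on_def by auto
  define M where "M = max B 1"
  have M: "0 < M" "\<And>x. norm (f x) \<le> M" using B by (auto simp: M_def max.coboundedI1)
  \<comment> \<open>Radial retraction onto the ball of radius \<open>M\<close>, which fixes the values of \<open>f\<close>.\<close>
  define clip where "clip v = (M / max M (norm v)) *\<^sub>R v" for v :: 'b
  \<comment> \<open>Continuous cut-off that is 1 on the support of \<open>f\<close>.\<close>
  define \<kappa> where "\<kappa> x = max 0 (min 1 (R + 1 - norm x))" for x :: heis
  define h where "h n x = \<kappa> x *\<^sub>R clip (g n x)" for n x
  have cont_clip: "continuous_on UNIV clip"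
    unfolding clip_def using M by (intro continuous_intros) auto
  have clip_le: "norm (clip v) \<le> M" for v
    using M mult_left_mono[of "norm v" "max M (norm v)" M] by (simp add: clip_def divide_simps)
  have \<kappa>: "0 \<le> \<kappa> x" "\<kappa> x \<le> 1" for x by (auto simp: \<kappa>_def)
  have cont_h: "continuous_on UNIV (h n)" for n
    unfolding h_def \<kappa>_def
    by (intro continuous_intros continuous_on_compose2[OF cont_clip g]) simp_all
  have [measurable]: "h n \<in> borel_measurable borel" for n by (intro borel_measurable_continuous_onI cont_h)
  have h_supp: "norm x \<le> R + 1" if "h n x \<noteq> 0" for n x
    using that by (auto simp: h_def \<kappa>_def max_def min_def split: if_splits)
  have h_le: "norm (h n x) \<le> M" for n x
    using mult_mono[OF \<kappa>(2)[of x] clip_le[of "g n x"]] \<kappa>[of x] by (simp add: h_def)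
  have h_lim: "(\<lambda>n. h n x) \<longlonglongrightarrow> f x" if "x \<notin> N" for x
  proof -
    have "(\<lambda>n. clip (g n x)) \<longlonglongrightarrow> clip (f x)"
      by (rule continuous_on_tendsto_compose[OF cont_clip lim[OF that]]) simp_all
    then have "(\<lambda>n. h n x) \<longlonglongrightarrow> \<kappa> x *\<^sub>R clip (f x)" unfolding h_def by (intro tendsto_intros)
    moreover have "clip (f x) = f x" using M(1) max_absorb1[OF M(2), of x] by (simp add: clip_def)
    moreover have "\<kappa> x *\<^sub>R f x = f x"
      using R[of x] by (cases "f x = 0") (auto simp: \<kappa>_def)
    ultimately show ?thesis by simp
  qed
  have "(\<lambda>n. \<integral>x. norm (f x - h n x) ^ p \<partial>lborel) \<longlonglongrightarrow> (\<integral>x. 0 \<partial>(lborel :: heis measure))"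
  proof (rule integral_dominated_convergence[where w = "\<lambda>x. (2 * M) ^ p * indicator (cball 0 (R + 1)) x"])
    have "emeasure lborel (cball (0 :: heis) (R + 1)) < \<infinity>" by (rule emeasure_lborel_cball_finite)
    then show "integrable lborel (\<lambda>x :: heis. (2 * M) ^ p * indicator (cball 0 (R + 1)) x)" by simp
    have "N \<in> null_sets lebesgue" using N by (simp add: negligible_iff_null_sets)
    then have "AE x in lebesgue. x \<notin> N" by (rule AE_not_in)
    then have "AE x in lborel. x \<notin> N" by (simp add: AE_completion_iff)
    then show "AE x in lborel. (\<lambda>n. norm (f x - h n x) ^ p) \<longlonglongrightarrow> 0"
    proof eventually_elim
      case (elim x)
      have "(\<lambda>n. norm (f x - h n x) ^ p) \<longlonglongrightarrow> norm (f x - f x) ^ p"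
        by (intro tendsto_intros h_lim elim)
      then show ?case by (simp only: diff_self norm_zero zero_power[OF p])
    qed
    show "AE x in lborel. norm (norm (f x - h n x) ^ p) \<le> (2 * M) ^ p * indicator (cball 0 (R + 1)) x" for n
    proof (rule AE_I2)
      fix x
      show "norm (norm (f x - h n x) ^ p) \<le> (2 * M) ^ p * indicator (cball 0 (R + 1)) x"
      proof (cases "x \<in> cball 0 (R + 1)")
        case True
        have "norm (f x - h n x) \<le> 2 * M"
          using norm_triangle_ineq4[of "f x" "h n x"] M(2)[of x] h_le[of n x] by linarith
        from power_mono[OF this norm_ge_zero, of p] show ?thesis using True by simp
      next
        case False
        then have "f x = 0" "h n x = 0" using R[of x] h_supp[of n x] by force+
        then show ?thesis using False by (simp add: zero_power[OF p])
      qed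
    qed
  qed measurable
  then have "\<forall>\<^sub>F n in sequentially. (\<integral>x. norm (f x - h n x) ^ p \<partial>lborel) < \<epsilon>"
    using \<epsilon> by (intro order_tendstoD) simp_all
  then obtain n where n: "(\<integral>x. norm (f x - h n x) ^ p \<partial>lborel) < \<epsilon>"
    by (meson eventually_happens sequentially_bot)
  have "cont_supp (h n)" using cont_h h_supp unfolding cont_supp_def by blast
  with n show ?thesis by (intro exI[of _ "h n"]) simp
qed

lemma cont_supp_dense:
  fixes f :: "heis \<Rightarrow> 'b::euclidean_space"
  assumes f [measurable]: "f \<in> borel_measurable borel" and int: "integrable lborel (\<lambda>x. norm (f x) ^ p)"
    and p: "0 < p" and \<epsilon>: "0 < \<epsilon>"
  shows "\<exists>g. cont_supp g \<and> (\<integral>x. norm (f x - g x) ^ p \<partial>lborel) \<le> \<epsilon>"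
proof -
  \<comment> \<open>\<open>2 ^ p\<close> is the constant in the triangle inequality for \<open>p\<close>-th powers.\<close>
  define \<delta> where "\<delta> = \<epsilon> / (2 * 2 ^ p)"
  have \<delta>: "0 < \<delta>" using \<epsilon> by (simp add: \<delta>_def)
  define F where "F n x = (if norm (f x) \<le> real n \<and> norm x \<le> real n then f x else 0)" for n x
  have [measurable]: "F n \<in> borel_measurable borel" for n unfolding F_def by measurable
  have "(\<lambda>n. \<integral>x. norm (f x - F n x) ^ p \<partial>lborel) \<longlonglongrightarrow> (\<integral>x. 0 \<partial>(lborel :: heis measure))"
  proof (rule integral_dominated_convergence[where w = "\<lambda>x. norm (f x) ^ p"])
    show "AE x in lborel. (\<lambda>n. norm (f x - F n x) ^ p) \<longlonglongrightarrow> 0"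
    proof (rule AE_I2)
      fix x
      obtain N where N: "max (norm (f x)) (norm x) \<le> real N" using real_arch_simple by blast
      have "\<forall>\<^sub>F n in sequentially. norm (f x - F n x) ^ p = 0"
        using p N by (intro eventually_mono[OF eventually_ge_at_top[of N]]) (auto simp: F_def)
      then show "(\<lambda>n. norm (f x - F n x) ^ p) \<longlonglongrightarrow> 0" by (rule tendsto_eventually)
    qed
    show "AE x in lborel. norm (norm (f x - F n x) ^ p) \<le> norm (f x) ^ p" for n
      using p by (intro AE_I2) (simp add: F_def)
  qed (use int in measurable)
  then have "\<forall>\<^sub>F n in sequentially. (\<integral>x. norm (f x - F n x) ^ p \<partial>lborel) < \<delta>"
    using \<delta> by (intro order_tendstoD) simp_all
  then obtain n where n: "(\<integral>x. norm (f x - F n x) ^ p \<partial>lborel) < \<delta>"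
    by (meson eventually_happens sequentially_bot)
  have F_le: "norm (F n x) \<le> real n" and F_supp: "F n x \<noteq> 0 \<Longrightarrow> norm x \<le> real n" for x
    by (simp_all add: F_def split: if_splits)
  from cont_supp_dense_bounded[of "F n", OF _ F_le F_supp p \<delta>]
  obtain g where g: "cont_supp g" and gF: "(\<integral>x. norm (F n x - g x) ^ p \<partial>lborel) \<le> \<delta>" by auto
  have [measurable]: "g \<in> borel_measurable borel" by (rule cont_supp_measurable[OF g])
  have F_int: "integrable lborel (\<lambda>x. norm (f x - F n x) ^ p)"
    by (rule Bochner_Integration.integrable_bound[OF int]) (use p in \<open>auto simp: F_def\<close>)
  have g_int: "integrable lborel (\<lambda>x. norm (F n x - g x) ^ p)"
  proof -
    obtain B R where "\<And>x. norm (g x) \<le> B" and R: "\<And>x. g x \<noteq> 0 \<Longrightarrow> norm x \<le> R"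
      using cont_supp_bounded[OF g] by metis
    then have "norm (F n x - g x) \<le> real n + B" for x
      using norm_triangle_ineq4[of "F n x" "g x"] F_le[of x] by (smt (verit))
    moreover have "norm x \<le> max R (real n)" if "norm (F n x - g x) ^ p \<noteq> 0" for x
      using that p R[of x] F_supp[of x] by (cases "g x = 0") auto
    ultimately show ?thesis
      by (intro integrable_bounded_support[of _ "(real n + B) ^ p" "max R (real n)"]) (auto intro: power_mono)
  qed
  have fg_int: "integrable lborel (\<lambda>x. norm (f x - g x) ^ p)"
  proof (rule Bochner_Integration.integrable_bound)
    show "integrable lborel (\<lambda>x. 2 ^ p * (norm (f x - F n x) ^ p + norm (F n x - g x) ^ p))"
      using F_int g_int by simp
    show "AE x in lborel. norm (norm (f x - g x) ^ p) \<le> norm (2 ^ p * (norm (f x - F n x) ^ p + norm (F n x - g x) ^ p))"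
      using norm_power_diff_le[of "f _" "g _" p "F n _"] by (intro AE_I2) simp
  qed measurable
  have "(\<integral>x. norm (f x - g x) ^ p \<partial>lborel) \<le> (\<integral>x. 2 ^ p * (norm (f x - F n x) ^ p + norm (F n x - g x) ^ p) \<partial>lborel)"
    using fg_int F_int g_int by (intro integral_mono norm_power_diff_le) simp_all
  also have "\<dots> = 2 ^ p * ((\<integral>x. norm (f x - F n x) ^ p \<partial>lborel) + (\<integral>x. norm (F n x - g x) ^ p \<partial>lborel))"
    using F_int g_int by simp
  also have "\<dots> \<le> 2 ^ p * (\<delta> + \<delta>)" using n gF by (intro mult_left_mono add_mono) simp_all
  also have "\<dots> = \<epsilon>" by (simp add: \<delta>_def)
  finally show ?thesis using g by blast
qed

lemma cont_supp_dense_L1: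
  fixes f :: "heis \<Rightarrow> complex"
  assumes "integrable lborel f" "0 < \<epsilon>"
  shows "\<exists>g. cont_supp g \<and> (\<integral>x. norm (f x - g x) \<partial>lborel) \<le> \<epsilon>"
  using cont_supp_dense[of f 1 \<epsilon>] borel_measurable_integrable[OF assms(1)] assms by simp

lemma square_integrable_cont_supp: "cont_supp g \<Longrightarrow> square_integrable g"
  using integrable_cont_supp_power[of g 2] cont_supp_measurable[of g] by (simp add: square_integrable_def)

lemma cont_supp_dense_L2:
  assumes "0 < \<epsilon>"
  shows "\<exists>g. cont_supp g \<and> norm (\<xi> - abs_L2_heis g) \<le> \<epsilon>"
proof -
  obtain g where g: "cont_supp g" and le: "(\<integral>x. norm (rep \<xi> x - g x) ^ 2 \<partial>lborel) \<le> \<epsilon>\<^sup>2"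
    using cont_supp_dense[of "rep \<xi>" 2 "\<epsilon>\<^sup>2"] square_integrable_rep[of \<xi>] assms
    by (auto simp: square_integrable_def)
  note sq = square_integrable_cont_supp[OF g]
  have "\<xi> - abs_L2_heis g = abs_L2_heis (\<lambda>x. rep \<xi> x - g x)"
    using minus_abs_L2_heis[OF square_integrable_rep sq, of \<xi>] by simp
  then have "(norm (\<xi> - abs_L2_heis g))\<^sup>2 \<le> \<epsilon>\<^sup>2"
    using le norm_abs_L2_heis[OF square_integrable_diff[OF square_integrable_rep sq], of \<xi>] by simp
  then have "norm (\<xi> - abs_L2_heis g) \<le> \<epsilon>" by (rule power2_le_imp_le) (use assms in simp)
  with g show ?thesis by blast
qed

lemma rep_apply_diff_le:
  assumes f: "integrable lborel f" and g: "integrable lborel g"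
  shows "norm (rep_apply \<sigma> f - rep_apply \<sigma> g) \<le> (\<integral>x. norm (f x - g x) \<partial>lborel)"
proof -
  have "rep_apply \<sigma> (\<lambda>x. (f x - g x) + g x) = rep_apply \<sigma> (\<lambda>x. f x - g x) + rep_apply \<sigma> g"
    by (rule rep_apply_add) (use f g in simp_all)
  then have "rep_apply \<sigma> f - rep_apply \<sigma> g = rep_apply \<sigma> (\<lambda>x. f x - g x)" by simp
  then show ?thesis using norm_rep_apply[of "\<lambda>x. f x - g x" \<sigma>] f g by simp
qed

lemma cont_supp_dense_cstar:
  assumes "0 < \<epsilon>"
  shows "\<exists>g. cont_supp g \<and> (\<forall>\<sigma>. norm (cstar_apply a \<sigma> - rep_apply \<sigma> g) \<le> \<epsilon>)"
proof -
  have e: "0 < \<epsilon> / 2" using assms by simp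
  obtain f where f: "integrable lborel f" "\<And>\<sigma>. norm (cstar_apply a \<sigma> - rep_apply \<sigma> f) \<le> \<epsilon> / 2"
    using cstar_carrierD[OF cstar_apply e] by blast
  obtain g where g: "cont_supp g" "(\<integral>x. norm (f x - g x) \<partial>lborel) \<le> \<epsilon> / 2"
    using cont_supp_dense_L1[OF f(1) e] by blast
  have "norm (cstar_apply a \<sigma> - rep_apply \<sigma> g) \<le> \<epsilon>" for \<sigma>
    using norm_triangle_ineq[of "cstar_apply a \<sigma> - rep_apply \<sigma> f" "rep_apply \<sigma> f - rep_apply \<sigma> g"]
      f(2)[of \<sigma>] g(2) rep_apply_diff_le[OF f(1) integrable_cont_supp[OF g(1)], of \<sigma>] by simp
  with g(1) show ?thesis by blast
qed

section \<open>Continuity of the dilations\<close>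

lemma norm_heis_bounds: "\<bar>fst x\<bar> \<le> norm x" "\<bar>fst (snd x)\<bar> \<le> norm x" "\<bar>snd (snd x)\<bar> \<le> norm x" for x :: heis
  using norm_fst_le[of "fst x" "snd x"] norm_snd_le[of "snd x" "fst x"]
    norm_fst_le[of "fst (snd x)" "snd (snd x)"] norm_snd_le[of "snd (snd x)" "fst (snd x)"]
  by simp_all

lemma norm_heis_le: "norm (a, b, c) \<le> \<bar>a\<bar> + \<bar>b\<bar> + \<bar>c :: real\<bar>" for a b :: real
  using norm_Pair_le[of a "(b, c)"] norm_Pair_le[of b c] by simp

lemma norm_heis_dil_le:
  assumes "0 \<le> t" "norm x \<le> R" shows "norm (heis_dil t x) \<le> (2 * t + t\<^sup>2) * R"
proof -
  have "norm (heis_dil t x) \<le> \<bar>t * fst x\<bar> + \<bar>t * fst (snd x)\<bar> + \<bar>t\<^sup>2 * snd (snd x)\<bar>"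
    using norm_heis_le[of "t * fst x" "t * fst (snd x)" "t\<^sup>2 * snd (snd x)"]
    by (simp add: heis_dil_def case_prod_beta)
  also have "\<dots> \<le> t * R + t * R + t\<^sup>2 * R"
    using norm_heis_bounds[of x] assms unfolding abs_mult
    by (intro add_mono mult_mono) simp_all
  finally show ?thesis by (simp add: algebra_simps)
qed

lemma heis_dil_compose: "heis_dil s (heis_dil t x) = heis_dil (s * t) x"
  by (cases x) (simp add: heis_dil_def power_mult_distrib mult.assoc)

lemma heis_dil_1 [simp]: "heis_dil 1 = (\<lambda>x. x)"
  by (auto simp: heis_dil_def)

text \<open>The case \<open>p = 1\<close>, \<open>c(t) = t\<^sup>-\<^sup>4\<close> is the action on \<open>L\<^sup>1\<close> and the case \<open>p = 2\<close>, \<open>c(t) = t\<^sup>-\<^sup>2\<close> the one on \<open>L\<^sup>2\<close>. As the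
  \<open>t\<^sub>n\<close> are bounded, all the dilated functions are supported in one ball.\<close>

lemma dilation_tendsto:
  fixes g :: "heis \<Rightarrow> 'b::euclidean_space"
  assumes g: "cont_supp g" and p: "0 < p" and t: "t \<longlonglongrightarrow> s" "\<And>n. 0 < t n" "0 < s"
    and c: "(\<lambda>n. c (t n)) \<longlonglongrightarrow> c s"
  shows "(\<lambda>n. \<integral>x. norm (c (t n) *\<^sub>R g (heis_dil (inverse (t n)) x) - c s *\<^sub>R g (heis_dil (inverse s) x)) ^ p \<partial>lborel) \<longlonglongrightarrow> 0"
proof -
  have [measurable]: "g \<in> borel_measurable borel" by (rule cont_supp_measurable[OF g])
  have cont: "continuous_on UNIV g" using g by (simp add: cont_supp_def)
  obtain B R where BR: "0 \<le> B" "0 \<le> R" "\<And>x. norm (g x) \<le> B" "\<And>x. g x \<noteq> 0 \<Longrightarrow> norm x \<le> R"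
    using cont_supp_bounded[OF g] by metis
  obtain T where T: "\<And>n. t n \<le> T" "s \<le> T"
  proof -
    obtain K where K: "\<And>n. norm (t n) \<le> K" using convergent_imp_Bseq[of t] t(1) by (auto simp: convergent_def Bseq_def)
    then show thesis using that[of "max K s"] by (force simp: abs_le_iff max.coboundedI1)
  qed
  obtain C where C: "\<And>n. \<bar>c (t n)\<bar> \<le> C" "\<bar>c s\<bar> \<le> C"
  proof -
    obtain K where K: "\<And>n. norm (c (t n)) \<le> K"
      using convergent_imp_Bseq[of "\<lambda>n. c (t n)"] c by (auto simp: convergent_def Bseq_def)
    then show thesis using that[of "max K \<bar>c s\<bar>"] by (force simp: max.coboundedI1)
  qed
  define M where "M = (2 * T + T\<^sup>2) * R"
  have supp: "norm x \<le> M" if "g (heis_dil (inverse r) x) \<noteq> 0" "0 < r" "r \<le> T" for r x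
  proof -
    have "x = heis_dil r (heis_dil (inverse r) x)" using that by (simp add: heis_dil_compose)
    then have "norm x \<le> (2 * r + r\<^sup>2) * R" using norm_heis_dil_le[of r] BR(4)[OF that(1)] that by (metis less_imp_le)
    also have "\<dots> \<le> M" unfolding M_def using that BR(2) by (intro mult_right_mono add_mono power_mono) simp_all
    finally show ?thesis .
  qed
  have "(\<lambda>n. \<integral>x. norm (c (t n) *\<^sub>R g (heis_dil (inverse (t n)) x) - c s *\<^sub>R g (heis_dil (inverse s) x)) ^ p \<partial>lborel)
      \<longlonglongrightarrow> (\<integral>x. 0 \<partial>(lborel :: heis measure))"
  proof (rule integral_dominated_convergence[where w = "\<lambda>x. (2 * (C * B)) ^ p * indicator (cball 0 M) x"])
    have "emeasure lborel (cball (0 :: heis) M) < \<infinity>" by (rule emeasure_lborel_cball_finite)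
    then show "integrable lborel (\<lambda>x :: heis. (2 * (C * B)) ^ p * indicator (cball 0 M) x)" by simp
    show "AE x in lborel. (\<lambda>n. norm (c (t n) *\<^sub>R g (heis_dil (inverse (t n)) x) - c s *\<^sub>R g (heis_dil (inverse s) x)) ^ p) \<longlonglongrightarrow> 0"
    proof (rule AE_I2)
      fix x :: heis
      obtain x1 x2 x3 where x: "x = (x1, x2, x3)" by (cases x)
      have "(\<lambda>n. heis_dil (inverse (t n)) x) \<longlonglongrightarrow> heis_dil (inverse s) x"
        unfolding heis_dil_def x prod.case using t by (intro tendsto_intros) simp_all
      then have "(\<lambda>n. g (heis_dil (inverse (t n)) x)) \<longlonglongrightarrow> g (heis_dil (inverse s) x)"
        by (rule continuous_on_tendsto_compose[OF cont]) simp_all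
      then have "(\<lambda>n. norm (c (t n) *\<^sub>R g (heis_dil (inverse (t n)) x) - c s *\<^sub>R g (heis_dil (inverse s) x)) ^ p)
         \<longlonglongrightarrow> norm (c s *\<^sub>R g (heis_dil (inverse s) x) - c s *\<^sub>R g (heis_dil (inverse s) x)) ^ p"
        by (intro tendsto_intros c)
      then show "(\<lambda>n. norm (c (t n) *\<^sub>R g (heis_dil (inverse (t n)) x) - c s *\<^sub>R g (heis_dil (inverse s) x)) ^ p) \<longlonglongrightarrow> 0"
        by (simp only: diff_self norm_zero zero_power[OF p])
    qed
    show "AE x in lborel. norm (norm (c (t n) *\<^sub>R g (heis_dil (inverse (t n)) x) - c s *\<^sub>R g (heis_dil (inverse s) x)) ^ p)
        \<le> (2 * (C * B)) ^ p * indicator (cball 0 M) x" for n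
    proof (rule AE_I2)
      fix x
      show "norm (norm (c (t n) *\<^sub>R g (heis_dil (inverse (t n)) x) - c s *\<^sub>R g (heis_dil (inverse s) x)) ^ p)
        \<le> (2 * (C * B)) ^ p * indicator (cball 0 M) x"
      proof (cases "x \<in> cball 0 M")
        case True
        have "norm (c (t n) *\<^sub>R g (heis_dil (inverse (t n)) x)) \<le> C * B" "norm (c s *\<^sub>R g (heis_dil (inverse s) x)) \<le> C * B"
          using C BR unfolding norm_scaleR by (intro mult_mono, auto intro: order_trans[OF abs_ge_zero])+
        then have "norm (c (t n) *\<^sub>R g (heis_dil (inverse (t n)) x) - c s *\<^sub>R g (heis_dil (inverse s) x)) \<le> 2 * (C * B)"
          by (smt (verit) norm_triangle_ineq4)
        from power_mono[OF this norm_ge_zero, of p] show ?thesis using True by simp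
      next
        case False
        then have "g (heis_dil (inverse (t n)) x) = 0" "g (heis_dil (inverse s) x) = 0"
          using supp[of "t n" x] supp[of s x] t T by (auto simp: dist_norm)
        then show ?thesis using False by (simp add: zero_power[OF p])
      qed
    qed
  qed measurable
  then show ?thesis by simp
qed

section \<open>Compactness of weighted convolution operators\<close>

lemma heis_inv_cancel_right [simp]: "heis_mult z (heis_mult (heis_inv x) x) = z"
  by (cases x; cases z) (simp add: heis_mult_def heis_inv_def algebra_simps)

text \<open>In a complete space compactness of the closure is total boundedness, which passes to sets that are
  approximated by compact ones.\<close>

lemma compact_closureI:
  fixes S :: "'a::banach set"
  assumes "\<And>\<epsilon>. 0 < \<epsilon> \<Longrightarrow> \<exists>K. compact K \<and> (\<forall>s\<in>S. \<exists>k\<in>K. norm (s - k) \<le> \<epsilon>)"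
  shows "compact (closure S)"
  unfolding compact_eq_totally_bounded
proof (intro conjI allI impI)
  show "complete (closure S)" by (simp add: complete_eq_closed)
  fix e :: real assume e: "0 < e"
  then have e4: "0 < e / 4" by simp
  obtain K where K: "compact K" "\<And>s. s \<in> S \<Longrightarrow> \<exists>k\<in>K. norm (s - k) \<le> e / 4" using assms[OF e4] by blast
  obtain F where F: "finite F" "K \<subseteq> (\<Union>x\<in>F. ball x (e / 4))"
    using K(1) e4 unfolding compact_eq_totally_bounded by blast
  have "closure S \<subseteq> (\<Union>x\<in>F. ball x e)"
  proof
    fix y assume "y \<in> closure S"
    then obtain s where s: "s \<in> S" "dist s y < e / 4" using e4 unfolding closure_approachable by blast
    obtain k where k: "k \<in> K" "norm (s - k) \<le> e / 4" using K(2)[OF s(1)] by blast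
    obtain x where x: "x \<in> F" "dist x k < e / 4" using F(2) k(1) by fastforce
    have "dist x y \<le> dist x k + (dist s k + dist s y)"
      by (metis add.commute add_left_mono dist_commute dist_triangle order_trans)
    also have "\<dots> < e" using s(2) k(2) x(2) e by (simp add: dist_norm)
    finally show "y \<in> (\<Union>x\<in>F. ball x e)" using x(1) by auto
  qed
  with F(1) show "\<exists>F. finite F \<and> closure S \<subseteq> (\<Union>x\<in>F. ball x e)" by blast
qed

lemma compact_op_approx:
  fixes T :: "'h::chilbert_space \<Rightarrow>\<^sub>L 'h"
  assumes "\<And>\<epsilon>. 0 < \<epsilon> \<Longrightarrow> \<exists>T'. compact_op T' \<and> norm (T - T') \<le> \<epsilon>"
  shows "compact_op T"
  unfolding compact_op_def
proof (rule compact_closureI)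
  fix \<epsilon> :: real assume "0 < \<epsilon>"
  then obtain T' where T': "compact_op T'" "norm (T - T') \<le> \<epsilon>" using assms by blast
  show "\<exists>K. compact K \<and> (\<forall>s\<in>blinfun_apply T ` cball 0 1. \<exists>k\<in>K. norm (s - k) \<le> \<epsilon>)"
  proof (intro exI conjI ballI)
    show "compact (closure (blinfun_apply T' ` cball 0 1))" using T'(1) by (simp add: compact_op_def)
    fix s assume "s \<in> blinfun_apply T ` cball 0 1"
    then obtain x where x: "s = T x" "norm x \<le> 1" by auto
    have "norm (T x - T' x) \<le> norm (T - T') * norm x"
      using norm_blinfun[of "T - T'" x] by (simp add: blinfun.diff_left)
    also have "\<dots> \<le> \<epsilon> * 1" using T'(2) x(2) by (intro mult_mono) (auto intro: order_trans[OF norm_ge_zero])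
    finally have "norm (s - T' x) \<le> \<epsilon>" by (simp add: x)
    moreover have "T' x \<in> closure (blinfun_apply T' ` cball 0 1)"
      using x(2) closure_subset[of "blinfun_apply T' ` cball 0 1"] by auto
    ultimately show "\<exists>k\<in>closure (blinfun_apply T' ` cball 0 1). norm (s - k) \<le> \<epsilon>" by blast
  qed
qed

lemma square_integrable_step:
  assumes "E \<in> sets borel" "E \<subseteq> cball (0 :: heis) R"
  shows "square_integrable (\<lambda>x. indicator E x *\<^sub>R v)"
  unfolding square_integrable_def
proof
  show "integrable lborel (\<lambda>x. (norm (indicator E x *\<^sub>R v))\<^sup>2)"
  proof (rule integrable_bounded_support[of _ "(norm v)\<^sup>2" R])
    fix x
    show "norm ((norm (indicator E x *\<^sub>R v))\<^sup>2) \<le> (norm v)\<^sup>2" by (simp split: split_indicator)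
    assume "(norm (indicator E x *\<^sub>R v))\<^sup>2 \<noteq> 0"
    then have "x \<in> E" by (simp split: split_indicator_asm)
    then show "norm x \<le> R" using assms(2) by auto
  qed (use assms(1) in simp)
qed (use assms in simp)

lemma bounded_linear_step:
  assumes E: "E \<in> sets borel" "E \<subseteq> cball (0 :: heis) R"
  shows "bounded_linear (\<lambda>v. abs_L2_heis (\<lambda>x. indicator E x *\<^sub>R v))"
proof -
  note sq = square_integrable_step[OF E]
  have "linear (\<lambda>v. abs_L2_heis (\<lambda>x. indicator E x *\<^sub>R v))"
  proof (rule linearI)
    fix v w :: "complex^2" and r :: real
    show "abs_L2_heis (\<lambda>x. indicator E x *\<^sub>R (v + w)) = abs_L2_heis (\<lambda>x. indicator E x *\<^sub>R v) + abs_L2_heis (\<lambda>x. indicator E x *\<^sub>R w)"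
      using plus_L2_heis.abs_eq[of "\<lambda>x. indicator E x *\<^sub>R v" "\<lambda>x. indicator E x *\<^sub>R w"] sq by (simp add: scaleR_add_right)
    show "abs_L2_heis (\<lambda>x. indicator E x *\<^sub>R r *\<^sub>R v) = r *\<^sub>R abs_L2_heis (\<lambda>x. indicator E x *\<^sub>R v)"
      using scaleR_L2_heis.abs_eq[of "\<lambda>x. indicator E x *\<^sub>R v" r] sq by (simp add: mult.commute)
  qed
  then show ?thesis by (simp add: linear_conv_bounded_linear)
qed

lemma compact_finite_sums:
  fixes J :: "nat \<Rightarrow> 'a::real_normed_vector \<Rightarrow> 'b::real_normed_vector"
  assumes "\<And>j. bounded_linear (J j)" "compact C"
  shows "compact {\<Sum>j<N. J j (v j) |v. \<forall>j. v j \<in> C}"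
proof (induction N)
  case 0
  have "{\<Sum>j<0. J j (v j) |v. \<forall>j. v j \<in> C} \<subseteq> {0}" by auto
  then show ?case by (rule finite_imp_compact[OF finite_subset]) simp
next
  case (Suc N)
  have "compact (J N ` C)"
    by (intro compact_continuous_image assms linear_continuous_on)
  from compact_sums[OF Suc this]
  have "compact {x + y |x y. x \<in> {\<Sum>j<N. J j (v j) |v. \<forall>j. v j \<in> C} \<and> y \<in> J N ` C}" .
  also have "{x + y |x y. x \<in> {\<Sum>j<N. J j (v j) |v. \<forall>j. v j \<in> C} \<and> y \<in> J N ` C}
      = {\<Sum>j<Suc N. J j (v j) |v. \<forall>j. v j \<in> C}" (is "?A = ?B")
  proof (intro subset_antisym subsetI)
    fix z assume "z \<in> ?A"
    then obtain v c where vc: "\<forall>j. v j \<in> C" "c \<in> C" "z = (\<Sum>j<N. J j (v j)) + J N c" by blast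
    have "z = (\<Sum>j<Suc N. J j ((v(N := c)) j))" by (simp add: vc)
    moreover have "\<forall>j. (v(N := c)) j \<in> C" using vc by simp
    ultimately show "z \<in> ?B" by blast
  next
    fix z assume "z \<in> ?B"
    then obtain v where v: "\<forall>j. v j \<in> C" "z = (\<Sum>j<N. J j (v j)) + J N (v N)" by auto
    then show "z \<in> ?A" by blast
  qed
  finally show ?case .
qed

text \<open>The estimate \<open>\<bar>\<xi>\<bar> \<le> 1 + \<bar>\<xi>\<bar>\<^sup>2\<close> suffices in place of Cauchy-Schwarz, since the bound only has to be
  uniform over the unit ball.\<close>

lemma
  assumes [measurable]: "k \<in> borel_measurable borel" and k: "\<And>z. norm (k z) \<le> \<delta>" "\<And>z. k z \<noteq> 0 \<Longrightarrow> norm z \<le> R"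
  shows integrable_compact_kernel: "integrable lborel (\<lambda>z. k z *s rep \<xi> z)" (is ?A)
    and norm_integral_compact_kernel: "norm (\<integral>z. k z *s rep \<xi> z \<partial>lborel)
      \<le> \<delta> * (measure lborel (cball (0 :: heis) R) + (norm \<xi>)\<^sup>2)" (is ?B)
proof -
  let ?h = "\<lambda>z. \<delta> * (indicator (cball (0 :: heis) R) z + (norm (rep \<xi> z))\<^sup>2)"
  have \<delta>: "0 \<le> \<delta>" using k(1)[of 0] norm_ge_zero order_trans by blast
  have sq: "integrable lborel (\<lambda>z. (norm (rep \<xi> z))\<^sup>2)"
    using square_integrable_rep[of \<xi>] by (simp add: square_integrable_def)
  have fin: "emeasure lborel (cball (0 :: heis) R) < \<infinity>" by (rule emeasure_lborel_cball_finite)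
  have h: "integrable lborel ?h"
    by (intro integrable_mult_right Bochner_Integration.integrable_add sq) (use fin in simp)
  have le: "norm (k z *s rep \<xi> z) \<le> ?h z" for z
  proof (cases "k z = 0")
    case False
    have "n \<le> 1 + n\<^sup>2" for n :: real
      using zero_le_power2[of "n - 1 / 2"] by (simp add: power2_eq_square algebra_simps)
    then have "norm (k z) * norm (rep \<xi> z) \<le> \<delta> * (1 + (norm (rep \<xi> z))\<^sup>2)"
      by (intro mult_mono k \<delta>) simp_all
    then show ?thesis using k(2)[OF False] by (simp add: norm_smult_vec)
  qed (use \<delta> in simp)
  have [measurable]: "(\<lambda>z. k z *s rep \<xi> z) \<in> borel_measurable borel"
    unfolding mat_vector_mult[symmetric] by measurable
  show A: ?A by (rule Bochner_Integration.integrable_bound[OF h]) (use order_trans[OF le abs_ge_self] in \<open>auto intro!: AE_I2\<close>)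
  have "norm (\<integral>z. k z *s rep \<xi> z \<partial>lborel) \<le> (\<integral>z. ?h z \<partial>lborel)"
    by (rule Bochner_Integration.integral_norm_bound_integral[OF A h le])
  also have "\<dots> = \<delta> * (measure lborel (cball (0 :: heis) R) + (norm \<xi>)\<^sup>2)"
    using fin sq by (simp add: norm_L2_heis_eq)
  finally show ?B .
qed

lemma bounded_left_quotients:
  obtains R' where "\<And>y x. norm y \<le> R \<Longrightarrow> norm x \<le> S \<Longrightarrow> norm (ldiv y x) \<le> R'"
proof -
  have "continuous_on (cball 0 R \<times> cball 0 S) (\<lambda>p. heis_mult (heis_inv (fst p)) (snd p))"
    unfolding heis_mult_def heis_inv_def case_prod_beta by (intro continuous_intros)
  then have "compact ((\<lambda>p. heis_mult (heis_inv (fst p)) (snd p)) ` (cball 0 R \<times> cball 0 S))"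
    by (intro compact_continuous_image compact_Times compact_cball)
  from compact_imp_bounded[OF this] obtain B
    where B: "\<forall>z\<in>(\<lambda>p. heis_mult (heis_inv (fst p)) (snd p)) ` (cball 0 R \<times> cball 0 S). norm z \<le> B"
    unfolding bounded_iff by blast
  have "norm (ldiv y x) \<le> B" if "norm y \<le> R" "norm x \<le> S" for y x
  proof -
    have "(y, x) \<in> cball 0 R \<times> cball 0 S" using that by simp
    from B[rule_format, OF imageI[OF this]] show ?thesis by simp
  qed
  then show thesis by (rule that)
qed

text \<open>If \<open>N(x)\<^sup>4 \<le> m\<close> with \<open>m \<ge> 1\<close>, then each coordinate of \<open>x\<close> is at most \<open>m\<close> in absolute value.\<close>

lemma weight_vanishes:
  assumes "0 < \<epsilon>" obtains M where "\<And>x. M < norm x \<Longrightarrow> weight x \<le> \<epsilon>"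
proof -
  define m where "m = max 1 (1 / \<epsilon>)"
  have "weight x \<le> \<epsilon>" if "3 * m < norm x" for x
  proof (rule ccontr)
    assume "\<not> weight x \<le> \<epsilon>"
    then have "\<epsilon> * (1 + koranyi4 x) \<le> 1"
      using weight_times[of x] koranyi4_nonneg[of x] mult_right_mono[of \<epsilon> "weight x" "1 + koranyi4 x"] by simp
    then have "1 + koranyi4 x \<le> 1 / \<epsilon>" using assms by (simp add: field_simps)
    then have k: "koranyi4 x \<le> m" and m: "1 \<le> m" by (auto simp: m_def)
    obtain a b c where x: "x = (a, b, c)" by (cases x)
    have mm: "m \<le> m\<^sup>2" using mult_left_mono[OF m, of m] m by (simp add: power2_eq_square)
    have k': "(a\<^sup>2 + b\<^sup>2)\<^sup>2 + c\<^sup>2 \<le> m" using k by (simp add: x koranyi4_def)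
    have "(a\<^sup>2 + b\<^sup>2)\<^sup>2 \<le> m\<^sup>2" using k' zero_le_power2[of c] mm by linarith
    then have ab: "a\<^sup>2 + b\<^sup>2 \<le> m" by (rule power2_le_imp_le) (use m in simp)
    have "c\<^sup>2 \<le> m\<^sup>2" using k' zero_le_power2[of "a\<^sup>2 + b\<^sup>2"] mm by linarith
    then have c: "\<bar>c\<bar> \<le> \<bar>m\<bar>" by (simp only: abs_le_square_iff)
    have "a\<^sup>2 \<le> m\<^sup>2" "b\<^sup>2 \<le> m\<^sup>2" using ab zero_le_power2[of a] zero_le_power2[of b] mm by linarith+
    then have "\<bar>a\<bar> \<le> \<bar>m\<bar>" "\<bar>b\<bar> \<le> \<bar>m\<bar>" by (simp_all only: abs_le_square_iff)
    with c m norm_heis_le[of a b c] that[unfolded x] show False by linarith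
  qed
  then show thesis by (rule that)
qed

lemma disjoint_cover:
  fixes B :: "'a::metric_space set"
  assumes "compact B" "0 < d"
  shows "\<exists>(N :: nat) E p. (\<forall>j. E j \<in> sets borel) \<and> (\<forall>j. E j \<subseteq> B) \<and> (\<Union>j<N. E j) = B \<and>
    disjoint_family E \<and> (\<forall>j. \<forall>x\<in>E j. dist (p j) x < d) \<and> (\<forall>j<N. p j \<in> B)"
proof -
  obtain F where F: "finite F" "F \<subseteq> B" "B \<subseteq> (\<Union>x\<in>F. ball x d)"
    using compact_imp_seq_compact[OF assms(1)] seq_compact_imp_totally_bounded assms(2) by metis
  obtain p where p: "bij_betw p {0..<card F} F" using ex_bij_betw_nat_finite[OF F(1)] by blast
  define A where "A j = (if j < card F then ball (p j) d \<inter> B else {})" for j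
  have B: "B \<in> sets borel" using compact_imp_closed[OF assms(1)] by simp
  show ?thesis
  proof (rule exI[of _ "card F"], rule exI[of _ "disjointed A"], rule exI[of _ p], intro conjI allI ballI impI)
    have A: "range A \<subseteq> sets borel" using B by (auto simp: A_def)
    show "disjointed A j \<in> sets borel" for j using sets.range_disjointed_sets[OF A] by auto
    show "disjointed A j \<subseteq> B" for j using disjointed_subset[of A j] by (auto simp: A_def split: if_splits)
    have "x \<in> (\<Union>j<card F. disjointed A j)" if "x \<in> B" for x
    proof -
      obtain y where y: "y \<in> F" "x \<in> ball y d" using F(3) \<open>x \<in> B\<close> by blast
      then obtain i where "i < card F" "p i = y" using p by (force simp: bij_betw_def)
      then have "x \<in> (\<Union>i. A i)" using y \<open>x \<in> B\<close> by (auto simp: A_def)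
      then obtain j where j: "x \<in> disjointed A j" using UN_disjointed_eq[of A] by blast
      then have "x \<in> A j" using disjointed_subset[of A j] by blast
      then have "j < card F" by (simp add: A_def split: if_splits)
      with j show ?thesis by blast
    qed
    moreover have "disjointed A j \<subseteq> B" for j using disjointed_subset[of A j] by (auto simp: A_def split: if_splits)
    ultimately show "(\<Union>j<card F. disjointed A j) = B" by blast
    show "disjoint_family (disjointed A)" by (rule disjoint_family_disjointed)
    show "dist (p j) x < d" if "x \<in> disjointed A j" for j x
      using that disjointed_subset[of A j] by (auto simp: A_def split: if_splits)
    show "p j \<in> B" if "j < card F" for j using that p F(2) by (auto simp: bij_betw_def)
  qed
qed

lemma norm_L2_heis_indicator:
  assumes "AE x in lborel. norm (rep \<zeta> x) \<le> \<delta> * indicator (cball 0 M) x" "0 \<le> \<delta>"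
  shows "norm \<zeta> \<le> \<delta> * sqrt (measure lborel (cball (0 :: heis) M))"
proof (rule power2_le_imp_le)
  have fin: "emeasure lborel (cball (0 :: heis) M) < \<infinity>" by (rule emeasure_lborel_cball_finite)
  have "(norm \<zeta>)\<^sup>2 \<le> (\<integral>x. \<delta>\<^sup>2 * indicator (cball (0 :: heis) M) x \<partial>lborel)"
    unfolding norm_L2_heis_eq
  proof (rule integral_mono_AE)
    show "integrable lborel (\<lambda>x. (norm (rep \<zeta> x))\<^sup>2)"
      using square_integrable_rep[of \<zeta>] by (simp add: square_integrable_def)
    show "integrable lborel (\<lambda>x. \<delta>\<^sup>2 * indicator (cball (0 :: heis) M) x)" using fin by simp
    show "AE x in lborel. (norm (rep \<zeta> x))\<^sup>2 \<le> \<delta>\<^sup>2 * indicator (cball 0 M) x"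
      using assms(1)
    proof eventually_elim
      case (elim x)
      from power_mono[OF elim norm_ge_zero, of 2] show ?case
        by (simp add: power_mult_distrib split: split_indicator_asm split_indicator)
    qed
  qed
  also have "\<dots> = (\<delta> * sqrt (measure lborel (cball (0 :: heis) M)))\<^sup>2"
    using fin by (simp add: power_mult_distrib)
  finally show "(norm \<zeta>)\<^sup>2 \<le> (\<delta> * sqrt (measure lborel (cball (0 :: heis) M)))\<^sup>2" .
qed (use assms(2) in simp)

text \<open>The substitution \<open>y = x z\<^sup>-\<^sup>1\<close> turns convolution into an integral operator in the usual form, whose kernel
  \<open>f(x z\<^sup>-\<^sup>1)\<close> depends continuously on \<open>x\<close>.\<close>

lemma conv_op_eq_quotient:
  assumes f: "integrable lborel f"
  shows "AE x in lborel. rep (conv_op f \<xi>) x = (\<integral>z. f (heis_mult x (heis_inv z)) *s rep \<xi> z \<partial>lborel)"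
  using rep_kernel_op[OF dominated_kernel_conv[OF f], of \<xi>]
proof eventually_elim
  case (elim x)
  have [measurable]: "f \<in> borel_measurable borel" using borel_measurable_integrable[OF f] by simp
  have "(\<lambda>y. mat (f y) *v rep \<xi> (ldiv y x)) \<in> borel_measurable borel" by measurable
  from integral_measure_scaling[OF measure_scaling_right_quotient this, of x] elim show ?case
    by (simp add: conv_op_def mat_vector_mult heis_inv_mult heis_mult_assoc)
qed

text \<open>The image of the unit ball is approximated by the compact set \<open>K\<close> of step functions. Outside a large ball the
  weight is small. Inside, the kernel \<open>k\<close> is uniformly continuous, so on each small cell \<open>E j\<close> the image \<open>F\<close> of a
  vector is nearly equal to its value at the sample point \<open>p j\<close>, and these values are bounded
  uniformly on the unit ball.\<close>

lemma compact_weight_conv_op: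
  assumes f: "cont_supp f"
  shows "compact_op (bmult (scalar_field weight) o\<^sub>L conv_op f)" (is "compact_op ?T")
  unfolding compact_op_def
proof (rule compact_closureI)
  fix \<epsilon> :: real assume \<epsilon>: "0 < \<epsilon>"
  note intf = integrable_cont_supp[OF f]
  have [measurable]: "f \<in> borel_measurable borel" by (rule cont_supp_measurable[OF f])
  obtain B R where BR: "0 \<le> B" "0 \<le> R" "\<And>x. norm (f x) \<le> B" "\<And>x. f x \<noteq> 0 \<Longrightarrow> norm x \<le> R"
    using cont_supp_bounded[OF f] by metis
  define \<epsilon>1 where "\<epsilon>1 = \<epsilon> / (2 * (norm (conv_op f) + 1))"
  have \<epsilon>1: "0 < \<epsilon>1" using \<epsilon> by (simp add: \<epsilon>1_def add_nonneg_pos)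
  obtain M where M: "\<And>x. M < norm x \<Longrightarrow> weight x \<le> \<epsilon>1" using weight_vanishes[OF \<epsilon>1] by metis
  \<comment> \<open>For \<open>x\<close> in the large ball, \<open>k x\<close> is supported in the ball of radius \<open>S\<close>.\<close>
  obtain S where S: "\<And>y x. norm y \<le> R \<Longrightarrow> norm x \<le> M \<Longrightarrow> norm (ldiv y x) \<le> S"
    using bounded_left_quotients by metis
  define k where "k x z = complex_of_real (weight x) * f (heis_mult x (heis_inv z))" for x z
  have [measurable]: "k x \<in> borel_measurable borel" for x
    unfolding k_def by measurable
  have k_supp: "norm z \<le> S" if "k x z \<noteq> 0" "norm x \<le> M" for x z
  proof -
    have "norm (heis_mult x (heis_inv z)) \<le> R" using that BR(4) by (simp add: k_def)
    from S[OF this that(2)] show ?thesis by (simp add: heis_inv_mult heis_mult_assoc)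
  qed
  have k_le: "norm (k x z) \<le> B" for x z
    using mult_mono[OF weight_le_1[of x] BR(3)[of "heis_mult x (heis_inv z)"]] weight_pos[of x] by (simp add: k_def norm_mult)
  \<comment> \<open>\<open>V\<close> bounds the integral of \<open>\<bar>\<xi>\<bar>\<close> over the ball of radius \<open>S\<close>, and \<open>W\<close> converts uniform bounds on the ball of radius \<open>M\<close> to \<open>L\<^sup>2\<close> bounds.\<close>
  define V where "V = measure lborel (cball (0 :: heis) S) + 1"
  have V: "0 < V" by (simp add: V_def add_nonneg_pos)
  define W where "W = sqrt (measure lborel (cball (0 :: heis) M))"
  have W: "0 \<le> W" by (simp add: W_def)
  define \<delta> where "\<delta> = \<epsilon> / (2 * V * (W + 1))"
  have \<delta>: "0 < \<delta>" using \<epsilon> V W by (simp add: \<delta>_def)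
  have "continuous_on (cball 0 M \<times> cball 0 S) (\<lambda>p. k (fst p) (snd p))"
  proof -
    have "continuous_on (cball 0 M \<times> cball 0 S) (\<lambda>p. heis_mult (fst p) (heis_inv (snd p)))"
      unfolding heis_mult_def heis_inv_def case_prod_beta by (intro continuous_intros)
    then have "continuous_on (cball 0 M \<times> cball 0 S) (\<lambda>p. f (heis_mult (fst p) (heis_inv (snd p))))"
      by (rule continuous_on_compose2[of UNIV f, rotated]) (use f in \<open>simp_all add: cont_supp_def\<close>)
    moreover have "continuous_on (cball 0 M \<times> cball 0 S) (\<lambda>p. weight (fst p))"
      by (rule continuous_on_compose2[OF continuous_weight[of UNIV]]) (auto intro!: continuous_intros)
    ultimately show ?thesis unfolding k_def by (intro continuous_intros)
  qed
  then have "uniformly_continuous_on (cball 0 M \<times> cball 0 S) (\<lambda>p. k (fst p) (snd p))"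
    by (rule compact_uniformly_continuous) (intro compact_Times compact_cball)
  then obtain d where d: "0 < d" "\<forall>p\<in>cball 0 M \<times> cball 0 S. \<forall>q\<in>cball 0 M \<times> cball 0 S.
      dist q p < d \<longrightarrow> dist (k (fst q) (snd q)) (k (fst p) (snd p)) < \<delta>"
    unfolding uniformly_continuous_on_def using \<delta> by blast
  have k_diff: "norm (k x z - k x' z) \<le> \<delta>" if "norm x \<le> M" "norm x' \<le> M" "dist x' x < d" for x x' z
  proof (cases "norm z \<le> S")
    case True
    have "dist (x', z) (x, z) < d" using that by (simp add: dist_Pair_Pair)
    then show ?thesis using d(2)[rule_format, of "(x, z)" "(x', z)"] that True
      by (simp add: dist_norm norm_minus_commute[of "k x' z"])
  next
    case False
    then have "k x z = 0" "k x' z = 0" using k_supp that by blast+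
    then show ?thesis using \<delta> by simp
  qed
  obtain N :: nat and E p where *: "(\<forall>j. E j \<in> sets borel) \<and> (\<forall>j. E j \<subseteq> cball (0 :: heis) M) \<and>
      (\<Union>j<N. E j) = cball 0 M \<and> disjoint_family E \<and> (\<forall>j. \<forall>x\<in>E j. dist (p j) x < d) \<and> (\<forall>j<N. p j \<in> cball 0 M)"
    using disjoint_cover[OF compact_cball[of 0 M] d(1)] by (elim exE)
  then have E: "E j \<in> sets borel" "E j \<subseteq> cball 0 M" for j by blast+
  from * have EU: "(\<Union>j<N. E j) = cball 0 M" and Ed: "disjoint_family E"
    and p: "\<forall>j. \<forall>x\<in>E j. dist (p j) x < d" "\<forall>j<N. p j \<in> cball 0 M" by blast+
  define J where "J j v = abs_L2_heis (\<lambda>x. indicator (E j) x *\<^sub>R v)" for j and v :: "complex^2"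
  have rep_J: "AE x in lborel. rep (J j v) x = indicator (E j) x *\<^sub>R v" for j v
    unfolding J_def by (rule rep_abs_L2_heis[OF square_integrable_step[OF E(1,2)]])
  define C where "C = cball (0 :: complex^2) (B * V)"
  define K where "K = {\<Sum>j<N. J j (v j) |v. \<forall>j. v j \<in> C}"
  have "compact K"
    unfolding K_def
  proof (rule compact_finite_sums)
    show "bounded_linear (J j)" for j
      unfolding J_def[abs_def] by (rule bounded_linear_step[OF E(1,2)])
    show "compact C" unfolding C_def by (rule compact_cball)
  qed
  moreover have "\<exists>\<zeta>\<in>K. norm (?T \<xi> - \<zeta>) \<le> \<epsilon>" if \<xi>: "norm \<xi> \<le> 1" for \<xi>
  proof -
    define F where "F x = (\<integral>z. k x z *s rep \<xi> z \<partial>lborel)" for x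
    have V_ge: "measure lborel (cball (0 :: heis) S) + (norm \<xi>)\<^sup>2 \<le> V"
      using \<xi> by (simp add: V_def power_le_one)
    have F_le: "norm (F x) \<le> B * V" if "norm x \<le> M" for x
    proof -
      have "norm (F x) \<le> B * (measure lborel (cball (0 :: heis) S) + (norm \<xi>)\<^sup>2)"
        unfolding F_def by (rule norm_integral_compact_kernel) (use k_le k_supp that in auto)
      also have "\<dots> \<le> B * V" using V_ge BR(1) by (rule mult_left_mono)
      finally show ?thesis .
    qed
    have F_diff: "norm (F x - F x') \<le> \<delta> * V" if x: "norm x \<le> M" "norm x' \<le> M" "dist x' x < d" for x x'
    proof -
      have "integrable lborel (\<lambda>z. k y z *s rep \<xi> z)" if "norm y \<le> M" for y
        by (rule integrable_compact_kernel[of _ B S]) (use k_le k_supp that in auto)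
      then have "F x - F x' = (\<integral>z. k x z *s rep \<xi> z - k x' z *s rep \<xi> z \<partial>lborel)"
        unfolding F_def using x by simp
      also have "\<dots> = (\<integral>z. (k x z - k x' z) *s rep \<xi> z \<partial>lborel)"
        by (simp add: vector_sub_rdistrib)
      also have "norm \<dots> \<le> \<delta> * (measure lborel (cball (0 :: heis) S) + (norm \<xi>)\<^sup>2)"
      proof (rule norm_integral_compact_kernel)
        show "norm z \<le> S" if "k x z - k x' z \<noteq> 0" for z
          using that k_supp[of x z] k_supp[of x' z] x by fastforce
      qed (use k_diff x in auto)
      also have "\<dots> \<le> \<delta> * V" using V_ge \<delta> by (intro mult_left_mono) simp_all
      finally show ?thesis .
    qed
    define \<zeta> where "\<zeta> = (\<Sum>j<N. J j (if j < N then F (p j) else 0))"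
    have "\<zeta> \<in> K"
      unfolding K_def \<zeta>_def C_def using F_le p(2) BR(1) V
      by (intro CollectI exI[of _ "\<lambda>j. if j < N then F (p j) else 0"] conjI refl) simp
    moreover have "norm (?T \<xi> - \<zeta>) \<le> \<epsilon>"
    proof -
      define m where "m = (indicator (cball 0 M) :: heis \<Rightarrow> real)"
      have m: "bounded_field 1 (scalar_field m)"
        unfolding m_def
      proof (rule bounded_field_scaleR)
        show "(indicator (cball 0 M) :: heis \<Rightarrow> real) \<in> borel_measurable borel" by (intro borel_measurable_indicator) simp
      qed (simp split: split_indicator)
      let ?\<eta> = "bmult (scalar_field m) (?T \<xi>)"
      have T: "AE x in lborel. rep (?T \<xi>) x = F x"
        using rep_bmult[OF bounded_field_weight, of "conv_op f \<xi>"] conv_op_eq_quotient[OF intf, of \<xi>]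
      proof eventually_elim
        case (elim x)
        have [measurable]: "(\<lambda>z. f (heis_mult x (heis_inv z)) *s rep \<xi> z) \<in> borel_measurable borel"
          unfolding mat_vector_mult[symmetric] by measurable
        have "F x = (\<integral>z. weight x *\<^sub>R (f (heis_mult x (heis_inv z)) *s rep \<xi> z) \<partial>lborel)"
          unfolding F_def k_def scaleR_smult vector_smult_assoc ..
        then show ?case using elim by (simp add: matrix_vector_scaleR)
      qed
      have "norm (?T \<xi> - ?\<eta>) \<le> \<epsilon>1 * norm (conv_op f \<xi>)"
      proof (rule norm_L2_heis_mono)
        show "AE x in lborel. norm (rep (?T \<xi> - ?\<eta>) x) \<le> \<epsilon>1 * norm (rep (conv_op f \<xi>) x)"
          using rep_L2_heis_diff[of "?T \<xi>" ?\<eta>] rep_bmult[OF m, of "?T \<xi>"]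
            rep_bmult[OF bounded_field_weight, of "conv_op f \<xi>"]
        proof eventually_elim
          case (elim x)
          show ?case
          proof (cases "x \<in> cball 0 M")
            case True
            then show ?thesis using elim \<epsilon>1 by (simp add: matrix_vector_scaleR m_def)
          next
            case False
            then have "weight x \<le> \<epsilon>1" by (intro M) simp
            then show ?thesis using elim False weight_pos[of x]
              by (simp add: matrix_vector_scaleR m_def mult_right_mono)
          qed
        qed
      qed (use \<epsilon>1 in simp)
      also have "\<dots> \<le> \<epsilon>1 * (norm (conv_op f) + 1)"
      proof (intro mult_left_mono)
        have "norm (conv_op f \<xi>) \<le> norm (conv_op f) * 1"
          using norm_blinfun[of "conv_op f" \<xi>] mult_left_mono[OF \<xi> norm_ge_zero[of "conv_op f"]] by linarith
        then show "norm (conv_op f \<xi>) \<le> norm (conv_op f) + 1" by simp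
      qed (use \<epsilon>1 in simp)
      also have "\<dots> = \<epsilon> / 2"
      proof -
        have "\<epsilon> / (2 * n) * n = \<epsilon> / 2" if "0 < n" for n :: real using that by simp
        from this[OF add_nonneg_pos[OF norm_ge_zero[of "conv_op f"] zero_less_one]] show ?thesis by (simp only: \<epsilon>1_def)
      qed
      finally have 1: "norm (?T \<xi> - ?\<eta>) \<le> \<epsilon> / 2" .
      have "norm (?\<eta> - \<zeta>) \<le> (\<delta> * V) * W"
        unfolding W_def
      proof (rule norm_L2_heis_indicator)
        have "AE x in lborel. \<forall>j. rep (J j (if j < N then F (p j) else 0)) x
            = indicator (E j) x *\<^sub>R (if j < N then F (p j) else 0)"
          unfolding AE_all_countable using rep_J by blast
        then show "AE x in lborel. norm (rep (?\<eta> - \<zeta>) x) \<le> \<delta> * V * indicator (cball 0 M) x"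
          using T rep_L2_heis_diff[of ?\<eta> \<zeta>] rep_bmult[OF m, of "?T \<xi>"]
            rep_L2_heis_sum[of "{..<N}" "\<lambda>j. J j (if j < N then F (p j) else 0)", folded \<zeta>_def, OF finite_lessThan]
        proof eventually_elim
          case (elim x)
          have \<zeta>: "rep \<zeta> x = (\<Sum>j<N. indicator (E j) x *\<^sub>R F (p j))"
            unfolding elim(5)
          proof (rule sum.cong[OF refl])
            fix j assume "j \<in> {..<N}"
            then show "rep (J j (if j < N then F (p j) else 0)) x = indicator (E j) x *\<^sub>R F (p j)"
              using elim(1)[rule_format, of j] by simp
          qed
          show ?case
          proof (cases "x \<in> cball 0 M")
            case True
            then obtain i where i: "i < N" "x \<in> E i" using EU by blast
            have "indicator (E j) x *\<^sub>R F (p j) = (if j = i then F (p i) else 0)" for j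
              using disjoint_family_onD[OF Ed, of i j] i(2) by (auto split: split_indicator)
            then have "rep \<zeta> x = F (p i)" using i(1) by (simp add: \<zeta>)
            moreover have "norm (F x - F (p i)) \<le> \<delta> * V" using True p i by (intro F_diff) auto
            ultimately show ?thesis using elim(2-4) True by (simp add: matrix_vector_scaleR m_def)
          next
            case False
            then have "x \<notin> E j" for j using E(2) by blast
            then have "rep \<zeta> x = 0" by (simp add: \<zeta>)
            then show ?thesis using elim(2-4) False by (simp add: matrix_vector_scaleR m_def)
          qed
        qed
      qed (use \<delta> V in simp)
      also have "\<dots> \<le> \<epsilon> / 2"
      proof -
        have "\<delta> * V * W = \<epsilon> / 2 * (W / (W + 1))" using V by (simp add: \<delta>_def)
        also have "\<dots> \<le> \<epsilon> / 2 * 1" using W \<epsilon> by (intro mult_left_mono) simp_all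
        finally show ?thesis by simp
      qed
      finally have 2: "norm (?\<eta> - \<zeta>) \<le> \<epsilon> / 2" .
      show ?thesis using norm_triangle_ineq[of "?T \<xi> - ?\<eta>" "?\<eta> - \<zeta>"] 1 2 by simp
    qed
    ultimately show ?thesis by blast
  qed
  ultimately show "\<exists>K. compact K \<and> (\<forall>s\<in>blinfun_apply ?T ` cball 0 1. \<exists>k\<in>K. norm (s - k) \<le> \<epsilon>)"
    by (intro exI[of _ K]) auto
qed

section \<open>Commutators with convolution operators\<close>

text \<open>The Euclidean norm of the image in the abelianisation.\<close>

definition planar_norm :: "heis \<Rightarrow> real" where
  "planar_norm x = norm (fst x, fst (snd x))"

lemma planar_norm_nonneg: "0 \<le> planar_norm x"
  by (simp add: planar_norm_def)

lemma planar_norm_tuple: "planar_norm (a, b, c) = sqrt (a\<^sup>2 + b\<^sup>2)"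
  by (simp add: planar_norm_def norm_Pair)

lemma planar_norm_bounds: "\<bar>a\<bar> \<le> planar_norm (a, b, c)" "\<bar>b\<bar> \<le> planar_norm (a, b, c)"
  using norm_fst_le[of a b] norm_snd_le[of b a] by (simp_all add: planar_norm_def)

lemma planar_norm_mult_diff:
  assumes "norm y \<le> R"
  shows "\<bar>planar_norm (heis_mult y x) - planar_norm x\<bar> \<le> 2 * R"
proof -
  obtain a b c where x: "x = (a, b, c)" by (cases x)
  obtain \<alpha> \<beta> \<gamma> where y: "y = (\<alpha>, \<beta>, \<gamma>)" by (cases y)
  have "\<bar>norm (\<alpha> + a, \<beta> + b) - norm (a, b)\<bar> \<le> norm ((\<alpha> + a, \<beta> + b) - (a, b))"
    by (rule norm_triangle_ineq3)
  also have "\<dots> \<le> \<bar>\<alpha>\<bar> + \<bar>\<beta>\<bar>" using norm_Pair_le[of \<alpha> \<beta>] by simp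
  also have "\<dots> \<le> 2 * R" using norm_heis_bounds[of y] assms by (simp add: y)
  finally show ?thesis by (simp add: planar_norm_def x y heis_mult_def)
qed

text \<open>Because \<open>\<bar>(a, b)\<bar>\<^sup>4 \<le> N\<^sup>4\<close>.\<close>

lemma root_weight_planar: "root_weight x * (1 + planar_norm x) \<le> 2"
proof -
  have "(root_weight x * planar_norm x) ^ 4 = weight x * planar_norm x ^ 4"
    using weight_pos[of x] by (simp add: root_weight_def power_mult_distrib powr_power)
  also have "\<dots> \<le> weight x * (1 + koranyi4 x)"
  proof (intro mult_left_mono)
    obtain a b c where x: "x = (a, b, c)" by (cases x)
    have "planar_norm x ^ 4 = ((planar_norm x)\<^sup>2)\<^sup>2" by (simp flip: power_mult)
    also have "\<dots> = (a\<^sup>2 + b\<^sup>2)\<^sup>2" by (simp add: x planar_norm_tuple)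
    finally show "planar_norm x ^ 4 \<le> 1 + koranyi4 x" by (simp add: x koranyi4_def)
  qed (use weight_pos[of x] in simp)
  finally have "\<not> 1 < (root_weight x * planar_norm x) ^ 4" by (simp add: weight_times)
  then have "root_weight x * planar_norm x \<le> 1"
    using one_less_power[of "root_weight x * planar_norm x" 4] by fastforce
  then show ?thesis using root_weight_le_1[of x] by (simp add: distrib_left)
qed

lemma continuous_root_weight: "continuous_on S root_weight"
  unfolding root_weight_def[abs_def]
  by (intro continuous_on_powr' continuous_weight continuous_on_const) (use weight_pos in \<open>auto simp: less_imp_le\<close>)

context clifford
begin

text \<open>With \<open>v = (a, b)\<close>, the planar part of \<open>\<ell>\<close> is \<open>\<bar>v\<bar> v\<close>, whose increments are linear in \<open>\<bar>v\<bar>\<close>; the central coordinate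
  changes by \<open>\<gamma> + \<alpha> b\<close>, which is also linear.\<close>

lemma ell_mult_diff:
  assumes y: "norm y \<le> R"
  shows "norm ((L (heis_mult y x) - L x) *v v) \<le> (8 * R + 4 * R\<^sup>2) * (1 + planar_norm x) * norm v"
proof -
  obtain a b c where x: "x = (a, b, c)" by (cases x)
  obtain \<alpha> \<beta> \<gamma> where y': "y = (\<alpha>, \<beta>, \<gamma>)" by (cases y)
  have R: "0 \<le> R" using y norm_ge_zero order_trans by blast
  have le: "\<bar>\<alpha>\<bar> \<le> R" "\<bar>\<beta>\<bar> \<le> R" "\<bar>\<gamma>\<bar> \<le> R" using norm_heis_bounds[of y] y by (simp_all add: y')
  define n where "n = planar_norm x"
  define n' where "n' = planar_norm (heis_mult y x)"
  have n0: "0 \<le> n" "0 \<le> n'" by (simp_all add: n_def n'_def planar_norm_nonneg)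
  have nn: "\<bar>n' - n\<bar> \<le> 2 * R" unfolding n_def n'_def by (rule planar_norm_mult_diff[OF y])
  have ab: "\<bar>a\<bar> \<le> n" "\<bar>b\<bar> \<le> n" unfolding n_def x by (rule planar_norm_bounds)+
  have diff: "\<bar>n' * (u + d) - n * u\<bar> \<le> 3 * R * n + 2 * R\<^sup>2" if "\<bar>d\<bar> \<le> R" "\<bar>u\<bar> \<le> n" for d u
  proof -
    have "\<bar>n' * (u + d) - n * u\<bar> = \<bar>n' * d + (n' - n) * u\<bar>" by (simp add: algebra_simps)
    also have "\<dots> \<le> \<bar>n'\<bar> * \<bar>d\<bar> + \<bar>n' - n\<bar> * \<bar>u\<bar>" by (metis abs_mult abs_triangle_ineq)
    also have "\<dots> \<le> (n + 2 * R) * R + (2 * R) * n"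
      using nn n0 that R by (intro add_mono mult_mono) auto
    finally show ?thesis by (simp add: power2_eq_square algebra_simps)
  qed
  define p q s where "p = n' * (a + \<alpha>) - n * a" and "q = n' * (b + \<beta>) - n * b" and "s = \<gamma> + \<alpha> * b"
  have pqs: "\<bar>p\<bar> \<le> 3 * R * n + 2 * R\<^sup>2" "\<bar>q\<bar> \<le> 3 * R * n + 2 * R\<^sup>2" "\<bar>s\<bar> \<le> R + R * n"
  proof -
    show "\<bar>p\<bar> \<le> 3 * R * n + 2 * R\<^sup>2" unfolding p_def using diff le ab by blast
    show "\<bar>q\<bar> \<le> 3 * R * n + 2 * R\<^sup>2" unfolding q_def using diff le ab by blast
    have "\<bar>\<alpha> * b\<bar> \<le> R * n" unfolding abs_mult using le ab R by (intro mult_mono) simp_all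
    then show "\<bar>s\<bar> \<le> R + R * n" unfolding s_def using le by linarith
  qed
  have "L (heis_mult y x) - L x = cliff p q s"
    unfolding x y' heis_mult_def prod.case ell_cliff
    by (simp add: p_def q_def s_def n_def n'_def x y' heis_mult_def planar_norm_tuple cliff_def algebra_simps)
  then have "norm ((L (heis_mult y x) - L x) *v v) = sqrt (p\<^sup>2 + q\<^sup>2 + s\<^sup>2) * norm v"
    by (simp add: norm_cliff)
  also have "\<dots> \<le> (\<bar>p\<bar> + \<bar>q\<bar> + \<bar>s\<bar>) * norm v"
  proof (intro mult_right_mono real_le_lsqrt)
    have "p\<^sup>2 + q\<^sup>2 + s\<^sup>2 = \<bar>p\<bar>\<^sup>2 + \<bar>q\<bar>\<^sup>2 + \<bar>s\<bar>\<^sup>2" by simp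
    also have "\<dots> \<le> (\<bar>p\<bar> + \<bar>q\<bar> + \<bar>s\<bar>)\<^sup>2"
      using mult_nonneg_nonneg[of "\<bar>p\<bar>" "\<bar>q\<bar>"] mult_nonneg_nonneg[of "\<bar>p\<bar>" "\<bar>s\<bar>"] mult_nonneg_nonneg[of "\<bar>q\<bar>" "\<bar>s\<bar>"]
      unfolding power2_eq_square by (simp add: algebra_simps)
    finally show "p\<^sup>2 + q\<^sup>2 + s\<^sup>2 \<le> (\<bar>p\<bar> + \<bar>q\<bar> + \<bar>s\<bar>)\<^sup>2" .
  qed simp_all
  also have "\<dots> \<le> ((8 * R + 4 * R\<^sup>2) * (1 + n)) * norm v"
  proof (intro mult_right_mono)
    have "\<bar>p\<bar> + \<bar>q\<bar> + \<bar>s\<bar> \<le> 7 * (R * n) + 4 * R\<^sup>2 + R" using pqs by simp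
    also have "\<dots> \<le> 7 * (R * n) + 4 * R\<^sup>2 + R + (7 * R + R * n + 4 * R\<^sup>2 * n)" using R n0 by simp
    also have "\<dots> = (8 * R + 4 * R\<^sup>2) * (1 + n)" by (simp add: algebra_simps)
    finally show "\<bar>p\<bar> + \<bar>q\<bar> + \<bar>s\<bar> \<le> (8 * R + 4 * R\<^sup>2) * (1 + n)" .
  qed simp
  finally show ?thesis by (simp add: n_def)
qed

definition comm_kernel :: "(heis \<Rightarrow> complex) \<Rightarrow> heis \<Rightarrow> heis \<Rightarrow> complex^2^2" where
  "comm_kernel f y x = mat (f y) ** (L x - L (ldiv y x))"

lemma comm_kernel_vector: "comm_kernel f y x *v v = f y *s ((L x - L (ldiv y x)) *v v)"
  by (simp add: comm_kernel_def mat_vector_mult flip: matrix_vector_mul_assoc)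

lemma continuous_comm_kernel:
  assumes f: "cont_supp f"
  shows "continuous_on UNIV (\<lambda>(y, x). comm_kernel f y x)"
proof -
  have q: "continuous_on UNIV (\<lambda>p. heis_mult (heis_inv (fst p)) (snd p))"
    unfolding heis_mult_def heis_inv_def case_prod_beta by (intro continuous_intros)
  have "continuous_on UNIV (\<lambda>p. L (heis_mult (heis_inv (fst p)) (snd p)))"
    by (rule continuous_on_compose2[OF continuous_ell[of UNIV] q]) simp
  moreover have "continuous_on UNIV (\<lambda>p :: heis \<times> heis. L (snd p))"
    by (rule continuous_on_compose2[OF continuous_ell[of UNIV]]) (auto intro: continuous_intros)
  moreover have fc: "continuous_on UNIV (\<lambda>p :: heis \<times> heis. f (fst p))"
    using f unfolding cont_supp_def by (intro continuous_on_compose2[of UNIV f UNIV fst]) (auto intro: continuous_intros)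
  have "continuous_on UNIV (\<lambda>p :: heis \<times> heis. if i = j then f (fst p) else 0)" for i j :: 2
    using fc by (cases "i = j") simp_all
  ultimately show ?thesis
    unfolding comm_kernel_def case_prod_beta matrix_matrix_mult_def mat_def
    by (intro continuous_on_vec_lambda continuous_on_sum continuous_on_mult continuous_on_component)
      (auto intro!: continuous_intros)
qed

text \<open>The weight is evaluated at \<open>y\<^sup>-\<^sup>1 x\<close> when \<open>\<langle>D\<rangle>\<^bsup>-1/2\<^esup>\<close> stands to the right of the commutator and at \<open>x\<close> when it
  stands to the left; over the support of \<open>f\<close> the planar norms of these two points differ by a bounded
  amount.\<close>

lemma dominated_comm_kernel:
  assumes f: "cont_supp f"
  shows "\<exists>C. dominated_kernel (\<lambda>y. C * norm (f y)) (\<lambda>y x. root_weight (ldiv y x) *\<^sub>R comm_kernel f y x)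
    \<and> dominated_kernel (\<lambda>y. C * norm (f y)) (\<lambda>y x. root_weight x *\<^sub>R comm_kernel f y x)"
proof -
  obtain B R where BR: "0 \<le> B" "0 \<le> R" "\<And>x. norm (f x) \<le> B" "\<And>x. f x \<noteq> 0 \<Longrightarrow> norm x \<le> R"
    using cont_supp_bounded[OF f] by metis
  define C0 where "C0 = 8 * R + 4 * R\<^sup>2"
  have C0: "0 \<le> C0" using BR(2) by (simp add: C0_def)
  define C where "C = 2 * C0 * (1 + 2 * R)"
  have C: "0 \<le> C" "2 * C0 \<le> C" using C0 BR(2) by (simp_all add: C_def mult_left_mono[of 1 "1 + 2 * R" "2 * C0", simplified])
  have est: "norm (comm_kernel f y x *v v) \<le> norm (f y) * (C0 * (1 + planar_norm (ldiv y x)) * norm v)" for y x v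
  proof (cases "f y = 0")
    case False
    from ell_mult_diff[OF BR(4)[OF this], of "ldiv y x" v]
    show ?thesis unfolding comm_kernel_vector norm_smult_vec by (intro mult_left_mono) (simp_all add: C0_def)
  qed (simp add: comm_kernel_vector norm_smult_vec)
  have est1: "norm ((root_weight (ldiv y x) *\<^sub>R comm_kernel f y x) *v v) \<le> C * norm (f y) * norm v" for y x v
  proof -
    let ?x = "ldiv y x"
    have "norm ((root_weight ?x *\<^sub>R comm_kernel f y x) *v v) = root_weight ?x * norm (comm_kernel f y x *v v)"
      using root_weight_pos[of ?x] by (simp add: matrix_vector_scaleR)
    also have "\<dots> \<le> root_weight ?x * (norm (f y) * (C0 * (1 + planar_norm ?x) * norm v))"
      using root_weight_pos[of ?x] by (intro mult_left_mono est) simp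
    also have "\<dots> = (root_weight ?x * (1 + planar_norm ?x)) * (C0 * norm (f y) * norm v)" by (simp add: mult_ac)
    also have "\<dots> \<le> 2 * (C0 * norm (f y) * norm v)"
      using C0 by (intro mult_right_mono root_weight_planar) simp
    also have "\<dots> = (2 * C0) * (norm (f y) * norm v)" by simp
    also have "\<dots> \<le> C * (norm (f y) * norm v)" using C by (intro mult_right_mono) simp_all
    finally show ?thesis by (simp add: mult.assoc)
  qed
  have est2: "norm ((root_weight x *\<^sub>R comm_kernel f y x) *v v) \<le> C * norm (f y) * norm v" for y x v
  proof (cases "f y = 0")
    case False
    let ?x = "ldiv y x"
    have "\<bar>planar_norm x - planar_norm ?x\<bar> \<le> 2 * R"
      using planar_norm_mult_diff[OF BR(4)[OF False], of ?x] by simp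
    then have "1 + planar_norm ?x \<le> 1 + planar_norm x + 2 * R" by linarith
    also have "\<dots> \<le> (1 + 2 * R) * (1 + planar_norm x)"
      using BR(2) planar_norm_nonneg[of x] by (simp add: algebra_simps)
    finally have pl: "1 + planar_norm ?x \<le> (1 + 2 * R) * (1 + planar_norm x)" .
    have "norm ((root_weight x *\<^sub>R comm_kernel f y x) *v v) = root_weight x * norm (comm_kernel f y x *v v)"
      using root_weight_pos[of x] by (simp add: matrix_vector_scaleR)
    also have "\<dots> \<le> root_weight x * (norm (f y) * (C0 * (1 + planar_norm ?x) * norm v))"
      using root_weight_pos[of x] by (intro mult_left_mono est) simp
    also have "\<dots> \<le> root_weight x * (norm (f y) * (C0 * ((1 + 2 * R) * (1 + planar_norm x)) * norm v))"
      using root_weight_pos[of x] C0 by (intro mult_left_mono mult_right_mono pl) simp_all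
    also have "\<dots> = (root_weight x * (1 + planar_norm x)) * (C0 * (1 + 2 * R) * norm (f y) * norm v)" by (simp add: mult_ac)
    also have "\<dots> \<le> 2 * (C0 * (1 + 2 * R) * norm (f y) * norm v)"
      using C0 BR(2) by (intro mult_right_mono root_weight_planar) simp
    also have "\<dots> = C * norm (f y) * norm v" by (simp only: C_def mult_ac)
    finally show ?thesis .
  qed (simp add: comm_kernel_vector matrix_vector_scaleR)
  have q: "continuous_on UNIV (\<lambda>p. heis_mult (heis_inv (fst p)) (snd p))"
    unfolding heis_mult_def heis_inv_def case_prod_beta by (intro continuous_intros)
  have k: "continuous_on UNIV (\<lambda>p. comm_kernel f (fst p) (snd p))"
    using continuous_comm_kernel[OF f] by (simp add: case_prod_beta)
  have "continuous_on UNIV (\<lambda>p. root_weight (heis_mult (heis_inv (fst p)) (snd p)) *\<^sub>R comm_kernel f (fst p) (snd p))"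
    by (intro continuous_on_scaleR k continuous_on_compose2[OF continuous_root_weight[of UNIV] q]) simp
  moreover have "continuous_on UNIV (\<lambda>p. root_weight (snd p) *\<^sub>R comm_kernel f (fst p) (snd p))"
    by (intro continuous_on_scaleR k continuous_on_compose2[OF continuous_root_weight[of UNIV]]) (auto intro: continuous_intros)
  ultimately have "(\<lambda>(y, x). root_weight (ldiv y x) *\<^sub>R comm_kernel f y x) \<in> borel_measurable (borel \<Otimes>\<^sub>M borel)"
    "(\<lambda>(y, x). root_weight x *\<^sub>R comm_kernel f y x) \<in> borel_measurable (borel \<Otimes>\<^sub>M borel)"
    unfolding borel_prod case_prod_beta by (simp_all add: borel_measurable_continuous_onI)
  moreover have "integrable lborel (\<lambda>y. C * norm (f y))" using integrable_cont_supp[OF f] by simp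
  ultimately show ?thesis
    using est1 est2 C(1) unfolding dominated_kernel_def by (intro exI[of _ C]) simp
qed

lemma conv_op_commutator:
  assumes f: "integrable lborel f" and D: "(\<xi>, \<xi>') \<in> D"
  shows "AE x in lborel. L x *v rep (conv_op f \<xi>) x - rep (conv_op f \<xi>') x
    = (\<integral>y. comm_kernel f y x *v rep \<xi> (ldiv y x) \<partial>lborel)"
proof -
  have [measurable]: "f \<in> borel_measurable borel" using borel_measurable_integrable[OF f] by simp
  note K = dominated_kernel_conv[OF f]
  have D': "AE x in lborel. rep \<xi>' x = L x *v rep \<xi> x" using D by (simp add: mult_op_def)
  show ?thesis
    using rep_kernel_op[OF K, of \<xi>, folded conv_op_def] rep_kernel_op[OF K, of \<xi>', folded conv_op_def]
      kernel_integrable[OF K, of \<xi>] kernel_integrable[OF K, of \<xi>']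
  proof eventually_elim
    case (elim x)
    let ?\<xi> = "\<lambda>y. rep \<xi> (ldiv y x)" and ?\<xi>' = "\<lambda>y. rep \<xi>' (ldiv y x)"
    have bl: "bounded_linear (\<lambda>v. L x *v v)"
      by (simp add: linear_conv_bounded_linear[symmetric] linearI matrix_vector_right_distrib matrix_vector_scaleR)
    have "L x *v rep (conv_op f \<xi>) x = (\<integral>y. L x *v (mat (f y) *v ?\<xi> y) \<partial>lborel)"
      unfolding elim(1) by (rule integral_bounded_linear[OF bl elim(3), symmetric])
    then have "L x *v rep (conv_op f \<xi>) x - rep (conv_op f \<xi>') x
      = (\<integral>y. L x *v (mat (f y) *v ?\<xi> y) - mat (f y) *v ?\<xi>' y \<partial>lborel)"
      using elim(2-4) integrable_bounded_linear[OF bl elim(3)] by simp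
    also have "\<dots> = (\<integral>y. comm_kernel f y x *v ?\<xi> y \<partial>lborel)"
    proof (rule Bochner_Integration.integral_cong_AE)
      show "AE y in lborel. L x *v (mat (f y) *v ?\<xi> y) - mat (f y) *v ?\<xi>' y = comm_kernel f y x *v ?\<xi> y"
        using AE_measure_scaling[OF measure_scaling_left_quotient D', of x]
        by eventually_elim (simp add: comm_kernel_vector mat_vector_mult matrix_vector_smult
            matrix_vector_mult_diff_rdistrib vector_ssub_ldistrib)
      have "(\<lambda>y. L (ldiv y x)) \<in> borel_measurable borel" by measurable
      then have "(\<lambda>y. f y *s ((L x - L (ldiv y x)) *v ?\<xi> y)) \<in> borel_measurable borel"
        unfolding mat_vector_mult[symmetric] by measurable
      then show "(\<lambda>y. comm_kernel f y x *v ?\<xi> y) \<in> borel_measurable lborel" by (simp add: comm_kernel_vector)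
    qed measurable
    finally show ?case .
  qed
qed

lemma in_commutator_iff:
  "(\<xi>, \<eta>) \<in> commutator D a \<longleftrightarrow> (\<exists>y y'. (a \<xi>, y) \<in> D \<and> (\<xi>, y') \<in> D \<and> \<eta> = y - a y')"
  by (auto simp: commutator_def op_minus_def op_times_def gr_def)

lemma in_gr_times: "(x, z) \<in> gr A \<odot> T \<longleftrightarrow> (\<exists>y. (x, y) \<in> T \<and> z = A y)"
  and in_times_gr: "(x, z) \<in> T \<odot> gr A \<longleftrightarrow> (A x, z) \<in> T"
  by (auto simp: op_times_def gr_def)

lemma rep_commutator_conv_op:
  assumes f: "integrable lborel f" and "(\<xi>, \<eta>) \<in> commutator D (conv_op f)"
  shows "AE x in lborel. rep \<eta> x = (\<integral>y. comm_kernel f y x *v rep \<xi> (ldiv y x) \<partial>lborel)"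
proof -
  obtain y y' where y: "(conv_op f \<xi>, y) \<in> D" "(\<xi>, y') \<in> D" "\<eta> = y - conv_op f y'"
    using assms(2) unfolding in_commutator_iff by blast
  have "AE x in lborel. rep y x = L x *v rep (conv_op f \<xi>) x"
    using y(1) by (simp add: mult_op_def)
  then show ?thesis
    using rep_L2_heis_diff[of y "conv_op f y'"] conv_op_commutator[OF f y(2)] unfolding y(3)
    by eventually_elim simp
qed

text \<open>The domain of \<open>D\<close> is contained in that of \<open>\<langle>D\<rangle>\<^bsup>1/2\<^esup>\<close>, since \<open>(1 + N\<^sup>4)\<^bsup>1/4\<^esup> \<le> 1 + N\<^sup>2\<close> and \<open>\<bar>\<ell> v\<bar> = N\<^sup>2 \<bar>v\<bar>\<close>.\<close>

lemma domain_D_root_weight: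
  assumes "(\<xi>, \<xi>') \<in> D" obtains \<zeta> where "\<xi> = bmult (scalar_field root_weight) \<zeta>"
proof -
  let ?h = "\<lambda>x. (1 / root_weight x) *\<^sub>R rep \<xi> x"
  have D: "AE x in lborel. rep \<xi>' x = L x *v rep \<xi> x" using assms by (simp add: mult_op_def)
  have le: "1 / root_weight x \<le> 1 + sqrt (koranyi4 x)" for x
  proof -
    let ?k = "1 + koranyi4 x"
    have k: "1 \<le> ?k" using koranyi4_nonneg[of x] by simp
    have "1 / root_weight x = ?k powr (1 / 4)"
      using k by (simp add: root_weight_def weight_def powr_divide)
    also have "\<dots> \<le> ?k powr (1 / 2)" using k by (intro powr_mono) simp_all
    also have "\<dots> = sqrt ?k" using k by (simp add: powr_half_sqrt)
    also have "\<dots> \<le> sqrt 1 + sqrt (koranyi4 x)" using koranyi4_nonneg[of x] by (intro sqrt_add_le_add_sqrt) simp_all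
    finally show ?thesis by simp
  qed
  have "integrable lborel (\<lambda>x. (norm (?h x))\<^sup>2)"
  proof (rule Bochner_Integration.integrable_bound)
    have sq: "integrable lborel (\<lambda>x. (norm (rep \<zeta> x))\<^sup>2)" for \<zeta>
      using square_integrable_rep[of \<zeta>] by (simp add: square_integrable_def)
    show "integrable lborel (\<lambda>x. 2 * (norm (rep \<xi> x))\<^sup>2 + 2 * (norm (rep \<xi>' x))\<^sup>2)"
      using sq by simp
    show "AE x in lborel. norm ((norm (?h x))\<^sup>2) \<le> norm (2 * (norm (rep \<xi> x))\<^sup>2 + 2 * (norm (rep \<xi>' x))\<^sup>2)"
      using D
    proof eventually_elim
      case (elim x)
      have "norm (?h x) = 1 / root_weight x * norm (rep \<xi> x)" using root_weight_pos[of x] by simp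
      also have "\<dots> \<le> (1 + sqrt (koranyi4 x)) * norm (rep \<xi> x)" by (intro mult_right_mono le) simp
      also have "\<dots> = norm (rep \<xi> x) + norm (rep \<xi>' x)" by (simp add: elim norm_ell distrib_right)
      finally have "(norm (?h x))\<^sup>2 \<le> (norm (rep \<xi> x) + norm (rep \<xi>' x))\<^sup>2" by (intro power_mono) simp_all
      also have "\<dots> \<le> 2 * (norm (rep \<xi> x))\<^sup>2 + 2 * (norm (rep \<xi>' x))\<^sup>2"
        using zero_le_power2[of "norm (rep \<xi> x) - norm (rep \<xi>' x)"]
        by (simp add: power2_eq_square algebra_simps)
      finally show ?case by simp
    qed
  qed measurable
  then have sq: "square_integrable ?h" by (simp add: square_integrable_def)
  have "AE x in lborel. rep \<xi> x = rep (bmult (scalar_field root_weight) (abs_L2_heis ?h)) x"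
    using rep_bmult[OF bounded_field_root_weight, of "abs_L2_heis ?h"] rep_abs_L2_heis[OF sq]
  proof eventually_elim
    case (elim x)
    then show ?case using root_weight_pos[of x] by (simp add: matrix_vector_scaleR)
  qed
  then have "\<xi> = bmult (scalar_field root_weight) (abs_L2_heis ?h)" by (rule L2_heis_eqI)
  then show thesis by (rule that)
qed

text \<open>That the domain is preserved also follows from the commutator estimate:
  for \<open>\<xi> = \<langle>D\<rangle>\<^bsup>-1/2\<^esup> \<zeta>\<close> in the domain, \<open>\<ell>\<close> times the convolution \<open>f * \<xi>\<close> is \<open>f * D\<xi>\<close> plus the image of \<open>\<zeta>\<close>
  under the bounded operator that extends \<open>[D, f] \<langle>D\<rangle>\<^bsup>-1/2\<^esup>\<close>.\<close>

lemma conv_op_in_Lip: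
  assumes f: "cont_supp f"
  shows "conv_op f \<in> Lip (1 / 2) D"
proof -
  note intf = integrable_cont_supp[OF f]
  have [measurable]: "f \<in> borel_measurable borel" by (rule cont_supp_measurable[OF f])
  let ?R = "bmult (scalar_field root_weight)"
  let ?K1 = "\<lambda>y x. root_weight (ldiv y x) *\<^sub>R comm_kernel f y x"
  let ?K2 = "\<lambda>y x. root_weight x *\<^sub>R comm_kernel f y x"
  obtain C where K1: "dominated_kernel (\<lambda>y. C * norm (f y)) ?K1" and K2: "dominated_kernel (\<lambda>y. C * norm (f y)) ?K2"
    using dominated_comm_kernel[OF f] by blast
  have Lm: "(\<lambda>y. L (ldiv y x)) \<in> borel_measurable borel" for x by measurable
  have km: "(\<lambda>y. comm_kernel f y x *v rep \<zeta> (ldiv y x)) \<in> borel_measurable borel" for \<zeta> x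
    unfolding comm_kernel_vector mat_vector_mult[symmetric] using Lm[of x] by measurable
  have km1: "(\<lambda>y. ?K1 y x *v rep \<zeta> (ldiv y x)) \<in> borel_measurable borel" for \<zeta> x
    unfolding matrix_vector_scaleR using km[of x \<zeta>] by measurable
  have int1: "(\<integral>y. comm_kernel f y x *v rep (?R \<zeta>) (ldiv y x) \<partial>lborel)
      = (\<integral>y. ?K1 y x *v rep \<zeta> (ldiv y x) \<partial>lborel)" for \<zeta> x
  proof (rule Bochner_Integration.integral_cong_AE)
    show "AE y in lborel. comm_kernel f y x *v rep (?R \<zeta>) (ldiv y x)
        = ?K1 y x *v rep \<zeta> (ldiv y x)"
      using AE_measure_scaling[OF measure_scaling_left_quotient rep_bmult[OF bounded_field_root_weight, of \<zeta>], of x]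
      by eventually_elim (simp add: matrix_vector_scaleR)
  qed (use km km1 in simp_all)
  have "blinfun_apply (conv_op f) ` Domain D \<subseteq> Domain D"
  proof clarify
    fix \<xi> \<xi>' assume D: "(\<xi>, \<xi>') \<in> D"
    obtain \<zeta> where \<zeta>: "\<xi> = ?R \<zeta>" using domain_D_root_weight[OF D] by blast
    have "AE x in lborel. rep (conv_op f \<xi>' + kernel_op ?K1 \<zeta>) x = L x *v rep (conv_op f \<xi>) x"
      using rep_L2_heis_add[of "conv_op f \<xi>'" "kernel_op ?K1 \<zeta>"] rep_kernel_op[OF K1, of \<zeta>]
        conv_op_commutator[OF intf D]
      by eventually_elim (simp add: \<zeta> int1 algebra_simps)
    then have "(conv_op f \<xi>, conv_op f \<xi>' + kernel_op ?K1 \<zeta>) \<in> D" by (simp add: mult_op_def)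
    then show "conv_op f \<xi> \<in> Domain D" by blast
  qed
  moreover have "bounded_extension (commutator D (conv_op f) \<odot> gr ?R) (kernel_op ?K1)"
    unfolding bounded_extension_def
  proof (intro conjI subrelI)
    show "bop (kernel_op ?K1)" by (rule bop_kernel_op[OF K1])
    fix \<zeta> \<eta> assume "(\<zeta>, \<eta>) \<in> commutator D (conv_op f) \<odot> gr ?R"
    then have "(?R \<zeta>, \<eta>) \<in> commutator D (conv_op f)" by (simp add: in_times_gr)
    from rep_commutator_conv_op[OF intf this] rep_kernel_op[OF K1, of \<zeta>]
    have "AE x in lborel. rep \<eta> x = rep (kernel_op ?K1 \<zeta>) x"
      by eventually_elim (simp add: int1)
    then have "\<eta> = kernel_op ?K1 \<zeta>" by (rule L2_heis_eqI)
    then show "(\<zeta>, \<eta>) \<in> gr (kernel_op ?K1)" by (simp add: gr_def)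
  qed
  moreover have "bounded_extension (gr ?R \<odot> commutator D (conv_op f)) (kernel_op ?K2)"
    unfolding bounded_extension_def
  proof (intro conjI subrelI)
    show "bop (kernel_op ?K2)" by (rule bop_kernel_op[OF K2])
    fix \<xi> \<eta>' assume "(\<xi>, \<eta>') \<in> gr ?R \<odot> commutator D (conv_op f)"
    then obtain \<eta> where \<eta>: "(\<xi>, \<eta>) \<in> commutator D (conv_op f)" "\<eta>' = ?R \<eta>" by (auto simp: in_gr_times)
    from rep_commutator_conv_op[OF intf \<eta>(1)] rep_kernel_op[OF K2, of \<xi>] rep_bmult[OF bounded_field_root_weight, of \<eta>]
    have "AE x in lborel. rep \<eta>' x = rep (kernel_op ?K2 \<xi>) x"
      by eventually_elim (simp add: matrix_vector_scaleR \<eta>(2))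
    then have "\<eta>' = kernel_op ?K2 \<xi>" by (rule L2_heis_eqI)
    then show "(\<xi>, \<eta>') \<in> gr (kernel_op ?K2)" by (simp add: gr_def)
  qed
  moreover have "bop (conv_op f)" unfolding conv_op_def by (rule bop_kernel_op[OF dominated_kernel_conv[OF intf]])
  ultimately show ?thesis unfolding Lip_def bracket_neg_power_D by blast
qed

end

section \<open>The second order spectral triple\<close>

lemma norm_blinfun_le_1I: "(\<And>x. norm (blinfun_apply U x) = norm x) \<Longrightarrow> norm U \<le> 1"
  by (rule norm_blinfun_bound) simp_all

lemma star_representation_left_regular: "star_representation left_regular_rep"
  unfolding star_representation_def left_regular_rep_def
  using carrier_bop[OF cstar_apply] carrier_is_adjoint[OF cstar_apply]
  by (simp add: plus_heis_cstar.rep_eq times_heis_cstar.rep_eq scaleC_heis_cstar.rep_eq star_heis_cstar.rep_eq)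

lemma conv_op_dense:
  assumes "0 < \<epsilon>"
  shows "\<exists>g. cont_supp g \<and> norm (left_regular_rep a - conv_op g) \<le> \<epsilon>"
  using cont_supp_dense_cstar[OF assms, of a] by (auto simp: left_regular_rep_def simp flip: rep_apply_left_regular)

context clifford
begin

lemma compact_resolvent: "compact_op (inv_one_plus_sq D o\<^sub>L left_regular_rep a)"
  unfolding inv_one_plus_sq_D
proof (rule compact_op_approx)
  fix \<epsilon> :: real assume \<epsilon>: "0 < \<epsilon>"
  obtain g where g: "cont_supp g" "norm (left_regular_rep a - conv_op g) \<le> \<epsilon>" using conv_op_dense[OF \<epsilon>] by blast
  let ?W = "bmult (scalar_field weight)"
  have "(?W o\<^sub>L left_regular_rep a) - (?W o\<^sub>L conv_op g) = ?W o\<^sub>L (left_regular_rep a - conv_op g)"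
    by (rule blinfun_eqI) (simp add: blinfun.diff_left blinfun.diff_right)
  also have "norm \<dots> \<le> norm ?W * norm (left_regular_rep a - conv_op g)" by (rule norm_blinfun_compose)
  also have "\<dots> \<le> 1 * \<epsilon>" using norm_bmult[OF bounded_field_weight] g(2) by (intro mult_mono) simp_all
  finally show "\<exists>T'. compact_op T' \<and> norm ((?W o\<^sub>L left_regular_rep a) - T') \<le> \<epsilon>"
    using compact_weight_conv_op[OF g(1)] by auto
qed

lemma left_regular_in_closure_Lip: "left_regular_rep a \<in> closure (Lip (1 / 2) D)"
  unfolding closure_approachable
proof (intro allI impI)
  fix e :: real assume "0 < e"
  then have e: "0 < e / 2" by simp
  obtain g where "cont_supp g" "norm (left_regular_rep a - conv_op g) \<le> e / 2" using conv_op_dense[OF e] by blast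
  then show "\<exists>y\<in>Lip (1 / 2) D. dist y (left_regular_rep a) < e"
    using conv_op_in_Lip \<open>0 < e\<close> by (intro bexI[of _ "conv_op g"]) (simp_all add: dist_norm norm_minus_commute)
qed

lemma spectral_triple_D: "spectral_triple (1 / 2) left_regular_rep D"
  unfolding spectral_triple_def
  using star_representation_left_regular selfadjoint_D compact_resolvent left_regular_in_closure_Lip by auto

end

section \<open>The dilation action\<close>

lemma L1_dil_compose: "L1_dil s (L1_dil t f) = L1_dil (s * t) f"
  by (rule ext) (simp add: L1_dil_def heis_dil_compose power_mult_distrib mult.commute inverse_mult_distrib)

lemma rep_dil_compose:
  assumes "0 < s" "0 < t" shows "rep_dil s (rep_dil t \<sigma>) = rep_dil (s * t) \<sigma>"
proof -
  have "rep_apply (rep_dil s (rep_dil t \<sigma>)) f = rep_apply (rep_dil (s * t) \<sigma>) f" for f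
    using assms by (simp add: rep_apply_rep_dil L1_dil_compose mult.commute)
  then show ?thesis by (metis rep_apply_inject ext)
qed

lemma rep_dil_1: "rep_dil 1 \<sigma> = \<sigma>"
proof -
  have "rep_apply (rep_dil 1 \<sigma>) f = rep_apply \<sigma> f" for f
    by (simp add: rep_apply_rep_dil L1_dil_def[abs_def])
  then show ?thesis by (metis rep_apply_inject ext)
qed

lemma cstar_dil_compose: "0 < s \<Longrightarrow> 0 < t \<Longrightarrow> cstar_dil s (cstar_dil t a) = cstar_dil (s * t) a"
  by (rule cstar_eqI) (simp add: cstar_apply_cstar_dil rep_dil_compose mult.commute)

lemma cstar_dil_1: "cstar_dil 1 a = a"
  by (rule cstar_eqI) (simp add: cstar_apply_cstar_dil rep_dil_1)

lemma star_automorphism_cstar_dil: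
  assumes t: "0 < t" shows "star_automorphism (cstar_dil t)"
proof -
  have "bij (cstar_dil t)"
    by (rule bij_betw_byWitness[where f' = "cstar_dil (inverse t)"]) (use t in \<open>auto simp: cstar_dil_compose cstar_dil_1\<close>)
  then show ?thesis
    unfolding star_automorphism_def using t
    by (auto intro!: cstar_eqI simp: cstar_apply_cstar_dil plus_heis_cstar.rep_eq times_heis_cstar.rep_eq
        scaleC_heis_cstar.rep_eq star_heis_cstar.rep_eq)
qed

text \<open>Approximate \<open>a\<close> by a continuous function of compact support, uniformly over all representations; the norm of
  its variation is bounded by the \<open>L\<^sup>1\<close> norm.\<close>

lemma continuous_cstar_dil: "continuous_on {0<..} (\<lambda>t. cstar_dil t a)"
proof (rule continuous_on_sequentiallyI)
  fix t :: "nat \<Rightarrow> real" and s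
  assume "\<forall>n. t n \<in> {0<..}" "s \<in> {0<..}" and lim: "t \<longlonglongrightarrow> s"
  then have t: "0 < t n" and s: "0 < s" for n by auto
  show "(\<lambda>n. cstar_dil (t n) a) \<longlonglongrightarrow> cstar_dil s a"
  proof (rule LIMSEQ_I)
    fix e :: real assume e: "0 < e"
    then have e4: "0 < e / 4" by simp
    obtain g where g: "cont_supp g" and ag: "\<And>\<sigma>. norm (cstar_apply a \<sigma> - rep_apply \<sigma> g) \<le> e / 4"
      using cont_supp_dense_cstar[OF e4] by blast
    note intg = integrable_cont_supp[OF g]
    let ?d = "\<lambda>n. \<integral>x. norm (L1_dil (t n) g x - L1_dil s g x) \<partial>lborel"
    have "(\<lambda>n. 1 / t n ^ 4) \<longlonglongrightarrow> 1 / s ^ 4" using s by (intro tendsto_intros lim) simp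
    from dilation_tendsto[OF g _ lim t s this, of 1] have "?d \<longlonglongrightarrow> 0"
      by (simp add: L1_dil_def scaleR_conv_of_real divide_inverse mult.commute)
    from LIMSEQ_D[OF this e4] obtain N where N: "\<And>n. N \<le> n \<Longrightarrow> norm (?d n - 0) < e / 4" by blast
    have "norm (cstar_dil (t n) a - cstar_dil s a) < e" if "N \<le> n" for n
    proof -
      have "norm (cstar_dil (t n) a - cstar_dil s a) \<le> 3 * (e / 4)"
      proof (rule norm_cstar_le)
        fix \<sigma>
        let ?x = "cstar_apply a (rep_dil (t n) \<sigma>)" and ?y = "cstar_apply a (rep_dil s \<sigma>)"
        let ?x' = "rep_apply \<sigma> (L1_dil (t n) g)" and ?y' = "rep_apply \<sigma> (L1_dil s g)"
        have "norm (?x - ?x') \<le> e / 4" using ag[of "rep_dil (t n) \<sigma>"] by (simp add: rep_apply_rep_dil t)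
        moreover have "norm (?y' - ?y) \<le> e / 4"
          using ag[of "rep_dil s \<sigma>"] by (simp add: rep_apply_rep_dil s norm_minus_commute)
        moreover have "norm (?x' - ?y') \<le> e / 4"
          using rep_apply_diff_le[OF integrable_L1_dil[OF t intg] integrable_L1_dil[OF s intg], of \<sigma> n] N[OF that] by simp
        ultimately have "norm ((?x - ?x') + (?x' - ?y') + (?y' - ?y)) \<le> e / 4 + e / 4 + e / 4"
          by (intro norm_triangle_mono)
        then show "norm (cstar_apply (cstar_dil (t n) a - cstar_dil s a) \<sigma>) \<le> 3 * (e / 4)"
          by (simp add: minus_heis_cstar.rep_eq cstar_apply_cstar_dil t s)
      qed
      also have "\<dots> < e" using e by simp
      finally show ?thesis .
    qed
    then show "\<exists>N. \<forall>n\<ge>N. norm (cstar_dil (t n) a - cstar_dil s a) < e" by blast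
  qed
qed

section \<open>The unitary representation of the dilations\<close>

lemma L2_dil_pullback: "L2_dil t = pullback (1 / t\<^sup>2) (heis_dil (inverse t))"
  by (simp add: L2_dil_def pullback_def)

lemma measure_scaling_L2_dil: "0 < t \<Longrightarrow> measure_scaling (1 / (1 / t\<^sup>2)\<^sup>2) (heis_dil (inverse t))"
  using measure_scaling_heis_dil[of "inverse t"] by (simp add: power_one_over power_inverse inverse_eq_divide flip: power_mult)

lemma rep_L2_dil:
  "0 < t \<Longrightarrow> AE x in lborel. rep (L2_dil t \<xi>) x = (1 / t\<^sup>2) *\<^sub>R rep \<xi> (heis_dil (inverse t) x)"
  unfolding L2_dil_pullback by (rule rep_pullback[OF measure_scaling_L2_dil])

lemma bop_L2_dil: "0 < t \<Longrightarrow> bop (L2_dil t)"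
  unfolding L2_dil_pullback by (rule bop_pullback[OF measure_scaling_L2_dil])

lemma cinner_L2_dil: "0 < t \<Longrightarrow> cinner (L2_dil t \<xi>) (L2_dil t \<eta>) = cinner \<xi> \<eta>"
  unfolding L2_dil_pullback by (rule cinner_pullback[OF measure_scaling_L2_dil])

lemma norm_L2_dil: "0 < t \<Longrightarrow> norm (L2_dil t \<xi>) = norm \<xi>"
  using cinner_L2_dil[of t \<xi> \<xi>] by (simp add: cinner_self flip: of_real_power)

lemma L2_dil_compose: "0 < s \<Longrightarrow> 0 < t \<Longrightarrow> L2_dil s (L2_dil t \<xi>) = L2_dil (s * t) \<xi>"
  unfolding L2_dil_pullback
  by (subst pullback_compose[OF measure_scaling_L2_dil measure_scaling_L2_dil])
    (simp_all add: heis_dil_compose power_mult_distrib mult.commute)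

lemma L2_dil_1: "L2_dil 1 \<xi> = \<xi>"
  by (simp add: L2_dil_pullback pullback_id)

lemma L2_dil_inverse: "0 < t \<Longrightarrow> L2_dil t (L2_dil (inverse t) \<xi>) = \<xi>" "0 < t \<Longrightarrow> L2_dil (inverse t) (L2_dil t \<xi>) = \<xi>"
  by (simp_all add: L2_dil_compose L2_dil_1)

lemma is_adjoint_L2_dil: "0 < t \<Longrightarrow> is_adjoint (L2_dil t) (L2_dil (inverse t))"
  unfolding is_adjoint_def using cinner_L2_dil[of t _ "L2_dil (inverse t) _"] by (simp add: L2_dil_inverse)

lemma adj_L2_dil: "0 < t \<Longrightarrow> adj (L2_dil t) = L2_dil (inverse t)"
  by (rule adj_eqI[OF is_adjoint_L2_dil])

lemma continuous_L2_dil: "continuous_on {0<..} (\<lambda>t. L2_dil t \<xi>)"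
proof (rule continuous_on_sequentiallyI)
  fix t :: "nat \<Rightarrow> real" and s
  assume "\<forall>n. t n \<in> {0<..}" "s \<in> {0<..}" and lim: "t \<longlonglongrightarrow> s"
  then have t: "0 < t n" and s: "0 < s" for n by auto
  show "(\<lambda>n. L2_dil (t n) \<xi>) \<longlonglongrightarrow> L2_dil s \<xi>"
  proof (rule LIMSEQ_I)
    fix e :: real assume e: "0 < e"
    then have e4: "0 < e / 4" by simp
    obtain g where g: "cont_supp g" and \<xi>g: "norm (\<xi> - abs_L2_heis g) \<le> e / 4"
      using cont_supp_dense_L2[OF e4] by blast
    note sq = square_integrable_cont_supp[OF g]
    have [measurable]: "g \<in> borel_measurable borel" by (rule cont_supp_measurable[OF g])
    define \<zeta> where "\<zeta> = abs_L2_heis g"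
    have rep: "AE x in lborel. rep (L2_dil r \<zeta>) x = (1 / r\<^sup>2) *\<^sub>R g (heis_dil (inverse r) x)" if "0 < r" for r
      using rep_L2_dil[OF that, of \<zeta>] AE_measure_scaling[OF measure_scaling_L2_dil[OF that] rep_abs_L2_heis[OF sq]]
      by eventually_elim (simp add: \<zeta>_def)
    have "(norm (L2_dil (t n) \<zeta> - L2_dil s \<zeta>))\<^sup>2
        = (\<integral>x. (norm ((1 / (t n)\<^sup>2) *\<^sub>R g (heis_dil (inverse (t n)) x) - (1 / s\<^sup>2) *\<^sub>R g (heis_dil (inverse s) x)))\<^sup>2 \<partial>lborel)" for n
      unfolding norm_L2_heis_eq
    proof (rule Bochner_Integration.integral_cong_AE)
      show "AE x in lborel. (norm (rep (L2_dil (t n) \<zeta> - L2_dil s \<zeta>) x))\<^sup>2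
        = (norm ((1 / (t n)\<^sup>2) *\<^sub>R g (heis_dil (inverse (t n)) x) - (1 / s\<^sup>2) *\<^sub>R g (heis_dil (inverse s) x)))\<^sup>2"
        using rep_L2_heis_diff[of "L2_dil (t n) \<zeta>" "L2_dil s \<zeta>"] rep[OF t[of n]] rep[OF s]
        by eventually_elim simp
    qed measurable
    moreover have "(\<lambda>n. 1 / (t n)\<^sup>2) \<longlonglongrightarrow> 1 / s\<^sup>2" using s by (intro tendsto_intros lim) simp
    from dilation_tendsto[OF g _ lim t s this, of 2]
    have "(\<lambda>n. \<integral>x. (norm ((1 / (t n)\<^sup>2) *\<^sub>R g (heis_dil (inverse (t n)) x) - (1 / s\<^sup>2) *\<^sub>R g (heis_dil (inverse s) x)))\<^sup>2 \<partial>lborel) \<longlonglongrightarrow> 0"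
      by simp
    ultimately have "(\<lambda>n. (norm (L2_dil (t n) \<zeta> - L2_dil s \<zeta>))\<^sup>2) \<longlonglongrightarrow> 0" by simp
    from tendsto_real_sqrt[OF this] have "(\<lambda>n. norm (L2_dil (t n) \<zeta> - L2_dil s \<zeta>)) \<longlonglongrightarrow> 0" by simp
    from LIMSEQ_D[OF this e4] obtain N where N: "\<And>n. N \<le> n \<Longrightarrow> norm (L2_dil (t n) \<zeta> - L2_dil s \<zeta>) < e / 4" by auto
    have "norm (L2_dil (t n) \<xi> - L2_dil s \<xi>) < e" if "N \<le> n" for n
    proof -
      have "norm (L2_dil r \<xi> - L2_dil r \<zeta>) \<le> e / 4" if "0 < r" for r
        using \<xi>g norm_L2_dil[OF that, of "\<xi> - \<zeta>"] by (simp add: \<zeta>_def blinfun.diff_right)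
      from this[OF t[of n]] this[OF s] N[OF that]
      have "norm ((L2_dil (t n) \<xi> - L2_dil (t n) \<zeta>) + (L2_dil (t n) \<zeta> - L2_dil s \<zeta>) + (L2_dil s \<zeta> - L2_dil s \<xi>)) \<le> e / 4 + e / 4 + e / 4"
        by (intro norm_triangle_mono) (simp_all add: norm_minus_commute)
      then show ?thesis using e by simp
    qed
    then show "\<exists>N. \<forall>n\<ge>N. norm (L2_dil (t n) \<xi> - L2_dil s \<xi>) < e" by blast
  qed
qed

lemma L2_dil_transl:
  assumes t: "0 < t"
  shows "L2_dil t (transl y (L2_dil (inverse t) \<xi>)) = transl (heis_dil t y) \<xi>"
proof (rule L2_heis_eqI)
  have it: "0 < inverse t" using t by simp
  have "AE x in lborel. rep (transl y (L2_dil (inverse t) \<xi>)) x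
      = t\<^sup>2 *\<^sub>R rep \<xi> (heis_dil t (ldiv y x))"
    using rep_transl[of y "L2_dil (inverse t) \<xi>"] AE_measure_scaling[OF measure_scaling_heis_mult rep_L2_dil[OF it, of \<xi>], of "heis_inv y"]
    by eventually_elim (simp add: power_inverse divide_inverse)
  from rep_L2_dil[OF t, of "transl y (L2_dil (inverse t) \<xi>)"] AE_measure_scaling[OF measure_scaling_L2_dil[OF t] this]
    rep_transl[of "heis_dil t y" \<xi>]
  show "AE x in lborel. rep (L2_dil t (transl y (L2_dil (inverse t) \<xi>))) x = rep (transl (heis_dil t y) \<xi>) x"
    by eventually_elim (use t in \<open>simp add: heis_dil_mult heis_dil_inv heis_dil_compose\<close>)
qed

text \<open>Conjugation with \<open>U\<^sub>t\<close> turns \<open>\<lambda>(y)\<close> into \<open>\<lambda>(\<delta>\<^sub>t y)\<close>; substitute in the weak formula for the convolution.\<close>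

lemma conv_op_L1_dil:
  assumes t: "0 < t" and f: "integrable lborel f"
  shows "conv_op (L1_dil t f) = L2_dil t o\<^sub>L conv_op f o\<^sub>L L2_dil (inverse t)"
proof (rule blinfun_eqI, rule cinner_eqI)
  fix \<xi> \<eta>
  have [measurable]: "f \<in> borel_measurable borel" using borel_measurable_integrable[OF f] by simp
  have adj: "cinner \<eta> (L2_dil t \<zeta>) = cinner (L2_dil (inverse t) \<eta>) \<zeta>" for \<eta> \<zeta>
    using is_adjoint_sym[OF is_adjoint_L2_dil[OF t]] by (simp add: is_adjoint_def)
  have "cinner \<eta> ((L2_dil t o\<^sub>L conv_op f o\<^sub>L L2_dil (inverse t)) \<xi>)
      = (\<integral>y. f y * coefficient (L2_dil (inverse t) \<eta>) (L2_dil (inverse t) \<xi>) y \<partial>lborel)"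
    by (simp add: adj cinner_conv_op[OF f])
  also have "\<dots> = (\<integral>y. f (heis_dil (inverse t) (heis_dil t y)) * coefficient \<eta> \<xi> (heis_dil t y) \<partial>lborel)"
    using t by (simp add: coefficient_def heis_dil_compose flip: adj L2_dil_transl)
  also have "\<dots> = (1 / t ^ 4) *\<^sub>R (\<integral>y. f (heis_dil (inverse t) y) * coefficient \<eta> \<xi> y \<partial>lborel)"
    by (rule integral_measure_scaling[OF measure_scaling_heis_dil[OF t]]) measurable
  also have "\<dots> = (\<integral>y. L1_dil t f y * coefficient \<eta> \<xi> y \<partial>lborel)"
    by (simp add: L1_dil_def scaleR_conv_of_real)
  finally show "cinner \<eta> (conv_op (L1_dil t f) \<xi>) = cinner \<eta> ((L2_dil t o\<^sub>L conv_op f o\<^sub>L L2_dil (inverse t)) \<xi>)"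
    by (simp add: cinner_conv_op[OF integrable_L1_dil[OF t f]])
qed

lemma left_regular_covariant:
  assumes t: "0 < t"
  shows "left_regular_rep (cstar_dil t a) = L2_dil t o\<^sub>L left_regular_rep a o\<^sub>L L2_dil (inverse t)" (is "?l = ?r")
proof -
  have it: "0 < inverse t" using t by simp
  have "norm (?l - ?r) \<le> \<epsilon>" if "0 < \<epsilon>" for \<epsilon>
  proof -
    have e: "0 < \<epsilon> / 2" using that by simp
    obtain f where f: "integrable lborel f" and af: "\<And>\<sigma>. norm (cstar_apply a \<sigma> - rep_apply \<sigma> f) \<le> \<epsilon> / 2"
      using cstar_carrierD[OF cstar_apply e] by blast
    let ?m = "L2_dil t o\<^sub>L conv_op f o\<^sub>L L2_dil (inverse t)"
    have "norm (?l - ?m) \<le> \<epsilon> / 2"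
      using af[of "rep_dil t left_regular"]
      by (simp add: left_regular_rep_def cstar_apply_cstar_dil t rep_apply_rep_dil rep_apply_left_regular conv_op_L1_dil f)
    moreover have "norm (?m - ?r) \<le> \<epsilon> / 2"
    proof -
      have "?m - ?r = L2_dil t o\<^sub>L ((conv_op f - left_regular_rep a) o\<^sub>L L2_dil (inverse t))"
        by (rule blinfun_eqI) (simp add: blinfun.diff_left blinfun.diff_right)
      also have "norm \<dots> \<le> norm (L2_dil t) * norm ((conv_op f - left_regular_rep a) o\<^sub>L L2_dil (inverse t))"
        by (rule norm_blinfun_compose)
      also have "\<dots> \<le> 1 * (norm (conv_op f - left_regular_rep a) * norm (L2_dil (inverse t)))"
        by (intro mult_mono norm_blinfun_compose norm_blinfun_le_1I norm_L2_dil t) simp_all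
      also have "\<dots> \<le> 1 * (\<epsilon> / 2 * 1)"
        using af[of left_regular] e
        by (intro mult_mono norm_blinfun_le_1I norm_L2_dil it)
          (simp_all add: left_regular_rep_def rep_apply_left_regular norm_minus_commute)
      finally show ?thesis by simp
    qed
    ultimately have "norm ((?l - ?m) + (?m - ?r)) \<le> \<epsilon> / 2 + \<epsilon> / 2" by (rule norm_triangle_mono)
    then show ?thesis by simp
  qed
  then have "norm (?l - ?r) \<le> 0" by (rule field_le_epsilon[of _ 0, simplified])
  then show ?thesis by simp
qed

section \<open>The group of positive reals\<close>

lemma group_pos_reals: "group pos_reals"
proof (rule groupI)
  fix x assume "x \<in> carrier pos_reals"
  then show "\<exists>y\<in>carrier pos_reals. y \<otimes>\<^bsub>pos_reals\<^esub> x = \<one>\<^bsub>pos_reals\<^esub>"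
    by (intro bexI[of _ "inverse x"]) (simp_all add: pos_reals_def)
qed (simp_all add: pos_reals_def)

lemma inv_pos_reals: "0 < x \<Longrightarrow> inv\<^bsub>pos_reals\<^esub> x = inverse x"
  by (rule group.inv_equality[OF group_pos_reals]) (simp_all add: pos_reals_def)

lemma locally_compact_group_pos_reals: "locally_compact_group pos_reals (top_of_set {0<..})"
  unfolding locally_compact_group_def
proof (intro conjI group_pos_reals)
  show "topspace (top_of_set {0<..}) = carrier pos_reals" by (simp add: pos_reals_def)
  show "Hausdorff_space (top_of_set {0 :: real<..})" by (simp add: Hausdorff_space_subtopology)
  show "locally_compact_space (top_of_set {0 :: real<..})"
    by (intro locally_compact_space_open_subset) (simp_all add: locally_compact_space_euclidean)
  have "continuous_on ({0<..} \<times> {0 :: real<..}) (\<lambda>p. fst p * snd p)" by (intro continuous_intros)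
  then show "continuous_map (prod_topology (top_of_set {0<..}) (top_of_set {0<..})) (top_of_set {0<..}) (\<lambda>(g, h). g \<otimes>\<^bsub>pos_reals\<^esub> h)"
    by (auto simp: continuous_map_in_subtopology case_prod_beta pos_reals_def simp flip: subtopology_Times euclidean_product_topology)
  have "continuous_on {0<..} (\<lambda>g. inv\<^bsub>pos_reals\<^esub> g)"
    by (rule continuous_on_eq[of _ inverse]) (auto intro!: continuous_intros simp: inv_pos_reals)
  then show "continuous_map (top_of_set {0<..}) (top_of_set {0<..}) (\<lambda>g. inv\<^bsub>pos_reals\<^esub> g)"
    by (simp add: continuous_map_in_subtopology image_subset_iff inv_pos_reals Pi_iff)
qed

lemma cstar_action_dil: "cstar_action pos_reals (top_of_set {0<..}) cstar_dil"
  unfolding cstar_action_def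
  using star_automorphism_cstar_dil continuous_cstar_dil
  by (auto simp: pos_reals_def fun_eq_iff cstar_dil_1 cstar_dil_compose)

lemma unitary_representation_dil: "unitary_representation pos_reals (top_of_set {0<..}) L2_dil"
  unfolding unitary_representation_def
proof (intro conjI ballI)
  fix t assume "t \<in> carrier pos_reals"
  then have t: "0 < t" by (simp add: pos_reals_def)
  have "surj (blinfun_apply (L2_dil t))" by (rule surjI[of _ "L2_dil (inverse t)"]) (simp add: L2_dil_inverse t)
  then show "unitary_op (L2_dil t)" by (simp add: unitary_op_def bop_L2_dil cinner_L2_dil t)
  fix s assume "s \<in> carrier pos_reals"
  then show "L2_dil (t \<otimes>\<^bsub>pos_reals\<^esub> s) = L2_dil t o\<^sub>L L2_dil s"
    using t by (intro blinfun_eqI) (simp add: L2_dil_compose pos_reals_def)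
next
  show "L2_dil \<one>\<^bsub>pos_reals\<^esub> = id_blinfun" by (rule blinfun_eqI) (simp add: pos_reals_def L2_dil_1)
  show "strongly_continuous (top_of_set {0<..}) L2_dil"
    using continuous_L2_dil by (simp add: strongly_continuous_def)
qed

section \<open>Conformal equivariance\<close>

lemma is_adjoint_scaleR_id: "is_adjoint (r *\<^sub>R id_blinfun) (r *\<^sub>R id_blinfun :: 'h::chilbert_space \<Rightarrow>\<^sub>L 'h)"
  by (simp add: is_adjoint_def blinfun.scaleR_left cinner_scaleR_left cinner_scaleR_right)

lemma adj_scaleR_id: "adj (r *\<^sub>R id_blinfun) = (r *\<^sub>R id_blinfun :: 'h::chilbert_space \<Rightarrow>\<^sub>L 'h)"
  by (rule adj_eqI[OF is_adjoint_scaleR_id])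

lemma bop_scaleR_id: "bop (r *\<^sub>R id_blinfun :: 'h::chilbert_space \<Rightarrow>\<^sub>L 'h)"
  by (simp add: bop_def blinfun.scaleR_left scaleR_scaleC scaleC_scaleC mult.commute)

lemma inverse_scaleR_id:
  fixes S :: "'h::chilbert_space \<Rightarrow>\<^sub>L 'h"
  assumes "r \<noteq> 0"
  shows "S o\<^sub>L (r *\<^sub>R id_blinfun) = id_blinfun \<and> (r *\<^sub>R id_blinfun) o\<^sub>L S = id_blinfun \<longleftrightarrow> S = (1 / r) *\<^sub>R id_blinfun"
proof
  assume "S o\<^sub>L (r *\<^sub>R id_blinfun) = id_blinfun \<and> (r *\<^sub>R id_blinfun) o\<^sub>L S = id_blinfun"
  then have "r *\<^sub>R S x = x" for x
    by (metis blinfun_apply_blinfun_compose blinfun_apply_id_blinfun blinfun.scaleR_left)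
  then have "S x = (1 / r) *\<^sub>R x" for x
    using assms by (metis divide_inverse mult_1 pth_1 scaleR_scaleR nonzero_divide_eq_eq)
  then show "S = (1 / r) *\<^sub>R id_blinfun" by (intro blinfun_eqI) (simp add: blinfun.scaleR_left)
qed (use assms in \<open>auto intro!: blinfun_eqI simp: blinfun.scaleR_left blinfun.scaleR_right\<close>)

lemma invertible_scaleR_id: "r \<noteq> 0 \<Longrightarrow> invertible_op (r *\<^sub>R id_blinfun :: 'h::chilbert_space \<Rightarrow>\<^sub>L 'h)"
  unfolding invertible_op_def by (simp add: inverse_scaleR_id)

lemma inv_op_scaleR_id: "r \<noteq> 0 \<Longrightarrow> inv_op (r *\<^sub>R id_blinfun) = ((1 / r) *\<^sub>R id_blinfun :: 'h::chilbert_space \<Rightarrow>\<^sub>L 'h)"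
  unfolding inv_op_def by (simp add: inverse_scaleR_id)

lemma is_adjoint_zero: "adj 0 = (0 :: 'h::chilbert_space \<Rightarrow>\<^sub>L 'h)"
  by (rule adj_eqI) (simp add: is_adjoint_def)

lemma star_strongly_continuous_extension_zero:
  fixes F :: "'g \<Rightarrow> 'h::chilbert_space oper"
  assumes "\<And>g x z. g \<in> topspace X \<Longrightarrow> (x, z) \<in> F g \<Longrightarrow> z = 0"
  shows "star_strongly_continuous_extension X F"
  unfolding star_strongly_continuous_extension_def
proof (intro exI[of _ "\<lambda>_. 0"] conjI ballI)
  fix g assume "g \<in> topspace X"
  then show "bounded_extension (F g) 0" using assms by (auto simp: bounded_extension_def bop_def gr_def)
next
  show "star_strongly_continuous X (\<lambda>g. 0 :: 'h \<Rightarrow>\<^sub>L 'h)"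
    by (simp add: star_strongly_continuous_def strongly_continuous_def is_adjoint_zero)
qed

lemma mult_op_scaleR:
  assumes "(\<xi>, \<xi>') \<in> mult_op m" shows "(r *\<^sub>R \<xi>, r *\<^sub>R \<xi>') \<in> mult_op m"
  using assms rep_L2_heis_scaleR[of r \<xi>] rep_L2_heis_scaleR[of r \<xi>']
  unfolding mult_op_def mem_Collect_eq case_prod_conv
  by eventually_elim (simp add: matrix_vector_scaleR)

context clifford
begin

lemma ell_dil: "0 \<le> t \<Longrightarrow> L (heis_dil t x) = t\<^sup>2 *\<^sub>R L x"
proof -
  assume t: "0 \<le> t"
  obtain a b c where x: "x = (a, b, c)" by (cases x)
  have "sqrt ((t * a)\<^sup>2 + (t * b)\<^sup>2) = sqrt (t\<^sup>2 * (a\<^sup>2 + b\<^sup>2))" by (simp add: power_mult_distrib distrib_left)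
  also have "\<dots> = t * sqrt (a\<^sup>2 + b\<^sup>2)" using t by (simp add: real_sqrt_mult)
  finally show ?thesis
    by (simp add: x heis_dil_def ell_def scaleR_add_right power2_eq_square mult_ac)
qed

text \<open>\<open>D U\<^sub>t = t\<^sup>2 U\<^sub>t D\<close> on the domain.\<close>

lemma L2_dil_domain:
  assumes t: "0 < t" and D: "(\<xi>, \<xi>') \<in> D"
  shows "(L2_dil t \<xi>, t\<^sup>2 *\<^sub>R L2_dil t \<xi>') \<in> D"
proof -
  have "AE x in lborel. rep \<xi>' x = L x *v rep \<xi> x" using D by (simp add: mult_op_def)
  from AE_measure_scaling[OF measure_scaling_L2_dil[OF t] this] rep_L2_dil[OF t, of \<xi>] rep_L2_dil[OF t, of \<xi>']
    rep_L2_heis_scaleR[of "t\<^sup>2" "L2_dil t \<xi>'"]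
  have "AE x in lborel. rep (t\<^sup>2 *\<^sub>R L2_dil t \<xi>') x = L x *v rep (L2_dil t \<xi>) x"
    by eventually_elim (use t in \<open>simp add: ell_dil matrix_vector_scaleR power_inverse divide_inverse\<close>)
  then show ?thesis by (simp add: mult_op_def)
qed

lemma commutator_scalar: "(x, z) \<in> commutator D (r *\<^sub>R id_blinfun) \<Longrightarrow> z = 0"
  unfolding in_commutator_iff using mult_op_scaleR mult_op_unique by (fastforce simp: blinfun.scaleR_left)

text \<open>Both \<open>U\<^sub>t D U\<^sub>t\<^sup>*\<close> and \<open>\<mu>\<^sub>t D \<mu>\<^sub>t\<^sup>*\<close> equal \<open>t\<^sup>-\<^sup>2 D\<close>.\<close>

lemma conformal_defect_id:
  assumes t: "0 < t" and d: "(x, z) \<in> conformal_defect D L2_dil (\<lambda>t. (1 / t) *\<^sub>R id_blinfun) id_blinfun t"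
  shows "z = 0"
proof -
  obtain y w where y: "(L2_dil (inverse t) x, y) \<in> D" and w: "((1 / t) *\<^sub>R x, w) \<in> D" and z: "z = L2_dil t y - (1 / t) *\<^sub>R w"
    using d t by (auto simp: conformal_defect_def op_minus_def op_times_def gr_def adj_L2_dil adj_scaleR_id blinfun.scaleR_left)
  have "(t *\<^sub>R (1 / t) *\<^sub>R x, t *\<^sub>R w) \<in> D" by (rule mult_op_scaleR[OF w])
  then have "(x, t *\<^sub>R w) \<in> D" using t by simp
  from L2_dil_domain[OF _ this, of "inverse t"] t
  have "(L2_dil (inverse t) x, (inverse t)\<^sup>2 *\<^sub>R L2_dil (inverse t) (t *\<^sub>R w)) \<in> D" by simp
  from mult_op_unique[OF y this] have "L2_dil t y = (inverse t)\<^sup>2 *\<^sub>R t *\<^sub>R w"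
    using t by (simp add: blinfun.scaleR_right L2_dil_inverse)
  then show ?thesis using t by (simp add: z power2_eq_square divide_inverse)
qed

lemma id_in_Lip: "id_blinfun \<in> Lip (1 / 2) D"
proof -
  have c: "(x, z) \<in> commutator D id_blinfun \<Longrightarrow> z = 0" for x z using commutator_scalar[of x z 1] by simp
  have "bounded_extension (commutator D id_blinfun \<odot> gr R) 0" "bounded_extension (gr R \<odot> commutator D id_blinfun) 0" for R
    by (auto simp: bounded_extension_def bop_def gr_def op_times_def dest!: c)
  moreover have "bop (id_blinfun :: L2_heis \<Rightarrow>\<^sub>L L2_heis)" by (simp add: bop_def)
  ultimately show ?thesis unfolding Lip_def by auto
qed

text \<open>All operators whose extensions are asked for vanish where they are defined, so the zero operator extends
  them.\<close>

lemma id_conformal_multiplier: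
  "id_blinfun \<in> conformal_multipliers (1 / 2) pos_reals (top_of_set {0<..}) D L2_dil (\<lambda>t. (1 / t) *\<^sub>R id_blinfun)"
proof -
  have \<nu>: "adj (inv_op ((1 / t) *\<^sub>R id_blinfun)) = (t *\<^sub>R id_blinfun :: L2_heis \<Rightarrow>\<^sub>L L2_heis)" if "0 < t" for t
    using that by (simp add: inv_op_scaleR_id adj_scaleR_id)
  have comp: "id_blinfun o\<^sub>L T = T" for T :: "L2_heis \<Rightarrow>\<^sub>L L2_heis" by (rule blinfun_eqI) simp
  have dom: "(r *\<^sub>R id_blinfun) ` Domain D \<subseteq> Domain D \<inter> L2_dil t ` Domain D" if t: "0 < t" for r t
  proof clarify
    fix \<xi> \<xi>' assume "(\<xi>, \<xi>') \<in> D"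
    from mult_op_scaleR[OF this, of r] have r: "(r *\<^sub>R \<xi>, r *\<^sub>R \<xi>') \<in> D" .
    have "L2_dil (inverse t) (r *\<^sub>R \<xi>) \<in> Domain D"
      using L2_dil_domain[OF _ r, of "inverse t"] t by auto
    then have "L2_dil t (L2_dil (inverse t) (r *\<^sub>R \<xi>)) \<in> L2_dil t ` Domain D" by (rule imageI)
    then show "(r *\<^sub>R id_blinfun) \<xi> \<in> Domain D \<inter> L2_dil t ` Domain D"
      using r t by (auto simp: blinfun.scaleR_left L2_dil_inverse)
  qed
  show ?thesis
    unfolding conformal_multipliers_def Let_def
  proof (intro CollectI conjI ballI id_in_Lip)
    fix t assume "t \<in> carrier pos_reals"
    then have "0 < t" by (simp add: pos_reals_def)
    then show "(id_blinfun o\<^sub>L (1 / t) *\<^sub>R id_blinfun) ` Domain D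
        \<union> (id_blinfun o\<^sub>L adj (inv_op ((1 / t) *\<^sub>R id_blinfun))) ` Domain D \<subseteq> Domain D \<inter> L2_dil t ` Domain D"
      using dom by (simp add: comp \<nu>)
  qed (intro star_strongly_continuous_extension_zero,
      auto simp: op_times_def gr_def comp \<nu> dest!: commutator_scalar conformal_defect_id)+
qed

lemma conformally_equivariant:
  "conformally_equivariant_spectral_triple (1 / 2) pos_reals (top_of_set {0<..}) cstar_dil
     left_regular_rep D L2_dil (\<lambda>t. (1 / t) *\<^sub>R id_blinfun)"
  unfolding conformally_equivariant_spectral_triple_def Let_def
proof (intro conjI ballI allI spectral_triple_D locally_compact_group_pos_reals cstar_action_dil unitary_representation_dil
    bop_scaleR_id)
  fix t a assume "t \<in> carrier pos_reals"
  then have t: "0 < t" by (simp add: pos_reals_def)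
  then show "left_regular_rep (cstar_dil t a) = L2_dil t o\<^sub>L left_regular_rep a o\<^sub>L adj (L2_dil t)"
    by (simp add: left_regular_covariant adj_L2_dil)
next
  fix t assume "t \<in> carrier pos_reals"
  then show "invertible_op ((1 / t) *\<^sub>R id_blinfun :: L2_heis \<Rightarrow>\<^sub>L L2_heis)"
    by (intro invertible_scaleR_id) (simp add: pos_reals_def)
next
  show "star_strongly_continuous (top_of_set {0<..}) (\<lambda>t. (1 / t) *\<^sub>R id_blinfun :: L2_heis \<Rightarrow>\<^sub>L L2_heis)"
    by (auto simp: star_strongly_continuous_def strongly_continuous_def adj_scaleR_id blinfun.scaleR_left
        intro!: continuous_intros)
next
  let ?Q = "conformal_multipliers (1 / 2) pos_reals (top_of_set {0<..}) D L2_dil (\<lambda>t. (1 / t) *\<^sub>R id_blinfun)"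
  have "left_regular_rep a \<in> {left_regular_rep a o\<^sub>L q |a q. q \<in> ?Q}" for a
    using id_conformal_multiplier by (auto intro!: exI[of _ a] exI[of _ id_blinfun] blinfun_eqI)
  moreover have "left_regular_rep a \<in> {q o\<^sub>L left_regular_rep a |a q. q \<in> ?Q}" for a
    using id_conformal_multiplier by (auto intro!: exI[of _ a] exI[of _ id_blinfun] blinfun_eqI)
  ultimately show "range left_regular_rep \<subseteq> closure (span {left_regular_rep a o\<^sub>L q |a q. q \<in> ?Q})
      \<inter> closure (span {q o\<^sub>L left_regular_rep a |a q. q \<in> ?Q})"
    by (intro Int_greatest subsetI; elim rangeE) (meson closure_subset span_base subsetD)+
qed

end

theorem proposition3p28:
  fixes \<gamma>1 \<gamma>2 \<gamma>3 :: "complex^2^2"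
  assumes "clifford_generators \<gamma>1 \<gamma>2 \<gamma>3"
  shows "conformally_equivariant_spectral_triple (1/2)
    pos_reals (top_of_set {0<..}) cstar_dil
    left_regular_rep (mult_op (ell \<gamma>1 \<gamma>2 \<gamma>3)) L2_dil (\<lambda>t. (1 / t) *\<^sub>R id_blinfun)"
proof -
  interpret clifford \<gamma>1 \<gamma>2 \<gamma>3 by (rule clifford.intro[OF assms])
  show ?thesis by (rule conformally_equivariant)
qed

end
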